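(* Let $L$ be a principal ideal domain without $2$-torsion, and suppose that $L$ does not contain $1/2$ (i.e. $2$ is not invertible in $L$). Then for $n\geq5$ there is no crossed homomorphism $\mathrm{Aut}\,F_n\to V_L$ whose restriction to $\mathrm{IA}_n$ coincides with $\tau_{1,L}$.
   Context: $F_n$ is the free group of rank $n$; $\mathrm{Aut}\,F_n$ acts on $F_n$ from the right, written $x^{\sigma}$, so $x^{\sigma\tau}=(x^\sigma)^\tau$. $H$ is the abelianization of $F_n$, $[x]\in H$ is the class of $x\in F_n$, and $H^*=\mathrm{Hom}_{\mathbf{Z}}(H,\mathbf{Z})$. $H$ is a left $\mathrm{Aut}\,F_n$-module via $\sigma\cdot[x]:=[x^{\sigma^{-1}}]$; $H^*$ carries the dual action, and $H^*\otimes_{\mathbf{Z}}\Lambda^2H$ the induced diagonal action. $\mathrm{IA}_n$ is the kernel of the natural homomorphism $\mathrm{Aut}\,F_n\to\mathrm{Aut}\,H$. The first Johnson homomorphism is $\tau_1:\mathrm{IA}_n\to\mathrm{Hom}_{\mathbf{Z}}(H,\Lambda^2H)=H^*\otimes_{\mathbf{Z}}\Lambda^2H$, $\sigma\mapsto([x]\mapsto x^{-1}x^\sigma)$. Here the class of $x^{-1}x^\sigma\in[F_n,F_n]$ is taken in $[F_n,F_n]/[F_n,[F_n,F_n]]\cong\Lambda^2H$, the class of $[x,y]=xyx^{-1}y^{-1}$ corresponding to $[x]\wedge[y]$. The map $\tau_1$ induces an isomorphism of $\mathrm{GL}(n,\mathbf{Z})$-modules (known result) by which $V:=\mathrm{IA}_n^{\mathrm{ab}}$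 is identified with $H^*\otimes_{\mathbf{Z}}\Lambda^2H$. $V_L:=V\otimes_{\mathbf{Z}}L$ with $L$ a trivial $\mathrm{Aut}\,F_n$-module, and $\tau_{1,L}:\mathrm{IA}_n\to V_L$ is the composition of $\tau_1$ with the natural map $V\to V_L$. A crossed homomorphism $f:\mathrm{Aut}\,F_n\to V_L$ satisfies $f(\sigma\tau)=f(\sigma)+\sigma\cdot f(\tau)$. "Without $2$-torsion" means that $2a=0$ with $a\in L$ implies $a=0$. *)

theory Defs
  imports "HOL-Algebra.Algebra"
begin

section \<open>Free groups\<close>

text \<open>A letter \<open>(True, i)\<close> stands for the generator \<open>x\<^sub>i\<close> and \<open>(False, i)\<close> for its inverse.
  Group elements are the reduced words in the letters with index below \<open>n\<close>.\<close>

type_synonym letter = "bool \<times> nat"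

definition inv_letter :: "letter \<Rightarrow> letter" where
  "inv_letter a = (\<not> fst a, snd a)"

fun cons_red :: "letter \<Rightarrow> letter list \<Rightarrow> letter list" where
  "cons_red a [] = [a]"
| "cons_red a (b # w) = (if b = inv_letter a then w else a # b # w)"

definition reduced :: "letter list \<Rightarrow> bool" where
  "reduced = successively (\<lambda>a b. b \<noteq> inv_letter a)"

definition free_grp :: "nat \<Rightarrow> letter list monoid" where
  "free_grp n = \<lparr>carrier = {w. reduced w \<and> snd ` set w \<subseteq> {..<n}},
                 monoid.mult = (\<lambda>u v. foldr cons_red u v), one = []\<rparr>"

lemma inv_letter_inv_letter [simp]: "inv_letter (inv_letter a) = a"
  and inv_letter_neq [simp]: "inv_letter a \<noteq> a" "a \<noteq> inv_letter a"
  and snd_inv_letter [simp]: "snd (inv_letter a) = snd a"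
  by (auto simp: inv_letter_def prod_eq_iff)

lemma inv_letter_inject [simp]: "inv_letter a = inv_letter b \<longleftrightarrow> a = b"
  by (metis inv_letter_inv_letter)

lemma reduced_simps [simp]:
  "reduced []" "reduced [a]" "reduced (a # b # w) \<longleftrightarrow> b \<noteq> inv_letter a \<and> reduced (b # w)"
  by (auto simp: reduced_def)

lemma reduced_ConsD: "reduced (a # w) \<Longrightarrow> reduced w"
  by (cases w) auto

lemma reduced_cons_red: "reduced w \<Longrightarrow> reduced (cons_red a w)"
  by (cases w) (auto dest: reduced_ConsD)

lemma cons_red_cancel: "reduced w \<Longrightarrow> cons_red a (cons_red (inv_letter a) w) = w"
  by (cases w; cases "tl w") auto

lemma reduced_foldr: "reduced v \<Longrightarrow> reduced (foldr cons_red u v)"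
  by (induction u) (auto intro: reduced_cons_red)

lemma set_cons_red: "set (cons_red a w) \<subseteq> insert a (set w)"
  by (cases w) auto

lemma set_foldr_cons_red: "set (foldr cons_red u v) \<subseteq> set u \<union> set v"
proof (induction u)
  case (Cons a u)
  then show ?case using set_cons_red[of a "foldr cons_red u v"] by auto
qed simp

lemma foldr_cons_red_cons_red:
  "reduced w \<Longrightarrow> foldr cons_red (cons_red a v) w = cons_red a (foldr cons_red v w)"
proof (cases v)
  case (Cons b v')
  assume "reduced w"
  with Cons show ?thesis
    using cons_red_cancel[OF reduced_foldr[of w v'], of a] by auto
qed simp

lemma foldr_cons_red_assoc:
  "reduced w \<Longrightarrow> foldr cons_red (foldr cons_red u v) w = foldr cons_red u (foldr cons_red v w)"
  by (induction u) (auto simp: foldr_cons_red_cons_red)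

lemma foldr_cons_red_Nil: "reduced w \<Longrightarrow> foldr cons_red w [] = w"
proof (induction w)
  case (Cons a w)
  then show ?case by (cases w) (auto dest: reduced_ConsD)
qed simp

lemma reduced_inverse: "reduced w \<Longrightarrow> reduced (rev (map inv_letter w))"
  by (auto simp: reduced_def successively_rev successively_map elim!: successively_mono)

lemma foldr_cons_red_inverse: "foldr cons_red (rev (map inv_letter w)) w = []"
  by (induction w) auto

lemma group_free_grp: "group (free_grp n)"
proof (rule groupI)
  fix x y assume "x \<in> carrier (free_grp n)" "y \<in> carrier (free_grp n)"
  then show "x \<otimes>\<^bsub>free_grp n\<^esub> y \<in> carrier (free_grp n)"
    using set_foldr_cons_red[of x y] by (fastforce simp: free_grp_def intro: reduced_foldr)
next
  fix x assume "x \<in> carrier (free_grp n)"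
  then show "\<exists>y\<in>carrier (free_grp n). y \<otimes>\<^bsub>free_grp n\<^esub> x = \<one>\<^bsub>free_grp n\<^esub>"
    by (intro bexI[of _ "rev (map inv_letter x)"])
      (auto simp: free_grp_def foldr_cons_red_inverse reduced_inverse)
qed (auto simp: free_grp_def foldr_cons_red_assoc)


section \<open>Groups of homomorphisms, tensor products and exterior squares over the integers\<close>

text \<open>Abelian groups are written multiplicatively, as in the library; maps are extensional
  so that equality of homomorphisms is equality of functions on the carrier.\<close>

definition hom_group :: "('a, 'c) monoid_scheme \<Rightarrow> ('b, 'd) monoid_scheme \<Rightarrow> ('a \<Rightarrow> 'b) monoid" where
  "hom_group A B = \<lparr>carrier = hom A B \<inter> extensional (carrier A),
     monoid.mult = (\<lambda>f g. \<lambda>x\<in>carrier A. f x \<otimes>\<^bsub>B\<^esub> g x), one = (\<lambda>x\<in>carrier A. \<one>\<^bsub>B\<^esub>)\<rparr>"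

definition bilinear_rels ::
  "('a, 'c) monoid_scheme \<Rightarrow> ('b, 'd) monoid_scheme \<Rightarrow> ('a \<times> 'b \<Rightarrow>\<^sub>0 int) set" where
  "bilinear_rels A B =
     {frag_of (a \<otimes>\<^bsub>A\<^esub> a', b) - frag_of (a, b) - frag_of (a', b) | a a' b.
        a \<in> carrier A \<and> a' \<in> carrier A \<and> b \<in> carrier B} \<union>
     {frag_of (a, b \<otimes>\<^bsub>B\<^esub> b') - frag_of (a, b) - frag_of (a, b') | a b b'.
        a \<in> carrier A \<and> b \<in> carrier B \<and> b' \<in> carrier B}"

definition tensor_ker ::
  "('a, 'c) monoid_scheme \<Rightarrow> ('b, 'd) monoid_scheme \<Rightarrow> ('a \<times> 'b \<Rightarrow>\<^sub>0 int) set" where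
  "tensor_ker A B = generate (free_Abelian_group (carrier A \<times> carrier B)) (bilinear_rels A B)"

definition tensor ::
  "('a, 'c) monoid_scheme \<Rightarrow> ('b, 'd) monoid_scheme \<Rightarrow> ('a \<times> 'b \<Rightarrow>\<^sub>0 int) set monoid" where
  "tensor A B = free_Abelian_group (carrier A \<times> carrier B) Mod tensor_ker A B"

definition pure ::
  "('a, 'c) monoid_scheme \<Rightarrow> ('b, 'd) monoid_scheme \<Rightarrow> 'a \<Rightarrow> 'b \<Rightarrow> ('a \<times> 'b \<Rightarrow>\<^sub>0 int) set" where
  "pure A B a b = tensor_ker A B #>\<^bsub>free_Abelian_group (carrier A \<times> carrier B)\<^esub> frag_of (a, b)"

text \<open>The homomorphism out of \<open>A \<otimes> B\<close> given by a bilinear map \<open>\<beta>\<close>.\<close>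

definition tensor_lift ::
  "('a, 'c) monoid_scheme \<Rightarrow> ('b, 'd) monoid_scheme \<Rightarrow> ('e, 'f) monoid_scheme \<Rightarrow>
   ('a \<Rightarrow> 'b \<Rightarrow> 'e) \<Rightarrow> ('a \<times> 'b \<Rightarrow>\<^sub>0 int) set \<Rightarrow> 'e" where
  "tensor_lift A B C \<beta> = (THE \<phi>. \<phi> \<in> hom (tensor A B) C \<inter> extensional (carrier (tensor A B)) \<and>
     (\<forall>a\<in>carrier A. \<forall>b\<in>carrier B. \<phi> (pure A B a b) = \<beta> a b))"

definition tensor_map ::
  "('a, 'c) monoid_scheme \<Rightarrow> ('b, 'd) monoid_scheme \<Rightarrow> ('a \<Rightarrow> 'a) \<Rightarrow> ('b \<Rightarrow> 'b) \<Rightarrow>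
   ('a \<times> 'b \<Rightarrow>\<^sub>0 int) set \<Rightarrow> ('a \<times> 'b \<Rightarrow>\<^sub>0 int) set" where
  "tensor_map A B f g = tensor_lift A B (tensor A B) (\<lambda>a b. pure A B (f a) (g b))"

definition ext2_ker :: "('a, 'c) monoid_scheme \<Rightarrow> ('a \<times> 'a \<Rightarrow>\<^sub>0 int) set set" where
  "ext2_ker A = generate (tensor A A) {pure A A a a | a. a \<in> carrier A}"

definition ext2 :: "('a, 'c) monoid_scheme \<Rightarrow> ('a \<times> 'a \<Rightarrow>\<^sub>0 int) set set monoid" where
  "ext2 A = tensor A A Mod ext2_ker A"

definition wedge :: "('a, 'c) monoid_scheme \<Rightarrow> 'a \<Rightarrow> 'a \<Rightarrow> ('a \<times> 'a \<Rightarrow>\<^sub>0 int) set set" where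
  "wedge A a b = ext2_ker A #>\<^bsub>tensor A A\<^esub> pure A A a b"

definition ext2_map :: "('a, 'c) monoid_scheme \<Rightarrow> ('a \<Rightarrow> 'a) \<Rightarrow>
   ('a \<times> 'a \<Rightarrow>\<^sub>0 int) set set \<Rightarrow> ('a \<times> 'a \<Rightarrow>\<^sub>0 int) set set" where
  "ext2_map A f = (THE \<phi>. \<phi> \<in> hom (ext2 A) (ext2 A) \<inter> extensional (carrier (ext2 A)) \<and>
     (\<forall>a\<in>carrier A. \<forall>b\<in>carrier A. \<phi> (wedge A a b) = wedge A (f a) (f b)))"


section \<open>The automorphism group and its modules\<close>

text \<open>Automorphisms act from the right: \<open>x\<^sup>\<sigma>\<close> is \<open>\<sigma> x\<close>, and the product \<open>\<sigma>\<tau>\<close> is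
  ``first \<open>\<sigma>\<close>, then \<open>\<tau>\<close>'', opposite to the library's composition order.\<close>

definition aut_free :: "nat \<Rightarrow> (letter list \<Rightarrow> letter list) monoid" where
  "aut_free n = (AutoGroup (free_grp n))
     \<lparr>monoid.mult := \<lambda>\<sigma> \<tau>. \<tau> \<otimes>\<^bsub>AutoGroup (free_grp n)\<^esub> \<sigma>\<rparr>"

abbreviation comm_sub :: "nat \<Rightarrow> letter list set" where
  "comm_sub n \<equiv> derived (free_grp n) (carrier (free_grp n))"

definition ab :: "nat \<Rightarrow> letter list set monoid" where
  "ab n = free_grp n Mod comm_sub n"

definition ab_class :: "nat \<Rightarrow> letter list \<Rightarrow> letter list set" where
  "ab_class n x = comm_sub n #>\<^bsub>free_grp n\<^esub> x"

text \<open>\<open>\<sigma> \<cdot> [x] = [x\<^sup>\<sigma>\<^sup>-\<^sup>1]\<close>, where the class \<open>[x]\<close> is a coset; see \<open>act_ab_class\<close> below.\<close>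

definition act_ab :: "nat \<Rightarrow> (letter list \<Rightarrow> letter list) \<Rightarrow> letter list set \<Rightarrow> letter list set" where
  "act_ab n \<sigma> = (\<lambda>h\<in>carrier (ab n). (inv\<^bsub>aut_free n\<^esub> \<sigma>) ` h)"

definition IA :: "nat \<Rightarrow> (letter list \<Rightarrow> letter list) set" where
  "IA n = kernel (aut_free n) (AutoGroup (ab n)) (act_ab n)"

definition ab_dual :: "nat \<Rightarrow> (letter list set \<Rightarrow> int) monoid" where
  "ab_dual n = hom_group (ab n) integer_group"

definition act_dual ::
  "nat \<Rightarrow> (letter list \<Rightarrow> letter list) \<Rightarrow> (letter list set \<Rightarrow> int) \<Rightarrow> letter list set \<Rightarrow> int" where
  "act_dual n \<sigma> f = (\<lambda>h\<in>carrier (ab n). f (act_ab n (inv\<^bsub>aut_free n\<^esub> \<sigma>) h))"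

type_synonym ext2_ab = "(letter list set \<times> letter list set \<Rightarrow>\<^sub>0 int) set set"
type_synonym V_elem = "((letter list set \<Rightarrow> int) \<times> ext2_ab \<Rightarrow>\<^sub>0 int) set"

definition V :: "nat \<Rightarrow> V_elem monoid" where
  "V n = tensor (ab_dual n) (ext2 (ab n))"

definition act_V :: "nat \<Rightarrow> (letter list \<Rightarrow> letter list) \<Rightarrow> V_elem \<Rightarrow> V_elem" where
  "act_V n \<sigma> = tensor_map (ab_dual n) (ext2 (ab n)) (act_dual n \<sigma>) (ext2_map (ab n) (act_ab n \<sigma>))"

definition VL :: "nat \<Rightarrow> ('a, 'm) ring_scheme \<Rightarrow> (V_elem \<times> 'a \<Rightarrow>\<^sub>0 int) set monoid" where
  "VL n L = tensor (V n) (add_monoid L)"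

definition act_VL :: "nat \<Rightarrow> ('a, 'm) ring_scheme \<Rightarrow> (letter list \<Rightarrow> letter list) \<Rightarrow>
    (V_elem \<times> 'a \<Rightarrow>\<^sub>0 int) set \<Rightarrow> (V_elem \<times> 'a \<Rightarrow>\<^sub>0 int) set" where
  "act_VL n L \<sigma> = tensor_map (V n) (add_monoid L) (act_V n \<sigma>) (\<lambda>l. l)"

definition crossed_homs :: "('g, 'c) monoid_scheme \<Rightarrow> ('v, 'd) monoid_scheme \<Rightarrow>
    ('g \<Rightarrow> 'v \<Rightarrow> 'v) \<Rightarrow> ('g \<Rightarrow> 'v) set" where
  "crossed_homs G M act = {f \<in> carrier G \<rightarrow> carrier M.
     \<forall>\<sigma>\<in>carrier G. \<forall>\<tau>\<in>carrier G. f (\<sigma> \<otimes>\<^bsub>G\<^esub> \<tau>) = f \<sigma> \<otimes>\<^bsub>M\<^esub> act \<sigma> (f \<tau>)}"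


section \<open>The first Johnson homomorphism\<close>

definition commutator :: "('a, 'b) monoid_scheme \<Rightarrow> 'a \<Rightarrow> 'a \<Rightarrow> 'a" where
  "commutator G x y = x \<otimes>\<^bsub>G\<^esub> y \<otimes>\<^bsub>G\<^esub> inv\<^bsub>G\<^esub> x \<otimes>\<^bsub>G\<^esub> inv\<^bsub>G\<^esub> y"

definition lower3 :: "nat \<Rightarrow> letter list set" where
  "lower3 n = generate (free_grp n)
     {commutator (free_grp n) x y | x y. x \<in> carrier (free_grp n) \<and> y \<in> comm_sub n}"

definition gr2 :: "nat \<Rightarrow> letter list set monoid" where
  "gr2 n = (free_grp n)\<lparr>carrier := comm_sub n\<rparr> Mod lower3 n"

definition gr2_class :: "nat \<Rightarrow> letter list \<Rightarrow> letter list set" where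
  "gr2_class n c = lower3 n #>\<^bsub>free_grp n\<^esub> c"

text \<open>The isomorphism from the exterior square of the abelianization to
  \<open>[F, F] / [F, [F, F]]\<close>.\<close>

definition ext2_to_gr2 :: "nat \<Rightarrow> ext2_ab \<Rightarrow> letter list set" where
  "ext2_to_gr2 n = (THE j. j \<in> iso (ext2 (ab n)) (gr2 n) \<inter> extensional (carrier (ext2 (ab n))) \<and>
     (\<forall>x\<in>carrier (free_grp n). \<forall>y\<in>carrier (free_grp n).
        j (wedge (ab n) (ab_class n x) (ab_class n y)) = gr2_class n (commutator (free_grp n) x y)))"

definition johnson_hom :: "nat \<Rightarrow> (letter list \<Rightarrow> letter list) \<Rightarrow> letter list set \<Rightarrow> ext2_ab" where
  "johnson_hom n \<sigma> = (THE \<phi>. \<phi> \<in> carrier (hom_group (ab n) (ext2 (ab n))) \<and>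
     (\<forall>x\<in>carrier (free_grp n).
        ext2_to_gr2 n (\<phi> (ab_class n x)) = gr2_class n (inv\<^bsub>free_grp n\<^esub> x \<otimes>\<^bsub>free_grp n\<^esub> \<sigma> x)))"

text \<open>The canonical isomorphism from \<open>H\<^sup>* \<otimes> \<Lambda>\<^sup>2 H\<close> to \<open>Hom(H, \<Lambda>\<^sup>2 H)\<close>, sending \<open>f \<otimes> w\<close> to
  \<open>h \<mapsto> f(h) w\<close>.\<close>

definition V_to_hom :: "nat \<Rightarrow> V_elem \<Rightarrow> letter list set \<Rightarrow> ext2_ab" where
  "V_to_hom n = tensor_lift (ab_dual n) (ext2 (ab n)) (hom_group (ab n) (ext2 (ab n)))
     (\<lambda>f w. \<lambda>h\<in>carrier (ab n). w [^]\<^bsub>ext2 (ab n)\<^esub> f h)"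

definition johnson :: "nat \<Rightarrow> (letter list \<Rightarrow> letter list) \<Rightarrow> V_elem" where
  "johnson n \<sigma> = inv_into (carrier (V n)) (V_to_hom n) (johnson_hom n \<sigma>)"

definition johnson_L :: "nat \<Rightarrow> ('a, 'm) ring_scheme \<Rightarrow> (letter list \<Rightarrow> letter list) \<Rightarrow>
    (V_elem \<times> 'a \<Rightarrow>\<^sub>0 int) set" where
  "johnson_L n L \<sigma> = pure (V n) (add_monoid L) (johnson n \<sigma>) \<one>\<^bsub>L\<^esub>"


section \<open>The action on the abelianization\<close>

lemma carrier_aut_free: "carrier (aut_free n) = auto (free_grp n)"
  by (simp add: aut_free_def AutoGroup_def)

lemma mult_aut_free:
  assumes "\<sigma> \<in> carrier (aut_free n)" "\<tau> \<in> carrier (aut_free n)" "x \<in> carrier (free_grp n)"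
  shows "(\<sigma> \<otimes>\<^bsub>aut_free n\<^esub> \<tau>) x = \<tau> (\<sigma> x)"
  using assms by (auto simp: aut_free_def AutoGroup_def BijGroup_def auto_def compose_def)

lemma group_aut_free: "group (aut_free n)"
proof -
  interpret A: group "AutoGroup (free_grp n)"
    using group.AutoGroup[OF group_free_grp] .
  show ?thesis
    by (rule groupI) (auto simp: aut_free_def A.m_assoc intro: A.r_inv_ex)
qed

lemma act_ab_class:
  assumes \<sigma>: "\<sigma> \<in> carrier (aut_free n)" and x: "x \<in> carrier (free_grp n)"
  shows "act_ab n \<sigma> (ab_class n x) = ab_class n ((inv\<^bsub>aut_free n\<^esub> \<sigma>) x)"
proof -
  interpret F: group "free_grp n" by (rule group_free_grp)
  define \<tau> where "\<tau> = inv\<^bsub>aut_free n\<^esub> \<sigma>"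
  have "\<tau> \<in> auto (free_grp n)"
    using group.inv_closed[OF group_aut_free \<sigma>] by (simp add: \<tau>_def carrier_aut_free)
  then have hom: "\<tau> \<in> hom (free_grp n) (free_grp n)"
    and bij: "\<tau> ` carrier (free_grp n) = carrier (free_grp n)"
    by (auto simp: auto_def Bij_def bij_betw_def)
  interpret h: group_hom "free_grp n" "free_grp n" \<tau>
    using hom by (simp add: group_hom_def group_hom_axioms_def group_free_grp)
  have N: "\<tau> ` comm_sub n = comm_sub n"
    using h.derived_img[of "carrier (free_grp n)"] bij by simp
  have sub: "comm_sub n \<subseteq> carrier (free_grp n)"
    by (rule F.derived_in_carrier) simp
  have "\<tau> ` ab_class n x = (\<tau> ` comm_sub n) #>\<^bsub>free_grp n\<^esub> \<tau> x"
    using sub x by (force simp: ab_class_def r_coset_def)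
  moreover have "ab_class n x \<in> carrier (ab n)"
    using x by (auto simp: ab_def FactGroup_def RCOSETS_def ab_class_def)
  ultimately show ?thesis
    by (simp add: act_ab_def N ab_class_def flip: \<tau>_def)
qed

end

(*
  Everything is read off modulo 2 L. Let D invert x_0, let P_u be the transvection x_0 |-> x_0 u for a
  word u in the other generators, and put s_u = P_u D P_u^-1, so that s_u maps x_0 to u x_0^-1 u. Then
  s_a D s_b = K s_{ab} with K : x_0 |-> x_0 [b^-1, a^-1] in IA_n. As D acts trivially on V/2, a crossed
  homomorphism f satisfies f(s_u) = P_u f(D) modulo 2, and the relation becomes
    tau(K) = (P_a + 1 + P_b + P_{ab}) f(D)   modulo 2.
  For a = x_j and b = x_k, the coefficient of e_0^* (x) e_j /\ e_k on the right is b_j + b_k, where b_i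
  is the coefficient of e_i^* (x) e_i /\ e_0 in f(D), and on the left it is 1. For the three pairs from
  {1, 2, 3} these equations add up to 0 = 3, hence 1 lies in 2 L.
*)
theory Submission
  imports Defs
begin

section \<open>Homomorphisms, tensor products and exterior squares\<close>

text \<open>Passing from f(s_u) to P_u f(D) is what makes the relation usable: the unknown value
  f(P_u) occurs twice in f(P_u D P_u^-1), the second time as P_u f(P_u^-1), so it cancels modulo 2
  and f(D) is the only unknown left. The resulting sum is a second difference in u. A coordinate of
  P_u f(D) is quadratic in the exponent sums of u, because P_u shifts the vector e_0 by [u] and the
  functionals e_i^* by multiples of e_0^*, so what survives modulo 2 is the mixed part, and that is
  where b_j and b_k appear. V_L is observed only through homomorphisms to L / 2 L, each induced by
  an integral functional on V and by the reduction of L. The other obstacle is that the Johnson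
  homomorphism is given by descriptions (\<open>THE\<close>, \<open>inv_into\<close>): to evaluate
  it at K, the isomorphism from the exterior square of H to [F, F] / [F, [F, F]] has to be shown to
  exist, and its injectivity rests on the quadratic Magnus coefficients.\<close>

lemma hom_eq_on_generators:
  assumes "group G" "group K" "f \<in> hom G K" "g \<in> hom G K" "S \<subseteq> carrier G" "generate G S = carrier G"
    and eq: "\<And>s. s \<in> S \<Longrightarrow> f s = g s" and x: "x \<in> carrier G"
  shows "f x = g x"
proof -
  interpret f: group_hom G K f using assms by (simp add: group_hom_def group_hom_axioms_def)
  interpret g: group_hom G K g using assms by (simp add: group_hom_def group_hom_axioms_def)
  have "x \<in> generate G S" using assms by simp
  then have "f x = g x \<and> x \<in> carrier G"
  proof (induction rule: generate.induct)
    case (inv h)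
    then have "h \<in> carrier G" using assms(5) by auto
    with inv eq show ?case by simp
  qed (use assms in auto)
  then show ?thesis ..
qed

lemma (in normal) generate_FactGroup:
  assumes "S \<subseteq> carrier G" "generate G S = carrier G"
  shows "generate (G Mod H) ((\<lambda>x. H #> x) ` S) = carrier (G Mod H)"
proof -
  interpret p: group_hom G "G Mod H" "\<lambda>x. H #> x"
    using r_coset_hom_Mod factorgroup_is_group
    by (simp add: group_hom_def group_hom_axioms_def is_group)
  show ?thesis using p.generate_img[OF assms(1)] assms(2) by (simp add: carrier_FactGroup)
qed

text \<open>The elements killed by \<open>h\<close> are closed under products and inverses, so
  killing \<open>S\<close> kills everything that \<open>S\<close> generates, and \<open>h\<close>
  becomes constant on cosets. Both \<open>tensor\<close> and \<open>ext2\<close> are quotients of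
  this kind, so the maps out of them start here.\<close>

lemma FactGroup_generate_universal:
  assumes "group G" "group K" "h \<in> hom G K" "S \<subseteq> carrier G" "generate G S \<lhd> G"
    and one: "\<And>s. s \<in> S \<Longrightarrow> h s = \<one>\<^bsub>K\<^esub>"
  obtains g where "g \<in> hom (G Mod generate G S) K"
    and "\<And>x. x \<in> carrier G \<Longrightarrow> g (generate G S #>\<^bsub>G\<^esub> x) = h x"
proof -
  interpret h: group_hom G K h using assms by (simp add: group_hom_def group_hom_axioms_def)
  have ker: "s \<in> carrier G \<and> h s = \<one>\<^bsub>K\<^esub>" if "s \<in> generate G S" for s
    using that
  proof (induction rule: generate.induct)
    case (inv s)
    then have "s \<in> carrier G" using assms(4) by auto
    with inv one show ?case by simp
  qed (use assms in auto)
  have "h x = h y" if x: "x \<in> carrier G" and y: "y \<in> carrier G"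
    and xy: "generate G S #>\<^bsub>G\<^esub> x = generate G S #>\<^bsub>G\<^esub> y" for x y
  proof -
    have "subgroup (generate G S) G" using assms(4) by (simp add: h.G.generate_is_subgroup)
    then have "x \<in> generate G S #>\<^bsub>G\<^esub> y" using xy x h.G.rcos_self by metis
    then obtain s where "s \<in> generate G S" "x = s \<otimes>\<^bsub>G\<^esub> y" by (auto simp: r_coset_def)
    then show ?thesis using ker[of s] y by simp
  qed
  then show thesis using FactGroup_universal[OF assms(3,5)] that by metis
qed

section \<open>Tensor products of abelian groups and the maps out of them\<close>

lemma generate_frag_of:
  "generate (free_Abelian_group S) (frag_of ` S) = carrier (free_Abelian_group S)"
proof -
  interpret F: group "free_Abelian_group S" by simp
  have sub: "frag_of ` S \<subseteq> carrier (free_Abelian_group S)" by auto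
  have "x \<in> generate (free_Abelian_group S) (frag_of ` S)" if "Poly_Mapping.keys x \<subseteq> S" for x
  proof (rule free_Abelian_group_induct[OF that])
    show "0 \<in> generate (free_Abelian_group S) (frag_of ` S)"
      using generate.one[of "free_Abelian_group S"] by simp
    show "x - y \<in> generate (free_Abelian_group S) (frag_of ` S)"
      if "Poly_Mapping.keys x \<subseteq> S" "Poly_Mapping.keys y \<subseteq> S"
        "x \<in> generate (free_Abelian_group S) (frag_of ` S)"
        "y \<in> generate (free_Abelian_group S) (frag_of ` S)" for x y
    proof -
      have "x \<otimes>\<^bsub>free_Abelian_group S\<^esub> inv\<^bsub>free_Abelian_group S\<^esub> y
        \<in> generate (free_Abelian_group S) (frag_of ` S)"
        using generate.eng[OF that(3) F.generate_m_inv_closed[OF sub that(4)]] .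
      then show ?thesis using that by simp
    qed
  qed (auto intro: generate.incl)
  then show ?thesis using F.generate_in_carrier[OF sub] by auto
qed

lemma bilinear_rels_subset:
  assumes "comm_group A" "comm_group B"
  shows "bilinear_rels A B \<subseteq> carrier (free_Abelian_group (carrier A \<times> carrier B))"
proof -
  interpret A: comm_group A by fact
  interpret B: comm_group B by fact
  let ?S = "carrier A \<times> carrier B"
  have diff: "frag_of u - frag_of v - frag_of w \<in> carrier (free_Abelian_group ?S)"
    if "u \<in> ?S" "v \<in> ?S" "w \<in> ?S" for u v w
  proof -
    have "Poly_Mapping.keys (frag_of u - frag_of v) \<subseteq> ?S"
      using keys_diff[of "frag_of u" "frag_of v"] that by auto
    then show ?thesis
      using keys_diff[of "frag_of u - frag_of v" "frag_of w"] that by auto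
  qed
  show ?thesis
    unfolding bilinear_rels_def
    by (auto simp del: carrier_free_Abelian_group_iff intro!: diff)
qed

lemma normal_tensor_ker:
  assumes "comm_group A" "comm_group B"
  shows "tensor_ker A B \<lhd> free_Abelian_group (carrier A \<times> carrier B)"
  unfolding tensor_ker_def
  by (simp add: comm_group.normal_iff_subgroup abelian_free_Abelian_group
      group.generate_is_subgroup bilinear_rels_subset assms)

lemma comm_group_tensor:
  assumes "comm_group A" "comm_group B" shows "comm_group (tensor A B)"
  unfolding tensor_def
  by (metis abelian_free_Abelian_group assms comm_group.abelian_FactGroup normal_imp_subgroup normal_tensor_ker)

lemma pure_closed [simp]:
  "a \<in> carrier A \<Longrightarrow> b \<in> carrier B \<Longrightarrow> pure A B a b \<in> carrier (tensor A B)"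
  by (auto simp: pure_def tensor_def carrier_FactGroup)

lemma generate_pure:
  assumes "comm_group A" "comm_group B"
  shows "generate (tensor A B) {pure A B a b | a b. a \<in> carrier A \<and> b \<in> carrier B} = carrier (tensor A B)"
proof -
  have "{pure A B a b | a b. a \<in> carrier A \<and> b \<in> carrier B} =
    (\<lambda>x. tensor_ker A B #>\<^bsub>free_Abelian_group (carrier A \<times> carrier B)\<^esub> x) ` frag_of ` (carrier A \<times> carrier B)"
    by (auto simp: pure_def)
  moreover have "frag_of ` (carrier A \<times> carrier B) \<subseteq> carrier (free_Abelian_group (carrier A \<times> carrier B))"
    by auto
  ultimately show ?thesis
    using normal.generate_FactGroup[OF normal_tensor_ker[OF assms] _ generate_frag_of]
    by (simp add: tensor_def)
qed

lemma tensor_hom_eq: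
  assumes "comm_group A" "comm_group B" "group C" "f \<in> hom (tensor A B) C" "g \<in> hom (tensor A B) C"
    and "\<And>a b. a \<in> carrier A \<Longrightarrow> b \<in> carrier B \<Longrightarrow> f (pure A B a b) = g (pure A B a b)"
    and "x \<in> carrier (tensor A B)"
  shows "f x = g x"
proof -
  have "group (tensor A B)" using comm_group_tensor[OF assms(1,2)] by (simp add: comm_group_def)
  then show ?thesis
    by (rule hom_eq_on_generators[OF _ assms(3-5) _ generate_pure[OF assms(1,2)] _ assms(7)])
      (auto simp: assms(6))
qed

text \<open>Neither argument group has to be abelian: \<open>bilinear_ab\<close> applies the notion
  to the free group itself. Closure in \<open>C\<close> is included so that fixing one argument
  yields a \<open>hom\<close>.\<close>

definition bilinear where
  "bilinear A B C \<beta> \<longleftrightarrow> (\<forall>a\<in>carrier A. \<forall>b\<in>carrier B. \<beta> a b \<in> carrier C) \<and>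
    (\<forall>a\<in>carrier A. \<forall>a'\<in>carrier A. \<forall>b\<in>carrier B. \<beta> (a \<otimes>\<^bsub>A\<^esub> a') b = \<beta> a b \<otimes>\<^bsub>C\<^esub> \<beta> a' b) \<and>
    (\<forall>a\<in>carrier A. \<forall>b\<in>carrier B. \<forall>b'\<in>carrier B. \<beta> a (b \<otimes>\<^bsub>B\<^esub> b') = \<beta> a b \<otimes>\<^bsub>C\<^esub> \<beta> a b')"

lemma bilinearI:
  assumes "\<And>a b. a \<in> carrier A \<Longrightarrow> b \<in> carrier B \<Longrightarrow> \<beta> a b \<in> carrier C"
    and "\<And>a a' b. a \<in> carrier A \<Longrightarrow> a' \<in> carrier A \<Longrightarrow> b \<in> carrier B \<Longrightarrow>
      \<beta> (a \<otimes>\<^bsub>A\<^esub> a') b = \<beta> a b \<otimes>\<^bsub>C\<^esub> \<beta> a' b"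
    and "\<And>a b b'. a \<in> carrier A \<Longrightarrow> b \<in> carrier B \<Longrightarrow> b' \<in> carrier B \<Longrightarrow>
      \<beta> a (b \<otimes>\<^bsub>B\<^esub> b') = \<beta> a b \<otimes>\<^bsub>C\<^esub> \<beta> a b'"
  shows "bilinear A B C \<beta>"
  using assms unfolding bilinear_def by blast

lemma bilinear_hom:
  assumes "bilinear A B C \<beta>"
  shows "a \<in> carrier A \<Longrightarrow> \<beta> a \<in> hom B C" and "b \<in> carrier B \<Longrightarrow> (\<lambda>a. \<beta> a b) \<in> hom A C"
  using assms unfolding bilinear_def hom_def by auto

lemma bilinear_pure:
  assumes "comm_group A" "comm_group B"
  shows "bilinear A B (tensor A B) (pure A B)"
proof (rule bilinearI)
  interpret A: comm_group A by fact
  interpret B: comm_group B by fact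
  let ?F = "free_Abelian_group (carrier A \<times> carrier B)"
  interpret K: normal "tensor_ker A B" ?F using normal_tensor_ker[OF assms] .
  \<comment> \<open>Both kinds of generators of \<open>tensor_ker\<close> have the shape u - v - w,
    so one computation with pairs gives additivity in either argument.\<close>
  have sum: "pure A B (fst u) (snd u) = pure A B (fst v) (snd v) \<otimes>\<^bsub>tensor A B\<^esub> pure A B (fst w) (snd w)"
    if "u \<in> carrier A \<times> carrier B" "v \<in> carrier A \<times> carrier B" "w \<in> carrier A \<times> carrier B"
      and "frag_of u - frag_of v - frag_of w \<in> bilinear_rels A B" for u v w
  proof -
    have "frag_of u - frag_of v - frag_of w \<in> tensor_ker A B"
      using that(4) unfolding tensor_ker_def by (rule generate.incl)
    then have mem: "frag_of u \<in> tensor_ker A B #>\<^bsub>?F\<^esub> (frag_of v + frag_of w)"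
      unfolding r_coset_def by (force simp: algebra_simps)
    have vw: "frag_of v + frag_of w \<in> carrier ?F"
      using K.m_closed[of "frag_of v" "frag_of w"] that by simp
    have "tensor_ker A B #>\<^bsub>?F\<^esub> (frag_of v + frag_of w) = tensor_ker A B #>\<^bsub>?F\<^esub> frag_of u"
      by (rule K.repr_independence[OF mem vw K.subgroup_axioms])
    moreover have "tensor_ker A B #>\<^bsub>?F\<^esub> (frag_of v + frag_of w) =
        (tensor_ker A B #>\<^bsub>?F\<^esub> frag_of v) <#>\<^bsub>?F\<^esub> (tensor_ker A B #>\<^bsub>?F\<^esub> frag_of w)"
      using K.rcos_sum[of "frag_of v" "frag_of w"] that by simp
    ultimately show ?thesis by (simp add: pure_def tensor_def)
  qed
  show "pure A B (a \<otimes>\<^bsub>A\<^esub> a') b = pure A B a b \<otimes>\<^bsub>tensor A B\<^esub> pure A B a' b"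
    if "a \<in> carrier A" "a' \<in> carrier A" "b \<in> carrier B" for a a' b
    using sum[of "(a \<otimes>\<^bsub>A\<^esub> a', b)" "(a, b)" "(a', b)"] that by (auto simp: bilinear_rels_def)
  show "pure A B a (b \<otimes>\<^bsub>B\<^esub> b') = pure A B a b \<otimes>\<^bsub>tensor A B\<^esub> pure A B a b'"
    if "a \<in> carrier A" "b \<in> carrier B" "b' \<in> carrier B" for a b b'
    using sum[of "(a, b \<otimes>\<^bsub>B\<^esub> b')" "(a, b)" "(a, b')"] that by (auto simp: bilinear_rels_def)
qed simp

text \<open>Freeness extends \<open>\<beta>\<close> from pairs to formal sums, and bilinearity says
  that this extension kills \<open>bilinear_rels\<close>.\<close>

lemma tensor_universal:
  assumes "comm_group A" "comm_group B" "comm_group C" and \<beta>: "bilinear A B C \<beta>"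
  obtains h where "h \<in> hom (tensor A B) C"
    and "\<And>a b. a \<in> carrier A \<Longrightarrow> b \<in> carrier B \<Longrightarrow> h (pure A B a b) = \<beta> a b"
proof -
  interpret A: comm_group A by fact
  interpret B: comm_group B by fact
  interpret C: comm_group C by fact
  let ?F = "free_Abelian_group (carrier A \<times> carrier B)"
  have "(\<lambda>(a, b). \<beta> a b) ` (carrier A \<times> carrier B) \<subseteq> carrier C"
    using \<beta> by (auto simp: bilinear_def)
  then obtain h where h: "h \<in> hom ?F C"
    and h_of: "\<And>a b. a \<in> carrier A \<Longrightarrow> b \<in> carrier B \<Longrightarrow> h (frag_of (a, b)) = \<beta> a b"
    using C.free_Abelian_group_universal[of "\<lambda>(a, b). \<beta> a b" "carrier A \<times> carrier B"]
    by (metis (no_types, lifting) SigmaI case_prod_conv)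
  interpret h: group_hom ?F C h using h by (simp add: group_hom_def group_hom_axioms_def)
  \<comment> \<open>The homomorphism property of \<open>h\<close> speaks of group operations, so a
    formal difference is first rewritten as a product with an inverse.\<close>
  have diff: "h (frag_of u - frag_of v - frag_of w) = h (frag_of u) \<otimes>\<^bsub>C\<^esub> inv\<^bsub>C\<^esub> (h (frag_of v) \<otimes>\<^bsub>C\<^esub> h (frag_of w))"
    if "u \<in> carrier A \<times> carrier B" "v \<in> carrier A \<times> carrier B" "w \<in> carrier A \<times> carrier B" for u v w
  proof -
    have vw: "Poly_Mapping.keys (frag_of v + frag_of w) \<subseteq> carrier A \<times> carrier B"
      using h.G.m_closed[of "frag_of v" "frag_of w"] that by simp
    have "frag_of u - frag_of v - frag_of w = frag_of u \<otimes>\<^bsub>?F\<^esub> inv\<^bsub>?F\<^esub> (frag_of v \<otimes>\<^bsub>?F\<^esub> frag_of w)"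
      using vw by simp
    also have "h \<dots> = h (frag_of u) \<otimes>\<^bsub>C\<^esub> inv\<^bsub>C\<^esub> (h (frag_of v) \<otimes>\<^bsub>C\<^esub> h (frag_of w))"
      using that by (simp del: inv_free_Abelian_group mult_free_Abelian_group carrier_free_Abelian_group_iff)
    finally show ?thesis .
  qed
  have "h r = \<one>\<^bsub>C\<^esub>" if "r \<in> bilinear_rels A B" for r
    using that \<beta> unfolding bilinear_rels_def
    by (auto simp: diff h_of bilinear_def)
  from FactGroup_generate_universal[OF _ C.is_group h bilinear_rels_subset[OF assms(1,2)]
      normal_tensor_ker[OF assms(1,2), unfolded tensor_ker_def] this]
  obtain g where "g \<in> hom (?F Mod generate ?F (bilinear_rels A B)) C"
    "\<And>x. x \<in> carrier ?F \<Longrightarrow> g (generate ?F (bilinear_rels A B) #>\<^bsub>?F\<^esub> x) = h x"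
    by (metis group_free_Abelian_group)
  then show thesis
    by (intro that[of g]) (auto simp: tensor_def tensor_ker_def pure_def h_of)
qed

text \<open>Serves the \<open>THE\<close> in \<open>tensor_lift\<close> and \<open>ext2_map\<close>:
  a generating set determines a homomorphism on the carrier, and extensionality fixes it outside, so
  the restriction of any suitable \<open>h\<close> is the unique solution.\<close>

lemma ex1_extensional_hom:
  assumes "group G" "group K" "h \<in> hom G K" "S \<subseteq> carrier G" "generate G S = carrier G"
  shows "\<exists>!f. f \<in> hom G K \<inter> extensional (carrier G) \<and> (\<forall>s\<in>S. f s = h s)"
proof (rule ex1I)
  interpret group G by fact
  show r: "restrict h (carrier G) \<in> hom G K \<inter> extensional (carrier G) \<and>
      (\<forall>s\<in>S. restrict h (carrier G) s = h s)"
    using assms by (auto simp: hom_def)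
  fix f assume f: "f \<in> hom G K \<inter> extensional (carrier G) \<and> (\<forall>s\<in>S. f s = h s)"
  show "f = restrict h (carrier G)"
  proof (rule extensionalityI)
    fix x assume x: "x \<in> carrier G"
    show "f x = restrict h (carrier G) x"
      by (rule hom_eq_on_generators[OF assms(1,2) _ _ assms(4,5) _ x])
        (use f r in \<open>auto simp del: restrict_apply restrict_apply'\<close>)
  qed (use f in auto)
qed

lemma tensor_lift:
  assumes "comm_group A" "comm_group B" "comm_group C" "bilinear A B C \<beta>"
  shows "tensor_lift A B C \<beta> \<in> hom (tensor A B) C"
    and "a \<in> carrier A \<Longrightarrow> b \<in> carrier B \<Longrightarrow> tensor_lift A B C \<beta> (pure A B a b) = \<beta> a b"
proof -
  obtain h where h: "h \<in> hom (tensor A B) C"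
    "\<And>a b. a \<in> carrier A \<Longrightarrow> b \<in> carrier B \<Longrightarrow> h (pure A B a b) = \<beta> a b"
    by (rule tensor_universal[OF assms]) (rule that)
  have groups: "group (tensor A B)" "group C"
    using comm_group_tensor[OF assms(1,2)] assms(3) by (simp_all add: comm_group_def)
  have sub: "{pure A B a b | a b. a \<in> carrier A \<and> b \<in> carrier B} \<subseteq> carrier (tensor A B)" by auto
  \<comment> \<open>The condition on pure tensors is restated as agreement with \<open>h\<close> on
    a generating set, the form in which unique existence was proved.\<close>
  have "(\<forall>a\<in>carrier A. \<forall>b\<in>carrier B. \<phi> (pure A B a b) = \<beta> a b) \<longleftrightarrow>
     (\<forall>s\<in>{pure A B a b | a b. a \<in> carrier A \<and> b \<in> carrier B}. \<phi> s = h s)" for \<phi>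
    by (auto simp flip: h(2))
  then have "\<exists>!\<phi>. \<phi> \<in> hom (tensor A B) C \<inter> extensional (carrier (tensor A B)) \<and>
     (\<forall>a\<in>carrier A. \<forall>b\<in>carrier B. \<phi> (pure A B a b) = \<beta> a b)"
    using ex1_extensional_hom[OF groups h(1) sub generate_pure[OF assms(1,2)]] by simp
  from theI'[OF this] show "tensor_lift A B C \<beta> \<in> hom (tensor A B) C"
    "a \<in> carrier A \<Longrightarrow> b \<in> carrier B \<Longrightarrow> tensor_lift A B C \<beta> (pure A B a b) = \<beta> a b"
    unfolding tensor_lift_def by auto
qed

lemma bilinear_compose:
  assumes "bilinear A' B' C \<beta>" "f \<in> hom A A'" "g \<in> hom B B'"
  shows "bilinear A B C (\<lambda>a b. \<beta> (f a) (g b))"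
  using assms unfolding bilinear_def hom_def Pi_iff by simp

lemma tensor_map:
  assumes "comm_group A" "comm_group B" "f \<in> hom A A" "g \<in> hom B B"
  shows "tensor_map A B f g \<in> hom (tensor A B) (tensor A B)"
    and "a \<in> carrier A \<Longrightarrow> b \<in> carrier B \<Longrightarrow> tensor_map A B f g (pure A B a b) = pure A B (f a) (g b)"
  unfolding tensor_map_def
  using tensor_lift[OF assms(1,2) comm_group_tensor[OF assms(1,2)]
      bilinear_compose[OF bilinear_pure[OF assms(1,2)] assms(3,4)]]
  by auto

section \<open>Exterior squares\<close>

lemma normal_ext2_ker:
  assumes "comm_group A" shows "ext2_ker A \<lhd> tensor A A"
  unfolding ext2_ker_def
  by (subst comm_group.normal_iff_subgroup[OF comm_group_tensor[OF assms assms]])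
    (use comm_group_tensor[OF assms assms] in \<open>auto simp: comm_group_def intro!: group.generate_is_subgroup\<close>)

lemma comm_group_ext2:
  assumes "comm_group A" shows "comm_group (ext2 A)"
  unfolding ext2_def
  by (metis assms comm_group.abelian_FactGroup comm_group_tensor normal_imp_subgroup normal_ext2_ker)

lemma generate_wedge:
  assumes "comm_group A"
  shows "generate (ext2 A) {wedge A a b | a b. a \<in> carrier A \<and> b \<in> carrier A} = carrier (ext2 A)"
proof -
  have "{wedge A a b | a b. a \<in> carrier A \<and> b \<in> carrier A} =
    (\<lambda>x. ext2_ker A #>\<^bsub>tensor A A\<^esub> x) ` {pure A A a b | a b. a \<in> carrier A \<and> b \<in> carrier A}"
    by (auto simp: wedge_def)
  moreover have "{pure A A a b | a b. a \<in> carrier A \<and> b \<in> carrier A} \<subseteq> carrier (tensor A A)"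
    by auto
  ultimately show ?thesis
    using normal.generate_FactGroup[OF normal_ext2_ker[OF assms] _ generate_pure[OF assms assms]]
    by (simp add: ext2_def)
qed

lemma wedge_closed [simp]:
  "a \<in> carrier A \<Longrightarrow> b \<in> carrier A \<Longrightarrow> wedge A a b \<in> carrier (ext2 A)"
  by (auto simp: wedge_def ext2_def carrier_FactGroup)

lemma ext2_hom_eq:
  assumes "comm_group A" "group C" "f \<in> hom (ext2 A) C" "g \<in> hom (ext2 A) C"
    and "\<And>a b. a \<in> carrier A \<Longrightarrow> b \<in> carrier A \<Longrightarrow> f (wedge A a b) = g (wedge A a b)"
    and "x \<in> carrier (ext2 A)"
  shows "f x = g x"
proof -
  have "group (ext2 A)" using comm_group_ext2[OF assms(1)] by (simp add: comm_group_def)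
  then show ?thesis
    by (rule hom_eq_on_generators[OF _ assms(2-4) _ generate_wedge[OF assms(1)] _ assms(6)])
      (auto simp: assms(5))
qed

lemma bilinear_wedge:
  assumes "comm_group A" shows "bilinear A A (ext2 A) (wedge A)"
proof -
  interpret N: normal "ext2_ker A" "tensor A A" using normal_ext2_ker[OF assms] .
  note b = bilinear_pure[OF assms assms]
  show ?thesis
    using b N.rcos_sum unfolding bilinear_def wedge_def ext2_def
    by (auto simp: carrier_FactGroup)
qed

lemma wedge_self:
  assumes "comm_group A" "a \<in> carrier A" shows "wedge A a a = \<one>\<^bsub>ext2 A\<^esub>"
proof -
  interpret N: normal "ext2_ker A" "tensor A A" using normal_ext2_ker[OF assms(1)] .
  have "pure A A a a \<in> ext2_ker A"
    unfolding ext2_ker_def using assms(2) by (intro generate.incl) auto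
  then show ?thesis by (simp add: wedge_def ext2_def N.rcos_const)
qed

text \<open>An alternating \<open>\<beta>\<close> sends pure tensors with equal factors to the
  identity, and these generate \<open>ext2_ker\<close>, so the map on the tensor product descends
  once more.\<close>

lemma ext2_universal:
  assumes A: "comm_group A" and C: "comm_group C" and \<beta>: "bilinear A A C \<beta>"
    and alt: "\<And>a. a \<in> carrier A \<Longrightarrow> \<beta> a a = \<one>\<^bsub>C\<^esub>"
  obtains h where "h \<in> hom (ext2 A) C"
    and "\<And>a b. a \<in> carrier A \<Longrightarrow> b \<in> carrier A \<Longrightarrow> h (wedge A a b) = \<beta> a b"
proof -
  obtain h where h: "h \<in> hom (tensor A A) C"
    and h_pure: "\<And>a b. a \<in> carrier A \<Longrightarrow> b \<in> carrier A \<Longrightarrow> h (pure A A a b) = \<beta> a b"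
    using tensor_universal[OF A A C \<beta>] by metis
  let ?S = "{pure A A a a | a. a \<in> carrier A}"
  have groups: "group (tensor A A)" "group C"
    using comm_group_tensor[OF A A] C by (auto simp: comm_group_def)
  have sub: "?S \<subseteq> carrier (tensor A A)" by auto
  have one: "h s = \<one>\<^bsub>C\<^esub>" if "s \<in> ?S" for s using that alt h_pure by auto
  obtain g where "g \<in> hom (tensor A A Mod generate (tensor A A) ?S) C"
    "\<And>x. x \<in> carrier (tensor A A) \<Longrightarrow> g (generate (tensor A A) ?S #>\<^bsub>tensor A A\<^esub> x) = h x"
    by (rule FactGroup_generate_universal[OF groups h sub normal_ext2_ker[OF A, unfolded ext2_ker_def] one])
      (assumption, rule that)
  then show thesis
    by (intro that[of g]) (auto simp: ext2_def ext2_ker_def wedge_def h_pure)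
qed

lemma ext2_map:
  assumes A: "comm_group A" and f: "f \<in> hom A A"
  shows "ext2_map A f \<in> hom (ext2 A) (ext2 A)"
    and "a \<in> carrier A \<Longrightarrow> b \<in> carrier A \<Longrightarrow> ext2_map A f (wedge A a b) = wedge A (f a) (f b)"
proof -
  have "wedge A (f a) (f a) = \<one>\<^bsub>ext2 A\<^esub>" if "a \<in> carrier A" for a
    using wedge_self[OF A] f that by (auto simp: hom_def)
  from ext2_universal[OF A comm_group_ext2[OF A] bilinear_compose[OF bilinear_wedge[OF A] f f] this]
  obtain h where h: "h \<in> hom (ext2 A) (ext2 A)"
    "\<And>a b. a \<in> carrier A \<Longrightarrow> b \<in> carrier A \<Longrightarrow> h (wedge A a b) = wedge A (f a) (f b)"
    by metis
  have g: "group (ext2 A)" using comm_group_ext2[OF A] by (simp add: comm_group_def)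
  have sub: "{wedge A a b | a b. a \<in> carrier A \<and> b \<in> carrier A} \<subseteq> carrier (ext2 A)" by auto
  have "(\<forall>a\<in>carrier A. \<forall>b\<in>carrier A. \<phi> (wedge A a b) = wedge A (f a) (f b)) \<longleftrightarrow>
     (\<forall>s\<in>{wedge A a b | a b. a \<in> carrier A \<and> b \<in> carrier A}. \<phi> s = h s)" for \<phi>
    by (auto simp flip: h(2))
  then have "\<exists>!\<phi>. \<phi> \<in> hom (ext2 A) (ext2 A) \<inter> extensional (carrier (ext2 A)) \<and>
     (\<forall>a\<in>carrier A. \<forall>b\<in>carrier A. \<phi> (wedge A a b) = wedge A (f a) (f b))"
    using ex1_extensional_hom[OF g g h(1) sub generate_wedge[OF A]] by simp
  from theI'[OF this] show "ext2_map A f \<in> hom (ext2 A) (ext2 A)"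
    "a \<in> carrier A \<Longrightarrow> b \<in> carrier A \<Longrightarrow> ext2_map A f (wedge A a b) = wedge A (f a) (f b)"
    unfolding ext2_map_def by auto
qed

lemma comm_group_hom_group:
  assumes "group A" "comm_group B" shows "comm_group (hom_group A B)"
proof -
  interpret A: group A by fact
  interpret B: comm_group B by fact
  have inv: "(\<lambda>x\<in>carrier A. inv\<^bsub>B\<^esub> f x) \<in> hom A B" if "f \<in> hom A B" for f
    using that by (auto simp: hom_def B.inv_mult Pi_def)
  show ?thesis
  proof (rule comm_groupI)
    fix f assume f: "f \<in> carrier (hom_group A B)"
    show "\<exists>g\<in>carrier (hom_group A B). g \<otimes>\<^bsub>hom_group A B\<^esub> f = \<one>\<^bsub>hom_group A B\<^esub>"
      by (rule bexI[of _ "\<lambda>x\<in>carrier A. inv\<^bsub>B\<^esub> f x"])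
        (use f inv in \<open>auto simp: hom_group_def hom_def fun_eq_iff Pi_def\<close>)
    show "\<one>\<^bsub>hom_group A B\<^esub> \<otimes>\<^bsub>hom_group A B\<^esub> f = f"
      using f by (auto simp: hom_group_def hom_def fun_eq_iff Pi_def extensional_def)
  qed (auto simp: hom_group_def hom_def fun_eq_iff Pi_def B.m_ac)
qed

section \<open>Free groups and their abelianization\<close>

definition gen :: "nat \<Rightarrow> letter list" where "gen i = [(True, i)]"

lemma mult_free_grp: "u \<otimes>\<^bsub>free_grp n\<^esub> v = foldr cons_red u v"
  and one_free_grp: "\<one>\<^bsub>free_grp n\<^esub> = []"
  and mem_free_grp: "w \<in> carrier (free_grp n) \<longleftrightarrow> reduced w \<and> snd ` set w \<subseteq> {..<n}"
  by (simp_all add: free_grp_def)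

lemma gen_closed [simp]: "i < n \<Longrightarrow> gen i \<in> carrier (free_grp n)"
  by (simp add: gen_def mem_free_grp)

lemma gen_funcset: "gen ` {..<n} \<subseteq> carrier (free_grp n)"
  by auto

lemma inv_gen: "i < n \<Longrightarrow> inv\<^bsub>free_grp n\<^esub> gen i = [(False, i)]"
  by (rule group.inv_equality[OF group_free_grp])
    (auto simp: gen_def mem_free_grp mult_free_grp one_free_grp inv_letter_def)

lemma cons_red_reduced: "reduced (a # w) \<Longrightarrow> cons_red a w = a # w"
  by (cases w) auto

text \<open>A reduced word is the product of its first letter and its tail with no cancellation, and
  a letter is a generator or the inverse of one.\<close>

lemma generate_gen: "generate (free_grp n) (gen ` {..<n}) = carrier (free_grp n)"
proof -
  interpret F: group "free_grp n" by (rule group_free_grp)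
  have "w \<in> generate (free_grp n) (gen ` {..<n})" if "w \<in> carrier (free_grp n)" for w
    using that
  proof (induction w)
    case Nil
    show ?case using generate.one[of "free_grp n"] by (simp add: one_free_grp)
  next
    case (Cons a w)
    then have w: "w \<in> generate (free_grp n) (gen ` {..<n})" and a: "snd a < n"
      by (auto simp: mem_free_grp dest: reduced_ConsD)
    have "[a] \<in> generate (free_grp n) (gen ` {..<n})"
    proof (cases "fst a")
      case True
      then have "[a] = gen (snd a)" by (simp add: gen_def prod_eq_iff)
      then show ?thesis using a by (auto intro: generate.incl)
    next
      case False
      then have "[a] = inv\<^bsub>free_grp n\<^esub> gen (snd a)" using a by (simp add: inv_gen prod_eq_iff)
      then show ?thesis using a by (auto intro: generate.inv)
    qed
    moreover have "a # w = [a] \<otimes>\<^bsub>free_grp n\<^esub> w"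
      using Cons.prems by (simp add: mult_free_grp mem_free_grp cons_red_reduced)
    ultimately show ?case using w by (simp add: generate.eng)
  qed
  then show ?thesis using F.generate_in_carrier[OF gen_funcset] by auto
qed

lemma free_hom_eq:
  assumes "group K" "f \<in> hom (free_grp n) K" "g \<in> hom (free_grp n) K"
    and "\<And>i. i < n \<Longrightarrow> f (gen i) = g (gen i)" and "x \<in> carrier (free_grp n)"
  shows "f x = g x"
  by (rule hom_eq_on_generators[OF group_free_grp assms(1-3) gen_funcset generate_gen _ assms(5)])
    (use assms(4) in auto)

text \<open>Evaluation is defined on all words, reduced or not. \<open>word_hom_cons_red\<close>
  shows that free reduction leaves the value unchanged, which makes this the universal homomorphism
  out of the free group.\<close>

definition word_hom :: "('g, 'm) monoid_scheme \<Rightarrow> (nat \<Rightarrow> 'g) \<Rightarrow> letter list \<Rightarrow> 'g" where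
  "word_hom G g w =
     foldr (\<lambda>a y. (if fst a then g (snd a) else inv\<^bsub>G\<^esub> g (snd a)) \<otimes>\<^bsub>G\<^esub> y) w \<one>\<^bsub>G\<^esub>"

context group
begin

lemma word_hom_simps [simp]:
  "word_hom G g [] = \<one>"
  "word_hom G g (a # w) = (if fst a then g (snd a) else inv g (snd a)) \<otimes> word_hom G g w"
  by (simp_all add: word_hom_def)

lemma word_hom_closed:
  "(\<And>i. i < n \<Longrightarrow> g i \<in> carrier G) \<Longrightarrow> snd ` set w \<subseteq> {..<n} \<Longrightarrow> word_hom G g w \<in> carrier G"
  by (induction w) auto

lemma word_hom_cons_red:
  assumes g: "\<And>i. i < n \<Longrightarrow> g i \<in> carrier G" and "snd ` set (a # w) \<subseteq> {..<n}"
  shows "word_hom G g (cons_red a w) = word_hom G g (a # w)"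
proof (cases w)
  case (Cons b v)
  have "word_hom G g v \<in> carrier G" "g (snd a) \<in> carrier G"
    using assms Cons word_hom_closed[OF g] by auto
  with Cons show ?thesis by (auto simp: inv_letter_def m_assoc[symmetric])
qed simp

lemma word_hom:
  assumes g: "\<And>i. i < n \<Longrightarrow> g i \<in> carrier G"
  shows "word_hom G g \<in> hom (free_grp n) G"
proof (rule homI)
  show "word_hom G g u \<in> carrier G" if "u \<in> carrier (free_grp n)" for u
    using that word_hom_closed[OF g] by (simp add: mem_free_grp)
  fix u v assume "u \<in> carrier (free_grp n)" "v \<in> carrier (free_grp n)"
  then have "snd ` set u \<subseteq> {..<n}" "snd ` set v \<subseteq> {..<n}" by (auto simp: mem_free_grp)
  then have "word_hom G g (foldr cons_red u v) = word_hom G g u \<otimes> word_hom G g v"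
  proof (induction u)
    case (Cons a u)
    have "snd ` set (foldr cons_red u v) \<subseteq> snd ` set u \<union> snd ` set v"
      using image_mono[OF set_foldr_cons_red[of u v], of snd] by (simp only: image_Un)
    also have "\<dots> \<subseteq> {..<n}" using Cons.prems by simp
    finally have "snd ` set (a # foldr cons_red u v) \<subseteq> {..<n}" using Cons.prems by simp
    then show ?case
      using Cons word_hom_cons_red[OF g] by (auto simp: m_assoc word_hom_closed[OF g] g)
  qed (simp add: word_hom_closed[OF g])
  then show "word_hom G g (u \<otimes>\<^bsub>free_grp n\<^esub> v) = word_hom G g u \<otimes> word_hom G g v"
    by (simp add: mult_free_grp)
qed

lemma word_hom_gen [simp]: "g i \<in> carrier G \<Longrightarrow> word_hom G g (gen i) = g i"
  by (simp add: gen_def)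

end

section \<open>Exponent sums and quadratic Magnus coefficients\<close>

definition expo :: "nat \<Rightarrow> letter list \<Rightarrow> int" where
  "expo j = word_hom integer_group (\<lambda>i. if i = j then 1 else 0)"

lemma expo_simps [simp]:
  "expo j [] = 0"
  "expo j (a # w) = (if snd a = j then if fst a then 1 else -1 else 0) + expo j w"
  by (simp_all add: expo_def group.word_hom_simps)

lemma expo_gen [simp]: "expo j (gen i) = (if i = j then 1 else 0)"
  by (simp add: gen_def)

lemma expo_hom: "expo j \<in> hom (free_grp n) integer_group"
  unfolding expo_def by (rule group.word_hom) auto

lemma expo_mult:
  "u \<in> carrier (free_grp n) \<Longrightarrow> v \<in> carrier (free_grp n) \<Longrightarrow>
    expo j (u \<otimes>\<^bsub>free_grp n\<^esub> v) = expo j u + expo j v"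
  using hom_mult[OF expo_hom] by fastforce

lemma expo_inv: "u \<in> carrier (free_grp n) \<Longrightarrow> expo j (inv\<^bsub>free_grp n\<^esub> u) = - expo j u"
  using group_hom.hom_inv[of "free_grp n" integer_group "expo j" u] expo_hom
  by (simp add: group_hom_def group_hom_axioms_def group_free_grp)

text \<open>For \<open>j \<noteq> k\<close> this is the coefficient of \<open>X\<^sub>j X\<^sub>k\<close> in the Magnus expansion
  \<open>x\<^sub>i \<mapsto> 1 + X\<^sub>i\<close>. It separates the elements of \<open>[F, F]\<close> modulo \<open>[F, [F, F]]\<close>.\<close>

fun magnus :: "nat \<Rightarrow> nat \<Rightarrow> letter list \<Rightarrow> int" where
  "magnus j k [] = 0"
| "magnus j k (a # w) = magnus j k w + expo j [a] * expo k w"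

text \<open>Cancelling \<open>a\<close> against its inverse changes the recursion by
  \<open>expo j [a] * expo k [inv_letter a]\<close>, which is zero because a letter cannot have both
  index \<open>j\<close> and index \<open>k\<close>.\<close>

lemma magnus_cons_red:
  "j \<noteq> k \<Longrightarrow> magnus j k (cons_red a w) = magnus j k (a # w)"
  by (cases w) (auto simp: inv_letter_def)

lemma expo_cons_red: "expo j (cons_red a w) = expo j (a # w)"
  by (cases w) (auto simp: inv_letter_def)

lemma expo_foldr: "expo j (foldr cons_red u v) = expo j u + expo j v"
  by (induction u) (auto simp: expo_cons_red)

text \<open>The Magnus expansion is multiplicative with constant term 1 and has the exponent sums as
  linear coefficients, so a quadratic coefficient of a product picks up one product of linear
  ones.\<close>

lemma magnus_mult:
  assumes "j \<noteq> k"
  shows "magnus j k (u \<otimes>\<^bsub>free_grp n\<^esub> v) = magnus j k u + expo j u * expo k v + magnus j k v"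
  unfolding mult_free_grp
  by (induction u) (auto simp: magnus_cons_red[OF assms] expo_foldr algebra_simps)

lemma magnus_inv:
  assumes "j \<noteq> k" "u \<in> carrier (free_grp n)"
  shows "magnus j k (inv\<^bsub>free_grp n\<^esub> u) = expo j u * expo k u - magnus j k u"
proof -
  interpret F: group "free_grp n" by (rule group_free_grp)
  have "magnus j k (inv\<^bsub>free_grp n\<^esub> u) + expo j (inv\<^bsub>free_grp n\<^esub> u) * expo k u + magnus j k u = 0"
    using magnus_mult[OF assms(1), where n = n and u = "inv\<^bsub>free_grp n\<^esub> u" and v = u] assms(2) by (simp add: one_free_grp)
  then show ?thesis using assms by (simp add: expo_inv)
qed

lemma commutator_closed [simp]:
  "group G \<Longrightarrow> x \<in> carrier G \<Longrightarrow> y \<in> carrier G \<Longrightarrow> commutator G x y \<in> carrier G"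
  by (simp add: commutator_def group.inv_closed monoid.m_closed group.is_monoid)

text \<open>The quadratic coefficients of x and y cancel against those of their inverses. What
  remains is a 2 by 2 minor of exponent sums, the same number that \<open>gen_coord_wedge\<close>
  gives for [x] wedge [y].\<close>

lemma magnus_commutator:
  assumes "j \<noteq> k" "x \<in> carrier (free_grp n)" "y \<in> carrier (free_grp n)"
  shows "magnus j k (commutator (free_grp n) x y) = expo j x * expo k y - expo j y * expo k x"
proof -
  interpret F: group "free_grp n" by (rule group_free_grp)
  show ?thesis
    unfolding commutator_def using assms
    by (simp add: magnus_mult magnus_inv expo_mult expo_inv algebra_simps)
qed

section \<open>The abelianization H and its dual\<close>

lemma derived_eq_commutators:
  "derived G (carrier G) = generate G {commutator G x y | x y. x \<in> carrier G \<and> y \<in> carrier G}"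
  unfolding derived_def commutator_def by (rule arg_cong[where f = "generate G"]) blast

lemma hom_comm_derived:
  assumes "group G" "comm_group C" "f \<in> hom G C" "x \<in> derived G (carrier G)"
  shows "f x = \<one>\<^bsub>C\<^esub>"
proof -
  interpret C: comm_group C by fact
  interpret f: group_hom G C f using assms by (simp add: group_hom_def group_hom_axioms_def comm_group_def)
  have "f ` derived G (carrier G) = derived C (f ` carrier G)"
    by (rule f.derived_img[symmetric]) simp
  also have "\<dots> = {\<one>\<^bsub>C\<^esub>}"
    by (rule C.derived_eq_singleton) (auto simp: f.hom_closed)
  finally show ?thesis using assms(4) by blast
qed

lemma comm_sub_normal: "comm_sub n \<lhd> free_grp n"
  by (rule group.derived_self_is_normal[OF group_free_grp])

lemma comm_sub_closed: "x \<in> comm_sub n \<Longrightarrow> x \<in> carrier (free_grp n)"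
  using group.derived_in_carrier[OF group_free_grp, of "carrier (free_grp n)" n] by blast

lemma commutator_comm_sub:
  "x \<in> carrier (free_grp n) \<Longrightarrow> y \<in> carrier (free_grp n) \<Longrightarrow> commutator (free_grp n) x y \<in> comm_sub n"
  unfolding derived_eq_commutators by (rule generate.incl) blast

lemma expo_comm_sub: "x \<in> comm_sub n \<Longrightarrow> expo j x = 0"
  using hom_comm_derived[OF group_free_grp abelian_integer_group expo_hom] by simp

lemma comm_group_ab: "comm_group (ab n)"
  unfolding ab_def by (rule group.derived_quot_is_comm_group[OF group_free_grp])

lemma group_ab [simp]: "group (ab n)"
  using comm_group_ab by (simp add: comm_group_def)

lemma ab_class_hom: "ab_class n \<in> hom (free_grp n) (ab n)"
  using normal.r_coset_hom_Mod[OF comm_sub_normal] unfolding ab_def ab_class_def[abs_def] .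

lemma carrier_ab: "carrier (ab n) = ab_class n ` carrier (free_grp n)"
  by (simp add: ab_def carrier_FactGroup ab_class_def)

lemma ab_class_closed [simp]: "x \<in> carrier (free_grp n) \<Longrightarrow> ab_class n x \<in> carrier (ab n)"
  by (simp add: carrier_ab)

lemma ab_class_mult:
  "x \<in> carrier (free_grp n) \<Longrightarrow> y \<in> carrier (free_grp n) \<Longrightarrow>
    ab_class n (x \<otimes>\<^bsub>free_grp n\<^esub> y) = ab_class n x \<otimes>\<^bsub>ab n\<^esub> ab_class n y"
  by (rule hom_mult[OF ab_class_hom])

lemma generate_ab: "generate (ab n) ((\<lambda>i. ab_class n (gen i)) ` {..<n}) = carrier (ab n)"
  using normal.generate_FactGroup[OF comm_sub_normal gen_funcset generate_gen]
  by (simp add: ab_def ab_class_def[abs_def] image_image)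

lemma (in normal) rcos_eq_iff: "x \<in> carrier G \<Longrightarrow> H #> x = H \<longleftrightarrow> x \<in> H"
  using coset_join1 coset_join2 subgroup_axioms by blast

lemma ab_class_eq_iff:
  assumes "x \<in> carrier (free_grp n)" "y \<in> carrier (free_grp n)"
  shows "ab_class n x = ab_class n y \<longleftrightarrow> inv\<^bsub>free_grp n\<^esub> x \<otimes>\<^bsub>free_grp n\<^esub> y \<in> comm_sub n"
proof -
  interpret F: group "free_grp n" by (rule group_free_grp)
  interpret N: normal "comm_sub n" "free_grp n" by (rule comm_sub_normal)
  interpret p: group_hom "free_grp n" "ab n" "ab_class n"
    using ab_class_hom by (simp add: group_hom_def group_hom_axioms_def group_free_grp)
  have "inv\<^bsub>free_grp n\<^esub> x \<otimes>\<^bsub>free_grp n\<^esub> y \<in> comm_sub n \<longleftrightarrow>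
      ab_class n (inv\<^bsub>free_grp n\<^esub> x \<otimes>\<^bsub>free_grp n\<^esub> y) = \<one>\<^bsub>ab n\<^esub>"
    unfolding ab_class_def ab_def one_FactGroup
    using assms by (simp add: N.rcos_eq_iff)
  also have "\<dots> \<longleftrightarrow> ab_class n x = ab_class n y"
    using assms by simp (metis p.H.inv_equality p.H.inv_inv p.H.inv_closed p.H.l_inv ab_class_closed)
  finally show ?thesis by blast
qed

lemma hom_ab_class_cong:
  assumes "comm_group C" "f \<in> hom (free_grp n) C"
    and "x \<in> carrier (free_grp n)" "y \<in> carrier (free_grp n)" "ab_class n x = ab_class n y"
  shows "f x = f y"
proof -
  interpret C: comm_group C by fact
  interpret f: group_hom "free_grp n" C f
    using assms by (simp add: group_hom_def group_hom_axioms_def group_free_grp comm_group_def)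
  have "f (inv\<^bsub>free_grp n\<^esub> x \<otimes>\<^bsub>free_grp n\<^esub> y) = \<one>\<^bsub>C\<^esub>"
    using assms ab_class_eq_iff hom_comm_derived[OF group_free_grp assms(1,2)] by blast
  then have "inv\<^bsub>C\<^esub> f x \<otimes>\<^bsub>C\<^esub> f y = \<one>\<^bsub>C\<^esub>" using assms(3,4) by simp
  then show ?thesis using assms(3,4)
    by (metis C.inv_equality C.inv_inv f.hom_closed C.inv_closed C.m_comm)
qed

text \<open>With one argument fixed, \<open>\<beta>\<close> is a homomorphism to an abelian group
  and depends only on the class of the other argument. Choosing a word in every coset therefore
  defines a bilinear map on H.\<close>

lemma bilinear_ab:
  assumes C: "comm_group C" and \<beta>: "bilinear (free_grp n) (free_grp n) C \<beta>"
  obtains \<gamma> where "bilinear (ab n) (ab n) C \<gamma>"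
    and "\<And>x y. x \<in> carrier (free_grp n) \<Longrightarrow> y \<in> carrier (free_grp n) \<Longrightarrow>
      \<gamma> (ab_class n x) (ab_class n y) = \<beta> x y"
proof -
  interpret F: group "free_grp n" by (rule group_free_grp)
  define rep where "rep h = (SOME x. x \<in> carrier (free_grp n) \<and> ab_class n x = h)" for h
  have rep: "rep (ab_class n x) \<in> carrier (free_grp n)" "ab_class n (rep (ab_class n x)) = ab_class n x"
    if "x \<in> carrier (free_grp n)" for x
    using someI[of "\<lambda>y. y \<in> carrier (free_grp n) \<and> ab_class n y = ab_class n x" x] that
    by (auto simp: rep_def)
  have \<gamma>: "\<beta> (rep (ab_class n x)) (rep (ab_class n y)) = \<beta> x y"
    if x: "x \<in> carrier (free_grp n)" and y: "y \<in> carrier (free_grp n)" for x y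
  proof -
    have "\<beta> (rep (ab_class n x)) (rep (ab_class n y)) = \<beta> (rep (ab_class n x)) y"
      by (rule hom_ab_class_cong[OF C bilinear_hom(1)[OF \<beta>]]) (use x y rep in auto)
    also have "\<dots> = \<beta> x y"
      by (rule hom_ab_class_cong[OF C bilinear_hom(2)[OF \<beta>]]) (use x y rep in auto)
    finally show ?thesis .
  qed
  show thesis
  proof
    show "bilinear (ab n) (ab n) C (\<lambda>h k. \<beta> (rep h) (rep k))"
      using \<beta> by (intro bilinearI) (auto simp: carrier_ab \<gamma> bilinear_def simp flip: ab_class_mult)
  qed (rule \<gamma>)
qed

lemma ab_universal:
  assumes "comm_group C" "f \<in> hom (free_grp n) C"
  obtains g where "g \<in> hom (ab n) C" and "\<And>x. x \<in> carrier (free_grp n) \<Longrightarrow> g (ab_class n x) = f x"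
proof -
  have "f x = f y" if "x \<in> carrier (free_grp n)" "y \<in> carrier (free_grp n)"
    "comm_sub n #>\<^bsub>free_grp n\<^esub> x = comm_sub n #>\<^bsub>free_grp n\<^esub> y" for x y
    by (rule hom_ab_class_cong[OF assms that(1,2)]) (simp add: ab_class_def that(3))
  then obtain g where "g \<in> hom (free_grp n Mod comm_sub n) C"
    "\<And>x. x \<in> carrier (free_grp n) \<Longrightarrow> g (comm_sub n #>\<^bsub>free_grp n\<^esub> x) = f x"
    using FactGroup_universal[OF assms(2) comm_sub_normal] by blast
  then show thesis by (intro that[of g]) (simp_all add: ab_def ab_class_def)
qed

lemma ab_hom_eq:
  assumes "group K" "f \<in> hom (ab n) K" "g \<in> hom (ab n) K"
    and "\<And>i. i < n \<Longrightarrow> f (ab_class n (gen i)) = g (ab_class n (gen i))" and "x \<in> carrier (ab n)"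
  shows "f x = g x"
  by (rule hom_eq_on_generators[OF group_ab assms(1-3) _ generate_ab _ assms(5)])
    (use assms(4) in auto)

lemma comm_group_ab_dual: "comm_group (ab_dual n)"
  unfolding ab_dual_def by (rule comm_group_hom_group) (simp_all add: abelian_integer_group)

text \<open>The vector of H^* dual to the class of x_j. \<open>SOME\<close> is used because a class
  is a coset without a preferred word; \<open>ab_universal\<close>, applied to the exponent sum,
  supplies a candidate.\<close>

definition dual_gen :: "nat \<Rightarrow> nat \<Rightarrow> letter list set \<Rightarrow> int" where
  "dual_gen n j = (SOME \<phi>. \<phi> \<in> carrier (ab_dual n) \<and>
     (\<forall>x\<in>carrier (free_grp n). \<phi> (ab_class n x) = expo j x))"

lemma dual_gen: "dual_gen n j \<in> carrier (ab_dual n)"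
  and dual_gen_ab_class: "x \<in> carrier (free_grp n) \<Longrightarrow> dual_gen n j (ab_class n x) = expo j x"
proof -
  obtain g where g: "g \<in> hom (ab n) integer_group"
    "\<And>x. x \<in> carrier (free_grp n) \<Longrightarrow> g (ab_class n x) = expo j x"
    using ab_universal[OF abelian_integer_group expo_hom] by metis
  have "restrict g (carrier (ab n)) \<in> carrier (ab_dual n) \<and>
     (\<forall>x\<in>carrier (free_grp n). restrict g (carrier (ab n)) (ab_class n x) = expo j x)"
    using g by (auto simp: ab_dual_def hom_group_def hom_def monoid.m_closed[OF group.is_monoid[OF group_ab]])
  then have "\<exists>\<phi>. \<phi> \<in> carrier (ab_dual n) \<and> (\<forall>x\<in>carrier (free_grp n). \<phi> (ab_class n x) = expo j x)"
    by blast
  then have "dual_gen n j \<in> carrier (ab_dual n) \<and>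
     (\<forall>x\<in>carrier (free_grp n). dual_gen n j (ab_class n x) = expo j x)"
    unfolding dual_gen_def by (rule someI_ex)
  then show "dual_gen n j \<in> carrier (ab_dual n)"
    "x \<in> carrier (free_grp n) \<Longrightarrow> dual_gen n j (ab_class n x) = expo j x" by auto
qed

section \<open>The second graded quotient of the free group\<close>

lemma (in group) commutator_conj:
  assumes "g \<in> carrier G" "x \<in> carrier G" "y \<in> carrier G"
  shows "g \<otimes> commutator G x y \<otimes> inv g = commutator G (g \<otimes> x \<otimes> inv g) (g \<otimes> y \<otimes> inv g)"
proof -
  have "inv g \<otimes> (g \<otimes> z) = z" if "z \<in> carrier G" for z
    using assms(1) that by (simp add: m_assoc[symmetric])
  then show ?thesis using assms by (simp add: commutator_def m_assoc inv_mult_group)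
qed

lemma (in group) commutator_mult:
  assumes "x \<in> carrier G" "y \<in> carrier G"
  shows "x \<otimes> y = commutator G x y \<otimes> (y \<otimes> x)"
proof -
  have "inv y \<otimes> (y \<otimes> x) = x" "inv x \<otimes> x = \<one>"
    using assms by (simp_all add: m_assoc[symmetric])
  then show ?thesis using assms by (simp add: commutator_def m_assoc)
qed

text \<open>In general [xy, z] = x [y, z] x^-1 [x, z]; the conjugation disappears because [y, z]
  commutes with everything.\<close>

lemma (in group) commutator_mult_left:
  assumes "x \<in> carrier G" "y \<in> carrier G" "z \<in> carrier G"
    and c: "\<And>g. g \<in> carrier G \<Longrightarrow> g \<otimes> commutator G y z = commutator G y z \<otimes> g"
  shows "commutator G (x \<otimes> y) z = commutator G x z \<otimes> commutator G y z"
proof -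
  have i: "inv z \<otimes> (z \<otimes> u) = u" "inv x \<otimes> (x \<otimes> u) = u" if "u \<in> carrier G" for u
    using assms that by (simp_all add: m_assoc[symmetric])
  have "commutator G (x \<otimes> y) z = (x \<otimes> commutator G y z) \<otimes> (inv x \<otimes> commutator G x z)"
    using assms(1-3) i by (simp add: commutator_def m_assoc inv_mult_group)
  also have "\<dots> = commutator G y z \<otimes> (x \<otimes> (inv x \<otimes> commutator G x z))"
    using assms(1-3) by (simp add: c m_assoc is_group)
  also have "\<dots> = commutator G y z \<otimes> commutator G x z"
    using assms(1-3) by (simp add: m_assoc[symmetric] is_group)
  also have "\<dots> = commutator G x z \<otimes> commutator G y z"
    using assms(1-3) by (simp add: c is_group)
  finally show ?thesis .
qed

text \<open>Here the general identity is [x, yz] = [x, y] y [x, z] y^-1, and [x, z] is the central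
  factor.\<close>

lemma (in group) commutator_mult_right:
  assumes "x \<in> carrier G" "y \<in> carrier G" "z \<in> carrier G"
    and c: "\<And>g. g \<in> carrier G \<Longrightarrow> g \<otimes> commutator G x z = commutator G x z \<otimes> g"
  shows "commutator G x (y \<otimes> z) = commutator G x y \<otimes> commutator G x z"
proof -
  have i: "inv x \<otimes> (x \<otimes> u) = u" "inv y \<otimes> (y \<otimes> u) = u" if "u \<in> carrier G" for u
    using assms that by (simp_all add: m_assoc[symmetric])
  have "commutator G x (y \<otimes> z) = commutator G x y \<otimes> ((y \<otimes> commutator G x z) \<otimes> inv y)"
    using assms(1-3) i by (simp add: commutator_def m_assoc inv_mult_group)
  also have "\<dots> = commutator G x y \<otimes> (commutator G x z \<otimes> (y \<otimes> inv y))"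
    using assms(1-3) by (simp add: c m_assoc is_group del: r_inv)
  finally show ?thesis using assms(1-3) by (simp add: is_group)
qed

text \<open>Conjugating a generator [x, y] conjugates both entries, and [F, F] is normal, so the
  generating set itself is stable under conjugation.\<close>

lemma lower3_normal: "lower3 n \<lhd> free_grp n"
  unfolding lower3_def
proof (rule group.normal_generateI[OF group_free_grp])
  interpret F: group "free_grp n" by (rule group_free_grp)
  show "{commutator (free_grp n) x y | x y. x \<in> carrier (free_grp n) \<and> y \<in> comm_sub n}
      \<subseteq> carrier (free_grp n)"
    using commutator_closed[OF F.is_group] comm_sub_closed by blast
  fix h g assume "h \<in> {commutator (free_grp n) x y | x y. x \<in> carrier (free_grp n) \<and> y \<in> comm_sub n}"
    and g: "g \<in> carrier (free_grp n)"
  then obtain x y where h: "h = commutator (free_grp n) x y"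
    and x: "x \<in> carrier (free_grp n)" and y: "y \<in> comm_sub n" by blast
  have "g \<otimes>\<^bsub>free_grp n\<^esub> y \<otimes>\<^bsub>free_grp n\<^esub> inv\<^bsub>free_grp n\<^esub> g \<in> comm_sub n"
    by (rule normal.inv_op_closed2[OF comm_sub_normal g y])
  then show "g \<otimes>\<^bsub>free_grp n\<^esub> h \<otimes>\<^bsub>free_grp n\<^esub> inv\<^bsub>free_grp n\<^esub> g
      \<in> {commutator (free_grp n) x y | x y. x \<in> carrier (free_grp n) \<and> y \<in> comm_sub n}"
    unfolding h F.commutator_conj[OF g x comm_sub_closed[OF y]] using g x by blast
qed

lemma commutator_lower3:
  "x \<in> carrier (free_grp n) \<Longrightarrow> y \<in> comm_sub n \<Longrightarrow> commutator (free_grp n) x y \<in> lower3 n"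
  unfolding lower3_def by (rule generate.incl) blast

lemma lower3_subset: "lower3 n \<subseteq> comm_sub n"
  unfolding lower3_def
  by (rule group.generate_subgroup_incl[OF group_free_grp])
    (auto intro: commutator_comm_sub comm_sub_closed normal_imp_subgroup[OF comm_sub_normal])

lemma comm_sub_mult:
    "x \<in> comm_sub n \<Longrightarrow> y \<in> comm_sub n \<Longrightarrow> x \<otimes>\<^bsub>free_grp n\<^esub> y \<in> comm_sub n"
  and comm_sub_inv: "x \<in> comm_sub n \<Longrightarrow> inv\<^bsub>free_grp n\<^esub> x \<in> comm_sub n"
  and comm_sub_one: "\<one>\<^bsub>free_grp n\<^esub> \<in> comm_sub n"
  using normal_imp_subgroup[OF comm_sub_normal]
  by (auto intro: subgroup.m_closed subgroup.m_inv_closed subgroup.one_closed)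

text \<open>For a generator [x, y] the exponent sums of y vanish, and with them the minor in
  \<open>magnus_commutator\<close>.\<close>

lemma magnus_lower3:
  assumes "j \<noteq> k" "c \<in> lower3 n" shows "magnus j k c = 0"
proof -
  \<comment> \<open>The vanishing exponent sums are carried through the induction, since they remove
    the extra terms of \<open>magnus_mult\<close> and \<open>magnus_inv\<close>.\<close>
  have "c \<in> carrier (free_grp n) \<and> expo j c = 0 \<and> expo k c = 0 \<and> magnus j k c = 0"
    using assms(2) unfolding lower3_def
  proof (induction rule: generate.induct)
    case one
    show ?case by (simp add: one_free_grp mem_free_grp)
  next
    case (incl h)
    then obtain x y where "h = commutator (free_grp n) x y" "x \<in> carrier (free_grp n)" "y \<in> comm_sub n"
      by blast
    then show ?case
      by (simp add: magnus_commutator[OF assms(1)] expo_comm_sub[of _ n] commutator_comm_sub comm_sub_closed group_free_grp)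
  next
    case (inv h)
    then obtain x y where "h = commutator (free_grp n) x y" "x \<in> carrier (free_grp n)" "y \<in> comm_sub n"
      by blast
    then show ?case
      using group.inv_closed[OF group_free_grp, of h n]
      by (simp add: magnus_commutator[OF assms(1)] expo_comm_sub[of _ n] commutator_comm_sub comm_sub_closed
          group_free_grp magnus_inv[OF assms(1)] expo_inv)
  next
    case (eng a b)
    then show ?case
      using monoid.m_closed[OF group.is_monoid[OF group_free_grp], of a n b]
      by (simp add: magnus_mult[OF assms(1)] expo_mult)
  qed
  then show ?thesis by blast
qed

text \<open>Cosets are multiplied as sets, alike in [F, F] and in F. Calculations in
  \<open>gr2\<close> can thus be made in the quotient of all of F, where classes of words outside
  [F, F] are available as entries of commutators.\<close>

lemma mult_gr2: "(\<otimes>\<^bsub>gr2 n\<^esub>) = (\<otimes>\<^bsub>free_grp n Mod lower3 n\<^esub>)"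
  by (simp add: gr2_def set_mult_def fun_eq_iff)

lemma carrier_gr2: "carrier (gr2 n) = gr2_class n ` comm_sub n"
  by (simp add: gr2_def carrier_FactGroup gr2_class_def r_coset_def)

lemma one_gr2: "\<one>\<^bsub>gr2 n\<^esub> = lower3 n"
  by (simp add: gr2_def)

lemma gr2_class_hom: "gr2_class n \<in> hom (free_grp n) (free_grp n Mod lower3 n)"
  using normal.r_coset_hom_Mod[OF lower3_normal] unfolding gr2_class_def[abs_def] .

lemma gr2_class_mult:
  "x \<in> carrier (free_grp n) \<Longrightarrow> y \<in> carrier (free_grp n) \<Longrightarrow>
    gr2_class n (x \<otimes>\<^bsub>free_grp n\<^esub> y) = gr2_class n x \<otimes>\<^bsub>gr2 n\<^esub> gr2_class n y"
  unfolding mult_gr2 by (rule hom_mult[OF gr2_class_hom])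

lemma gr2_class_one_iff:
  assumes "c \<in> carrier (free_grp n)"
  shows "gr2_class n c = \<one>\<^bsub>gr2 n\<^esub> \<longleftrightarrow> c \<in> lower3 n"
proof -
  interpret N: normal "lower3 n" "free_grp n" by (rule lower3_normal)
  show ?thesis unfolding gr2_class_def one_gr2 using assms by (rule N.rcos_eq_iff)
qed

text \<open>By x y = [x, y] y x the two products differ by a factor in
  \<open>lower3\<close>.\<close>

lemma gr2_class_central:
  assumes "x \<in> carrier (free_grp n)" "y \<in> comm_sub n"
  shows "gr2_class n x \<otimes>\<^bsub>gr2 n\<^esub> gr2_class n y = gr2_class n y \<otimes>\<^bsub>gr2 n\<^esub> gr2_class n x"
proof -
  interpret F: group "free_grp n" by (rule group_free_grp)
  interpret N: normal "lower3 n" "free_grp n" by (rule lower3_normal)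
  interpret Q: group "free_grp n Mod lower3 n" by (rule N.factorgroup_is_group)
  interpret p: group_hom "free_grp n" "free_grp n Mod lower3 n" "gr2_class n"
    using gr2_class_hom by (simp add: group_hom_def group_hom_axioms_def F.is_group Q.is_group)
  have y: "y \<in> carrier (free_grp n)" using assms(2) by (rule comm_sub_closed)
  have "gr2_class n (x \<otimes>\<^bsub>free_grp n\<^esub> y) =
      gr2_class n (commutator (free_grp n) x y) \<otimes>\<^bsub>gr2 n\<^esub> gr2_class n (y \<otimes>\<^bsub>free_grp n\<^esub> x)"
    using F.commutator_mult[OF assms(1) y] assms(1) y F.is_group
    by (metis F.m_closed commutator_closed gr2_class_mult)
  also have "gr2_class n (commutator (free_grp n) x y) = \<one>\<^bsub>gr2 n\<^esub>"
    using commutator_lower3[OF assms] assms(1) y by (simp add: gr2_class_one_iff F.is_group)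
  finally show ?thesis
    using assms(1) y by (simp add: gr2_class_mult one_gr2 mult_gr2 del: mult_FactGroup)
      (metis Q.l_one one_FactGroup p.hom_closed Q.m_closed)
qed

lemma comm_group_gr2: "comm_group (gr2 n)"
proof (rule group.group_comm_groupI)
  show "group (gr2 n)"
    unfolding gr2_def
    by (rule normal.factorgroup_is_group)
      (rule group.normal_restrict_supergroup[OF group_free_grp normal_imp_subgroup[OF comm_sub_normal]
          lower3_normal lower3_subset])
  show "x \<otimes>\<^bsub>gr2 n\<^esub> y = y \<otimes>\<^bsub>gr2 n\<^esub> x" if "x \<in> carrier (gr2 n)" "y \<in> carrier (gr2 n)" for x y
    using that gr2_class_central comm_sub_closed unfolding carrier_gr2 by blast
qed

lemma gr2_class_closed [simp]: "c \<in> comm_sub n \<Longrightarrow> gr2_class n c \<in> carrier (gr2 n)"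
  by (simp add: carrier_gr2)

lemma gr2_class_inv:
  assumes "c \<in> comm_sub n"
  shows "gr2_class n (inv\<^bsub>free_grp n\<^esub> c) = inv\<^bsub>gr2 n\<^esub> gr2_class n c"
proof -
  interpret F: group "free_grp n" by (rule group_free_grp)
  interpret C: comm_group "gr2 n" by (rule comm_group_gr2)
  have "gr2_class n (inv\<^bsub>free_grp n\<^esub> c) \<otimes>\<^bsub>gr2 n\<^esub> gr2_class n c = \<one>\<^bsub>gr2 n\<^esub>"
    using assms comm_sub_closed[OF assms] gr2_class_one_iff[OF F.one_closed]
      subgroup.one_closed[OF normal_imp_subgroup[OF lower3_normal]]
    by (simp flip: gr2_class_mult)
  then show ?thesis
    using assms by (intro C.inv_equality[symmetric]) (simp_all add: comm_sub_inv)
qed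

lemma gr2_class_commutator:
  assumes "x \<in> carrier (free_grp n)" "y \<in> carrier (free_grp n)"
  shows "gr2_class n (commutator (free_grp n) x y) =
    commutator (free_grp n Mod lower3 n) (gr2_class n x) (gr2_class n y)"
proof -
  interpret p: group_hom "free_grp n" "free_grp n Mod lower3 n" "gr2_class n"
    using gr2_class_hom normal.factorgroup_is_group[OF lower3_normal]
    by (simp add: group_hom_def group_hom_axioms_def group_free_grp)
  show ?thesis unfolding commutator_def using assms by (simp del: mult_FactGroup)
qed

text \<open>Classes of commutators are central in F / [F, [F, F]], so the expansions of [xy, z] and
  [x, yz] become additive.\<close>

lemma bilinear_gr2:
  "bilinear (free_grp n) (free_grp n) (gr2 n) (\<lambda>x y. gr2_class n (commutator (free_grp n) x y))"
proof (rule bilinearI)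
  interpret F: group "free_grp n" by (rule group_free_grp)
  interpret Q: group "free_grp n Mod lower3 n" by (rule normal.factorgroup_is_group[OF lower3_normal])
  have cl: "gr2_class n x \<in> carrier (free_grp n Mod lower3 n)" if "x \<in> carrier (free_grp n)" for x
    using that hom_in_carrier[OF gr2_class_hom] by blast
  have central: "g \<otimes>\<^bsub>free_grp n Mod lower3 n\<^esub> commutator (free_grp n Mod lower3 n) (gr2_class n x) (gr2_class n y)
     = commutator (free_grp n Mod lower3 n) (gr2_class n x) (gr2_class n y) \<otimes>\<^bsub>free_grp n Mod lower3 n\<^esub> g"
    if "x \<in> carrier (free_grp n)" "y \<in> carrier (free_grp n)"
      and g: "g \<in> carrier (free_grp n Mod lower3 n)" for x y g
  proof -
    obtain z where "z \<in> carrier (free_grp n)" "g = gr2_class n z"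
      using g by (auto simp: carrier_FactGroup gr2_class_def)
    then show ?thesis
      using gr2_class_central[of z n "commutator (free_grp n) x y"] commutator_comm_sub[of x n y] that
      by (simp add: gr2_class_commutator mult_gr2 del: mult_FactGroup)
  qed
  fix x y z assume x: "x \<in> carrier (free_grp n)" and y: "y \<in> carrier (free_grp n)" and z: "z \<in> carrier (free_grp n)"
  show "gr2_class n (commutator (free_grp n) x y) \<in> carrier (gr2 n)"
    using x y by (simp add: commutator_comm_sub)
  have xy: "gr2_class n (x \<otimes>\<^bsub>free_grp n\<^esub> y) = gr2_class n x \<otimes>\<^bsub>free_grp n Mod lower3 n\<^esub> gr2_class n y"
    using x y by (rule hom_mult[OF gr2_class_hom])
  have yz: "gr2_class n (y \<otimes>\<^bsub>free_grp n\<^esub> z) = gr2_class n y \<otimes>\<^bsub>free_grp n Mod lower3 n\<^esub> gr2_class n z"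
    using y z by (rule hom_mult[OF gr2_class_hom])
  show "gr2_class n (commutator (free_grp n) (x \<otimes>\<^bsub>free_grp n\<^esub> y) z) =
      gr2_class n (commutator (free_grp n) x z) \<otimes>\<^bsub>gr2 n\<^esub> gr2_class n (commutator (free_grp n) y z)"
    using Q.commutator_mult_left[OF cl[OF x] cl[OF y] cl[OF z] central[OF y z]] x y z
    by (simp add: gr2_class_commutator xy mult_gr2 del: mult_FactGroup)
  show "gr2_class n (commutator (free_grp n) x (y \<otimes>\<^bsub>free_grp n\<^esub> z)) =
      gr2_class n (commutator (free_grp n) x y) \<otimes>\<^bsub>gr2 n\<^esub> gr2_class n (commutator (free_grp n) x z)"
    using Q.commutator_mult_right[OF cl[OF x] cl[OF y] cl[OF z] central[OF x z]] x y z
    by (simp add: gr2_class_commutator yz mult_gr2 del: mult_FactGroup)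
qed

text \<open>The functional \<open>\<psi>\<close> wedge \<open>\<chi>\<close> on the exterior square,
  a 2 by 2 determinant on decomposable elements. When \<open>\<psi>\<close> and
  \<open>\<chi>\<close> are homomorphisms, it exists by \<open>ext2_universal\<close>.\<close>

definition wedge_dual ::
  "('a, 'c) monoid_scheme \<Rightarrow> ('a \<Rightarrow> int) \<Rightarrow> ('a \<Rightarrow> int) \<Rightarrow> ('a \<times> 'a \<Rightarrow>\<^sub>0 int) set set \<Rightarrow> int" where
  "wedge_dual A \<psi> \<chi> = (SOME \<omega>. \<omega> \<in> hom (ext2 A) integer_group \<and>
     (\<forall>a\<in>carrier A. \<forall>b\<in>carrier A. \<omega> (wedge A a b) = \<psi> a * \<chi> b - \<chi> a * \<psi> b))"

lemma
  assumes A: "comm_group A" and \<psi>: "\<psi> \<in> hom A integer_group" and \<chi>: "\<chi> \<in> hom A integer_group"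
  shows wedge_dual: "wedge_dual A \<psi> \<chi> \<in> hom (ext2 A) integer_group"
    and wedge_dual_wedge: "a \<in> carrier A \<Longrightarrow> b \<in> carrier A \<Longrightarrow>
      wedge_dual A \<psi> \<chi> (wedge A a b) = \<psi> a * \<chi> b - \<chi> a * \<psi> b"
proof -
  have "bilinear A A integer_group (\<lambda>a b. \<psi> a * \<chi> b - \<chi> a * \<psi> b)"
    using \<psi> \<chi> by (intro bilinearI) (auto simp: hom_def algebra_simps)
  then obtain h where "h \<in> hom (ext2 A) integer_group"
    "\<And>a b. a \<in> carrier A \<Longrightarrow> b \<in> carrier A \<Longrightarrow> h (wedge A a b) = \<psi> a * \<chi> b - \<chi> a * \<psi> b"
    by (rule ext2_universal[OF A abelian_integer_group]) auto
  then have "\<exists>\<omega>. \<omega> \<in> hom (ext2 A) integer_group \<and>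
     (\<forall>a\<in>carrier A. \<forall>b\<in>carrier A. \<omega> (wedge A a b) = \<psi> a * \<chi> b - \<chi> a * \<psi> b)" by blast
  then have "wedge_dual A \<psi> \<chi> \<in> hom (ext2 A) integer_group \<and>
     (\<forall>a\<in>carrier A. \<forall>b\<in>carrier A. wedge_dual A \<psi> \<chi> (wedge A a b) = \<psi> a * \<chi> b - \<chi> a * \<psi> b)"
    unfolding wedge_dual_def by (rule someI_ex)
  then show "wedge_dual A \<psi> \<chi> \<in> hom (ext2 A) integer_group"
    "a \<in> carrier A \<Longrightarrow> b \<in> carrier A \<Longrightarrow> wedge_dual A \<psi> \<chi> (wedge A a b) = \<psi> a * \<chi> b - \<chi> a * \<psi> b"
    by auto
qed

text \<open>Expand (a + b) wedge (a + b), which is trivial, and drop the two trivial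
  squares.\<close>

lemma wedge_swap:
  assumes A: "comm_group A" and a: "a \<in> carrier A" and b: "b \<in> carrier A"
  shows "wedge A b a = inv\<^bsub>ext2 A\<^esub> wedge A a b"
proof -
  interpret A: comm_group A by fact
  interpret E: comm_group "ext2 A" by (rule comm_group_ext2[OF A])
  note bil = bilinear_wedge[OF A, unfolded bilinear_def]
  have "wedge A (a \<otimes>\<^bsub>A\<^esub> b) (a \<otimes>\<^bsub>A\<^esub> b) =
      wedge A a (a \<otimes>\<^bsub>A\<^esub> b) \<otimes>\<^bsub>ext2 A\<^esub> wedge A b (a \<otimes>\<^bsub>A\<^esub> b)"
    using bil a b A.m_closed[OF a b] by blast
  moreover have "wedge A a (a \<otimes>\<^bsub>A\<^esub> b) = wedge A a a \<otimes>\<^bsub>ext2 A\<^esub> wedge A a b"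
    "wedge A b (a \<otimes>\<^bsub>A\<^esub> b) = wedge A b a \<otimes>\<^bsub>ext2 A\<^esub> wedge A b b"
    using bil a b by blast+
  ultimately have "\<one>\<^bsub>ext2 A\<^esub> = wedge A b a \<otimes>\<^bsub>ext2 A\<^esub> wedge A a b"
    using a b by (simp add: wedge_self[OF A] E.m_comm)
  then show ?thesis using a b by (intro E.inv_equality[symmetric]) simp_all
qed

lemma bilinear_eq_on_generators:
  assumes "group A" "group B" "group C" "bilinear A B C \<beta>" "bilinear A B C \<gamma>"
    and S: "S \<subseteq> carrier A" "generate A S = carrier A" and T: "T \<subseteq> carrier B" "generate B T = carrier B"
    and eq: "\<And>s t. s \<in> S \<Longrightarrow> t \<in> T \<Longrightarrow> \<beta> s t = \<gamma> s t"
    and a: "a \<in> carrier A" and b: "b \<in> carrier B"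
  shows "\<beta> a b = \<gamma> a b"
proof -
  have "\<beta> s b = \<gamma> s b" if "s \<in> S" for s
    by (rule hom_eq_on_generators[OF assms(2,3) bilinear_hom(1)[OF assms(4)]
          bilinear_hom(1)[OF assms(5)] T eq b]) (use that S in auto)
  then show ?thesis
    by (rule hom_eq_on_generators[OF assms(1,3) bilinear_hom(2)[OF assms(4) b]
          bilinear_hom(2)[OF assms(5) b] S _ a])
qed

abbreviation gen_wedge :: "nat \<Rightarrow> nat \<Rightarrow> nat \<Rightarrow> ext2_ab" where
  "gen_wedge n i j \<equiv> wedge (ab n) (ab_class n (gen i)) (ab_class n (gen j))"

abbreviation gen_coord :: "nat \<Rightarrow> nat \<Rightarrow> nat \<Rightarrow> ext2_ab \<Rightarrow> int" where
  "gen_coord n i j \<equiv> wedge_dual (ab n) (dual_gen n i) (dual_gen n j)"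

lemma dual_gen_hom: "dual_gen n j \<in> hom (ab n) integer_group"
  using dual_gen[of n j] by (simp add: ab_dual_def hom_group_def)

lemma gen_coord_hom: "gen_coord n i j \<in> hom (ext2 (ab n)) integer_group"
  by (intro wedge_dual comm_group_ab dual_gen_hom)

lemma gen_coord_wedge:
  "x \<in> carrier (free_grp n) \<Longrightarrow> y \<in> carrier (free_grp n) \<Longrightarrow>
   gen_coord n i j (wedge (ab n) (ab_class n x) (ab_class n y)) = expo i x * expo j y - expo j x * expo i y"
  by (simp add: wedge_dual_wedge comm_group_ab dual_gen_hom dual_gen_ab_class)

text \<open>The right-hand side is an endomorphism of the exterior square that fixes every wedge of
  two generators, hence everything. It is used to see that an element whose coordinates all vanish
  is trivial.\<close>

lemma ext2_ab_expand:
  assumes w: "w \<in> carrier (ext2 (ab n))"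
  shows "w = finprod (ext2 (ab n)) (\<lambda>p. gen_wedge n (fst p) (snd p)
      [^]\<^bsub>ext2 (ab n)\<^esub> gen_coord n (fst p) (snd p) w) {p. fst p < snd p \<and> snd p < n}"
    (is "w = ?\<rho> w")
proof -
  interpret E: comm_group "ext2 (ab n)" by (rule comm_group_ext2[OF comm_group_ab])
  let ?P = "{p. fst p < snd p \<and> snd p < n} :: (nat \<times> nat) set"
  have P: "finite ?P" by (rule finite_subset[of _ "{..<n} \<times> {..<n}"]) auto
  have cl: "gen_wedge n (fst p) (snd p) \<in> carrier (ext2 (ab n))" if "p \<in> ?P" for p
    using that by auto
  have \<rho>: "?\<rho> \<in> hom (ext2 (ab n)) (ext2 (ab n))"
  proof (rule homI)
    show "?\<rho> u \<in> carrier (ext2 (ab n))" if "u \<in> carrier (ext2 (ab n))" for u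
      by (rule E.finprod_closed) (use cl in blast)
    fix u v assume u: "u \<in> carrier (ext2 (ab n))" and v: "v \<in> carrier (ext2 (ab n))"
    have "gen_coord n i j (u \<otimes>\<^bsub>ext2 (ab n)\<^esub> v) = gen_coord n i j u + gen_coord n i j v" for i j
      using hom_mult[OF gen_coord_hom u v] by simp
    then have "?\<rho> (u \<otimes>\<^bsub>ext2 (ab n)\<^esub> v) = finprod (ext2 (ab n)) (\<lambda>p.
        gen_wedge n (fst p) (snd p) [^]\<^bsub>ext2 (ab n)\<^esub> gen_coord n (fst p) (snd p) u \<otimes>\<^bsub>ext2 (ab n)\<^esub>
        gen_wedge n (fst p) (snd p) [^]\<^bsub>ext2 (ab n)\<^esub> gen_coord n (fst p) (snd p) v) ?P"
      using cl by (intro E.finprod_cong) (auto simp: E.int_pow_mult simp_implies_def)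
    also have "\<dots> = ?\<rho> u \<otimes>\<^bsub>ext2 (ab n)\<^esub> ?\<rho> v"
      by (rule E.finprod_multf) (use cl in blast)+
    finally show "?\<rho> (u \<otimes>\<^bsub>ext2 (ab n)\<^esub> v) = ?\<rho> u \<otimes>\<^bsub>ext2 (ab n)\<^esub> ?\<rho> v" .
  qed
  interpret r: group_hom "ext2 (ab n)" "ext2 (ab n)" ?\<rho>
    using \<rho> by (simp add: group_hom_def group_hom_axioms_def E.is_group)
  have less_case: "?\<rho> (gen_wedge n l m) = gen_wedge n l m" if "l < m" "m < n" for l m
  proof -
    have lm: "(l, m) \<in> ?P" using that by simp
    have "?\<rho> (gen_wedge n l m) = finprod (ext2 (ab n)) (\<lambda>p. if p = (l, m)
        then gen_wedge n (fst p) (snd p) else \<one>\<^bsub>ext2 (ab n)\<^esub>) ?P"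
      using that cl by (intro E.finprod_cong') (auto simp: gen_coord_wedge)
    also have "\<dots> = gen_wedge n l m"
      using E.finprod_singleton_swap[OF lm P, of "\<lambda>p. gen_wedge n (fst p) (snd p)"] cl by auto
    finally show ?thesis .
  qed
  have gens: "?\<rho> (gen_wedge n l m) = gen_wedge n l m" if "l < n" "m < n" for l m
  proof (cases l m rule: linorder_cases)
    case less then show ?thesis using \<open>m < n\<close> by (rule less_case)
  next
    case equal then show ?thesis using that by (simp add: wedge_self comm_group_ab)
  next
    \<comment> \<open>The product runs over increasing pairs only; a wedge in the opposite order is
      the inverse of one already treated.\<close>
    case greater
    then show ?thesis
      using that wedge_swap[OF comm_group_ab, of "ab_class n (gen m)" n "ab_class n (gen l)"] less_case[of m l]
        r.hom_inv[of "gen_wedge n m l"] by simp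
  qed
  have S: "(\<lambda>i. ab_class n (gen i)) ` {..<n} \<subseteq> carrier (ab n)" by auto
  have bil: "bilinear (ab n) (ab n) (ext2 (ab n)) (\<lambda>a b. ?\<rho> (wedge (ab n) a b))"
    using bilinear_wedge[OF comm_group_ab, of n] hom_mult[OF \<rho>] r.hom_closed
    unfolding bilinear_def by auto
  have wedges: "?\<rho> (wedge (ab n) a b) = wedge (ab n) a b" if "a \<in> carrier (ab n)" "b \<in> carrier (ab n)" for a b
    by (rule bilinear_eq_on_generators[OF group_ab group_ab E.is_group bil
          bilinear_wedge[OF comm_group_ab] S generate_ab S generate_ab _ that])
      (use gens in blast)
  have "(\<lambda>w. w) \<in> hom (ext2 (ab n)) (ext2 (ab n))" by (simp add: hom_def)
  from ext2_hom_eq[OF comm_group_ab E.is_group \<rho> this wedges w] show ?thesis by simp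
qed

text \<open>Taking commutators is bilinear and alternating, which gives \<open>h\<close>; it is onto
  because commutators generate [F, F]. Injectivity needs an invariant of the target: the Magnus
  coefficients of a suitable word for \<open>h w\<close> are the coordinates of \<open>w\<close>,
  and they vanish on \<open>lower3\<close>.\<close>

lemma ext2_to_gr2_ex1:
  "\<exists>!j. j \<in> iso (ext2 (ab n)) (gr2 n) \<inter> extensional (carrier (ext2 (ab n))) \<and>
     (\<forall>x\<in>carrier (free_grp n). \<forall>y\<in>carrier (free_grp n).
        j (wedge (ab n) (ab_class n x) (ab_class n y)) = gr2_class n (commutator (free_grp n) x y))"
proof -
  interpret F: group "free_grp n" by (rule group_free_grp)
  interpret E: comm_group "ext2 (ab n)" by (rule comm_group_ext2[OF comm_group_ab])
  interpret C: comm_group "gr2 n" by (rule comm_group_gr2)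
  let ?W = "{wedge (ab n) a b | a b. a \<in> carrier (ab n) \<and> b \<in> carrier (ab n)}"
  obtain \<gamma> where \<gamma>: "bilinear (ab n) (ab n) (gr2 n) \<gamma>"
    and \<gamma>_class: "\<And>x y. x \<in> carrier (free_grp n) \<Longrightarrow> y \<in> carrier (free_grp n) \<Longrightarrow>
      \<gamma> (ab_class n x) (ab_class n y) = gr2_class n (commutator (free_grp n) x y)"
    by (rule bilinear_ab[OF comm_group_gr2 bilinear_gr2]) (rule that)
  have "\<gamma> a a = \<one>\<^bsub>gr2 n\<^esub>" if "a \<in> carrier (ab n)" for a
  proof -
    obtain x where x: "x \<in> carrier (free_grp n)" "a = ab_class n x" using \<open>a \<in> carrier (ab n)\<close> by (auto simp: carrier_ab)
    have "commutator (free_grp n) x x = \<one>\<^bsub>free_grp n\<^esub>" using x by (simp add: commutator_def F.m_assoc)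
    then show ?thesis
      using x gr2_class_one_iff[OF F.one_closed]
        subgroup.one_closed[OF normal_imp_subgroup[OF lower3_normal]] by (simp add: \<gamma>_class)
  qed
  then obtain h where h: "h \<in> hom (ext2 (ab n)) (gr2 n)"
    and h_wedge: "\<And>a b. a \<in> carrier (ab n) \<Longrightarrow> b \<in> carrier (ab n) \<Longrightarrow> h (wedge (ab n) a b) = \<gamma> a b"
    using ext2_universal[OF comm_group_ab comm_group_gr2 \<gamma>] by metis
  interpret h: group_hom "ext2 (ab n)" "gr2 n" h
    using h by (simp add: group_hom_def group_hom_axioms_def)
  have W: "?W \<subseteq> carrier (ext2 (ab n))" by auto
  have rep_wedge: "\<exists>c\<in>comm_sub n. h u = gr2_class n c \<and> (\<forall>j k. j \<noteq> k \<longrightarrow> magnus j k c = gen_coord n j k u)"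
    if "u \<in> ?W" for u
  proof -
    obtain x y where xy: "x \<in> carrier (free_grp n)" "y \<in> carrier (free_grp n)"
      "u = wedge (ab n) (ab_class n x) (ab_class n y)"
      using \<open>u \<in> ?W\<close> by (auto simp: carrier_ab)
    then show ?thesis
      by (intro bexI[of _ "commutator (free_grp n) x y"])
        (auto simp: h_wedge \<gamma>_class magnus_commutator gen_coord_wedge commutator_comm_sub)
  qed
  \<comment> \<open>Each \<open>w\<close> gets one word that represents \<open>h w\<close> and has
    the coordinates of \<open>w\<close> as Magnus coefficients. On [F, F] these coefficients are
    additive, because the exponent sums vanish there.\<close>
  have rep: "\<exists>c\<in>comm_sub n. h w = gr2_class n c \<and> (\<forall>j k. j \<noteq> k \<longrightarrow> magnus j k c = gen_coord n j k w)"
    if "w \<in> generate (ext2 (ab n)) ?W" for w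
    using that
  proof (induction rule: generate.induct)
    case one
    have "gen_coord n j k \<one>\<^bsub>ext2 (ab n)\<^esub> = 0" for j k
      using hom_one[OF gen_coord_hom E.is_group group_integer_group] by simp
    then show ?case
      using gr2_class_one_iff[OF F.one_closed]
        subgroup.one_closed[OF normal_imp_subgroup[OF lower3_normal]]
      by (intro bexI[of _ "\<one>\<^bsub>free_grp n\<^esub>"]) (auto simp: one_free_grp comm_sub_one[unfolded one_free_grp])
  next
    case (incl u)
    then show ?case by (rule rep_wedge)
  next
    case (inv u)
    from rep_wedge[OF inv] obtain c where c: "c \<in> comm_sub n" "h u = gr2_class n c"
      "\<forall>j k. j \<noteq> k \<longrightarrow> magnus j k c = gen_coord n j k u" by blast
    have u: "u \<in> carrier (ext2 (ab n))" using inv W by blast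
    have "gen_coord n j k (inv\<^bsub>ext2 (ab n)\<^esub> u) = - gen_coord n j k u" for j k
      using group_hom.hom_inv[of "ext2 (ab n)" integer_group "gen_coord n j k" u] u gen_coord_hom
      by (simp add: group_hom_def group_hom_axioms_def)
    then show ?case
      using c u by (intro bexI[of _ "inv\<^bsub>free_grp n\<^esub> c"])
        (auto simp: gr2_class_inv magnus_inv comm_sub_closed expo_comm_sub[of _ n] comm_sub_inv)
  next
    case (eng u v)
    then obtain c d where c: "c \<in> comm_sub n" "h u = gr2_class n c"
      "\<forall>j k. j \<noteq> k \<longrightarrow> magnus j k c = gen_coord n j k u"
      and d: "d \<in> comm_sub n" "h v = gr2_class n d"
      "\<forall>j k. j \<noteq> k \<longrightarrow> magnus j k d = gen_coord n j k v" by blast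
    have uv: "u \<in> carrier (ext2 (ab n))" "v \<in> carrier (ext2 (ab n))"
      using eng.hyps E.generate_in_carrier[OF W] by auto
    have "gen_coord n j k (u \<otimes>\<^bsub>ext2 (ab n)\<^esub> v) = gen_coord n j k u + gen_coord n j k v" for j k
      using hom_mult[OF gen_coord_hom uv] by simp
    then show ?case
      using c d uv by (intro bexI[of _ "c \<otimes>\<^bsub>free_grp n\<^esub> d"])
        (auto simp: gr2_class_mult magnus_mult comm_sub_closed expo_comm_sub[of _ n] comm_sub_mult)
  qed
  \<comment> \<open>A trivial image puts the representing word into \<open>lower3\<close>, so all
    coordinates of \<open>w\<close> vanish and its expansion is trivial.\<close>
  have "w = \<one>\<^bsub>ext2 (ab n)\<^esub>" if w: "w \<in> carrier (ext2 (ab n))" and "h w = \<one>\<^bsub>gr2 n\<^esub>" for w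
  proof -
    obtain c where c: "c \<in> comm_sub n" "h w = gr2_class n c"
      "\<forall>j k. j \<noteq> k \<longrightarrow> magnus j k c = gen_coord n j k w"
      using rep[of w] w generate_wedge[OF comm_group_ab, of n] by auto
    then have "c \<in> lower3 n" using that(2) gr2_class_one_iff[OF comm_sub_closed[OF c(1)]] by simp
    then have "gen_coord n j k w = 0" if "j \<noteq> k" for j k using magnus_lower3 c(3) that by metis
    then show ?thesis
      by (subst ext2_ab_expand[OF w]) (rule E.finprod_one_eqI, auto)
  qed
  then have inj: "inj_on h (carrier (ext2 (ab n)))"
    by (subst h.inj_on_one_iff) auto
  have surj: "\<exists>w\<in>carrier (ext2 (ab n)). h w = gr2_class n c" if "c \<in> comm_sub n" for c
    using that unfolding derived_eq_commutators
  proof (induction rule: generate.induct)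
    case one
    then show ?case
      using gr2_class_one_iff[OF F.one_closed]
        subgroup.one_closed[OF normal_imp_subgroup[OF lower3_normal]]
      by (intro bexI[of _ "\<one>\<^bsub>ext2 (ab n)\<^esub>"]) auto
  next
    case (incl c)
    then obtain x y where "c = commutator (free_grp n) x y" "x \<in> carrier (free_grp n)" "y \<in> carrier (free_grp n)"
      by blast
    then show ?case
      by (intro bexI[of _ "wedge (ab n) (ab_class n x) (ab_class n y)"]) (auto simp: h_wedge \<gamma>_class)
  next
    case (inv c)
    then obtain x y where "c = commutator (free_grp n) x y" "x \<in> carrier (free_grp n)" "y \<in> carrier (free_grp n)"
      by blast
    then show ?case
      by (intro bexI[of _ "inv\<^bsub>ext2 (ab n)\<^esub> wedge (ab n) (ab_class n x) (ab_class n y)"])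
        (auto simp: h_wedge \<gamma>_class gr2_class_inv commutator_comm_sub)
  next
    case (eng c d)
    from eng.IH(1) obtain u where "u \<in> carrier (ext2 (ab n))" "h u = gr2_class n c" by (elim bexE)
    moreover from eng.IH(2) obtain v where "v \<in> carrier (ext2 (ab n))" "h v = gr2_class n d" by (elim bexE)
    moreover have "c \<in> carrier (free_grp n)" "d \<in> carrier (free_grp n)"
      using eng.hyps[folded derived_eq_commutators] by (auto intro: comm_sub_closed)
    ultimately show ?case
      by (intro bexI[of _ "u \<otimes>\<^bsub>ext2 (ab n)\<^esub> v"]) (auto simp: gr2_class_mult)
  qed
  have "h ` carrier (ext2 (ab n)) = carrier (gr2 n)"
    using surj h.hom_closed unfolding carrier_gr2 by (auto simp: image_iff) (metis imageE)
  then have iso: "restrict h (carrier (ext2 (ab n))) \<in> iso (ext2 (ab n)) (gr2 n)"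
    using h inj by (auto simp: iso_def bij_betw_def hom_def inj_on_def)
  show ?thesis
  proof (rule ex1I)
    show "restrict h (carrier (ext2 (ab n))) \<in> iso (ext2 (ab n)) (gr2 n) \<inter> extensional (carrier (ext2 (ab n))) \<and>
     (\<forall>x\<in>carrier (free_grp n). \<forall>y\<in>carrier (free_grp n). restrict h (carrier (ext2 (ab n)))
        (wedge (ab n) (ab_class n x) (ab_class n y)) = gr2_class n (commutator (free_grp n) x y))"
      using iso by (simp add: h_wedge \<gamma>_class)
    fix j assume j: "j \<in> iso (ext2 (ab n)) (gr2 n) \<inter> extensional (carrier (ext2 (ab n))) \<and>
     (\<forall>x\<in>carrier (free_grp n). \<forall>y\<in>carrier (free_grp n).
        j (wedge (ab n) (ab_class n x) (ab_class n y)) = gr2_class n (commutator (free_grp n) x y))"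
    show "j = restrict h (carrier (ext2 (ab n)))"
    proof (rule extensionalityI)
      fix w assume w: "w \<in> carrier (ext2 (ab n))"
      have "j w = h w"
      proof (rule ext2_hom_eq[OF comm_group_ab C.is_group _ h _ w])
        show "j \<in> hom (ext2 (ab n)) (gr2 n)" using j by (simp add: iso_def)
        show "j (wedge (ab n) a b) = h (wedge (ab n) a b)"
          if "a \<in> carrier (ab n)" "b \<in> carrier (ab n)" for a b
          using that j by (auto simp: h_wedge \<gamma>_class carrier_ab)
      qed
      then show "j w = restrict h (carrier (ext2 (ab n))) w" using w by simp
    qed (use j in auto)
  qed
qed

lemma ext2_to_gr2_iso: "ext2_to_gr2 n \<in> iso (ext2 (ab n)) (gr2 n)"
  and ext2_to_gr2_wedge: "x \<in> carrier (free_grp n) \<Longrightarrow> y \<in> carrier (free_grp n) \<Longrightarrow>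
    ext2_to_gr2 n (wedge (ab n) (ab_class n x) (ab_class n y)) = gr2_class n (commutator (free_grp n) x y)"
  using theI'[OF ext2_to_gr2_ex1[of n]] unfolding ext2_to_gr2_def by auto

section \<open>Automorphisms of the free group\<close>

lemma (in group) inv_mult_cancel [simp]:
  "x \<in> carrier G \<Longrightarrow> y \<in> carrier G \<Longrightarrow> inv x \<otimes> (x \<otimes> y) = y"
  "x \<in> carrier G \<Longrightarrow> y \<in> carrier G \<Longrightarrow> x \<otimes> (inv x \<otimes> y) = y"
  by (simp_all flip: m_assoc)

lemma aut_hom: "\<sigma> \<in> carrier (aut_free n) \<Longrightarrow> \<sigma> \<in> hom (free_grp n) (free_grp n)"
  by (simp add: carrier_aut_free auto_def)

lemma aut_closed:
  "\<sigma> \<in> carrier (aut_free n) \<Longrightarrow> x \<in> carrier (free_grp n) \<Longrightarrow> \<sigma> x \<in> carrier (free_grp n)"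
  by (rule hom_in_carrier[OF aut_hom])

lemma aut_mult:
  "\<sigma> \<in> carrier (aut_free n) \<Longrightarrow> x \<in> carrier (free_grp n) \<Longrightarrow> y \<in> carrier (free_grp n) \<Longrightarrow>
    \<sigma> (x \<otimes>\<^bsub>free_grp n\<^esub> y) = \<sigma> x \<otimes>\<^bsub>free_grp n\<^esub> \<sigma> y"
  by (rule hom_mult[OF aut_hom])

lemma aut_inv:
  assumes "\<sigma> \<in> carrier (aut_free n)" "x \<in> carrier (free_grp n)"
  shows "\<sigma> (inv\<^bsub>free_grp n\<^esub> x) = inv\<^bsub>free_grp n\<^esub> \<sigma> x"
  using assms group_hom.hom_inv[of "free_grp n" "free_grp n" \<sigma> x] aut_hom[OF assms(1)]
  by (simp add: group_hom_def group_hom_axioms_def group_free_grp)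

lemma one_aut_free: "\<one>\<^bsub>aut_free n\<^esub> = (\<lambda>x\<in>carrier (free_grp n). x)"
  by (simp add: aut_free_def AutoGroup_def BijGroup_def)

lemma aut_eqI:
  assumes "\<sigma> \<in> carrier (aut_free n)" "\<tau> \<in> carrier (aut_free n)"
    and "\<And>i. i < n \<Longrightarrow> \<sigma> (gen i) = \<tau> (gen i)"
  shows "\<sigma> = \<tau>"
proof (rule extensionalityI)
  show "\<sigma> \<in> extensional (carrier (free_grp n))" "\<tau> \<in> extensional (carrier (free_grp n))"
    using assms(1,2) by (auto simp: carrier_aut_free auto_def Bij_def)
  show "\<sigma> x = \<tau> x" if "x \<in> carrier (free_grp n)" for x
    by (rule free_hom_eq[OF group_free_grp aut_hom[OF assms(1)] aut_hom[OF assms(2)] assms(3) that])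
qed

text \<open>Restricted to the carrier because the elements of \<open>AutoGroup\<close> are
  extensional functions.\<close>

definition subst_aut :: "nat \<Rightarrow> (nat \<Rightarrow> letter list) \<Rightarrow> letter list \<Rightarrow> letter list" where
  "subst_aut n g = restrict (word_hom (free_grp n) g) (carrier (free_grp n))"

lemma subst_aut_gen:
  "i < n \<Longrightarrow> g i \<in> carrier (free_grp n) \<Longrightarrow> subst_aut n g (gen i) = g i"
  by (simp add: subst_aut_def group.word_hom_gen group_free_grp)

lemma subst_aut_hom:
  assumes "\<And>i. i < n \<Longrightarrow> g i \<in> carrier (free_grp n)"
  shows "subst_aut n g \<in> hom (free_grp n) (free_grp n)"
proof -
  interpret F: group "free_grp n" by (rule group_free_grp)
  have "word_hom (free_grp n) g \<in> hom (free_grp n) (free_grp n)"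
    by (rule F.word_hom) (rule assms)
  then show ?thesis unfolding subst_aut_def hom_def by auto
qed

text \<open>Two substitutions that undo each other on the generators are mutually inverse on all
  words, and this yields bijectivity.\<close>

lemma subst_aut_closed:
  assumes g: "\<And>i. i < n \<Longrightarrow> g i \<in> carrier (free_grp n)" and g': "\<And>i. i < n \<Longrightarrow> g' i \<in> carrier (free_grp n)"
    and gg': "\<And>i. i < n \<Longrightarrow> subst_aut n g (g' i) = gen i"
    and g'g: "\<And>i. i < n \<Longrightarrow> subst_aut n g' (g i) = gen i"
  shows "subst_aut n g \<in> carrier (aut_free n)"
proof -
  have inverse: "subst_aut n p (subst_aut n q x) = x"
    if p: "\<And>i. i < n \<Longrightarrow> p i \<in> carrier (free_grp n)" and q: "\<And>i. i < n \<Longrightarrow> q i \<in> carrier (free_grp n)"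
      and pq: "\<And>i. i < n \<Longrightarrow> subst_aut n p (q i) = gen i" and x: "x \<in> carrier (free_grp n)" for p q x
  proof (rule free_hom_eq[OF group_free_grp _ _ _ x])
    show "(\<lambda>x. subst_aut n p (subst_aut n q x)) \<in> hom (free_grp n) (free_grp n)"
      using Group.hom_compose[OF subst_aut_hom[OF q] subst_aut_hom[OF p]] by (simp add: comp_def)
    show "(\<lambda>x. x) \<in> hom (free_grp n) (free_grp n)" by (simp add: hom_def)
    show "subst_aut n p (subst_aut n q (gen i)) = gen i" if "i < n" for i
      using that q pq by (simp add: subst_aut_gen)
  qed
  have "bij_betw (subst_aut n g) (carrier (free_grp n)) (carrier (free_grp n))"
    by (rule bij_betwI[where g = "subst_aut n g'"])
      (use subst_aut_hom[OF g] subst_aut_hom[OF g'] inverse[OF g g' gg'] inverse[OF g' g g'g] in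
        \<open>auto simp: hom_def\<close>)
  then show ?thesis
    using subst_aut_hom[OF g] by (simp add: carrier_aut_free auto_def Bij_def subst_aut_def)
qed

section \<open>Words without x_0, transvections of x_0, and conjugates of its inversion\<close>

definition tail_words :: "nat \<Rightarrow> letter list set" where
  "tail_words n = {u \<in> carrier (free_grp n). 0 \<notin> snd ` set u}"

lemma tail_words_carrier: "u \<in> tail_words n \<Longrightarrow> u \<in> carrier (free_grp n)"
  by (simp add: tail_words_def)

lemma tail_words_mult:
  "u \<in> tail_words n \<Longrightarrow> v \<in> tail_words n \<Longrightarrow> u \<otimes>\<^bsub>free_grp n\<^esub> v \<in> tail_words n"
  using set_foldr_cons_red[of u v] monoid.m_closed[OF group.is_monoid[OF group_free_grp], of u n v]
  by (auto simp: tail_words_def mult_free_grp)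

lemma inv_free_grp:
  assumes "u \<in> carrier (free_grp n)" shows "inv\<^bsub>free_grp n\<^esub> u = rev (map inv_letter u)"
  by (rule group.inv_equality[OF group_free_grp])
    (use assms in \<open>auto simp: mult_free_grp one_free_grp foldr_cons_red_inverse mem_free_grp reduced_inverse\<close>)

lemma tail_words_inv: "u \<in> tail_words n \<Longrightarrow> inv\<^bsub>free_grp n\<^esub> u \<in> tail_words n"
  using group.inv_closed[OF group_free_grp, of u n]
  by (auto simp: tail_words_def inv_free_grp image_iff)

lemma tail_words_gen: "0 < i \<Longrightarrow> i < n \<Longrightarrow> gen i \<in> tail_words n"
  by (simp add: tail_words_def) (simp add: gen_def)

lemma word_hom_tail:
  assumes "u \<in> tail_words n" "\<And>i. 0 < i \<Longrightarrow> i < n \<Longrightarrow> g i = gen i"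
  shows "word_hom (free_grp n) g u = u"
  using assms(1)
proof (induction u)
  case Nil
  show ?case using group.word_hom_simps(1)[OF group_free_grp] by (simp add: one_free_grp)
next
  case (Cons a u)
  then have u: "u \<in> tail_words n" and a: "snd a < n" "0 < snd a" and red: "reduced (a # u)"
    by (auto simp: tail_words_def mem_free_grp dest: reduced_ConsD)
  have "(if fst a then g (snd a) else inv\<^bsub>free_grp n\<^esub> g (snd a)) = [a]"
    using a by (simp add: assms(2) inv_gen) (simp add: gen_def prod_eq_iff)
  then show ?case
    using Cons.IH[OF u] red
    by (simp add: group.word_hom_simps group_free_grp mult_free_grp cons_red_reduced)
qed

definition transv :: "nat \<Rightarrow> letter list \<Rightarrow> letter list \<Rightarrow> letter list" where
  "transv n u = subst_aut n (\<lambda>i. if i = 0 then gen 0 \<otimes>\<^bsub>free_grp n\<^esub> u else gen i)"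

definition flip :: "nat \<Rightarrow> letter list \<Rightarrow> letter list" where
  "flip n = subst_aut n (\<lambda>i. if i = 0 then inv\<^bsub>free_grp n\<^esub> gen 0 else gen i)"

context
  fixes n :: nat
  assumes n: "0 < n"
begin

interpretation F: group "free_grp n" by (rule group_free_grp)
interpretation A: group "aut_free n" by (rule group_aut_free)

lemma transv_gen_0: "u \<in> tail_words n \<Longrightarrow> transv n u (gen 0) = gen 0 \<otimes>\<^bsub>free_grp n\<^esub> u"
  unfolding transv_def using n by (subst subst_aut_gen) (auto simp: tail_words_carrier)

lemma flip_gen_0: "flip n (gen 0) = inv\<^bsub>free_grp n\<^esub> gen 0"
  unfolding flip_def using n by (subst subst_aut_gen) auto

lemma transv_tail: "v \<in> tail_words n \<Longrightarrow> transv n u v = v"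
  unfolding transv_def subst_aut_def by (simp add: tail_words_carrier word_hom_tail)

lemma flip_tail: "v \<in> tail_words n \<Longrightarrow> flip n v = v"
  unfolding flip_def subst_aut_def by (simp add: tail_words_carrier word_hom_tail)

lemma transv_aut: assumes u: "u \<in> tail_words n" shows "transv n u \<in> carrier (aut_free n)"
proof -
  have hom: "transv n v \<in> hom (free_grp n) (free_grp n)" if "v \<in> tail_words n" for v
    unfolding transv_def using that n by (intro subst_aut_hom) (auto simp: tail_words_carrier)
  have inverse: "transv n v (gen 0 \<otimes>\<^bsub>free_grp n\<^esub> w) = gen 0 \<otimes>\<^bsub>free_grp n\<^esub> (v \<otimes>\<^bsub>free_grp n\<^esub> w)"
    if "v \<in> tail_words n" "w \<in> tail_words n" for v w
    using hom_mult[OF hom[OF that(1)], of "gen 0" w] that n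
    by (simp add: transv_gen_0 transv_tail tail_words_carrier F.m_assoc)
  \<comment> \<open>The inverse substitution multiplies x_0 by u^-1; the two undo each other because
    both fix words that avoid x_0.\<close>
  show ?thesis
    unfolding transv_def
    by (rule subst_aut_closed[where g' = "\<lambda>i. if i = 0 then gen 0 \<otimes>\<^bsub>free_grp n\<^esub> inv\<^bsub>free_grp n\<^esub> u else gen i"],
        unfold transv_def[symmetric])
      (use u n in \<open>auto simp: tail_words_carrier inverse tail_words_inv transv_tail tail_words_gen\<close>)
qed

lemma flip_aut: "flip n \<in> carrier (aut_free n)"
proof -
  have hom: "flip n \<in> hom (free_grp n) (free_grp n)"
    unfolding flip_def using n by (intro subst_aut_hom) auto
  interpret h: group_hom "free_grp n" "free_grp n" "flip n"
    using hom by (simp add: group_hom_def group_hom_axioms_def F.is_group)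
  have inverse: "flip n (inv\<^bsub>free_grp n\<^esub> gen 0) = gen 0"
    using n by (simp add: flip_gen_0)
  show ?thesis
    unfolding flip_def
    by (rule subst_aut_closed[where g' = "\<lambda>i. if i = 0 then inv\<^bsub>free_grp n\<^esub> gen 0 else gen i"],
        unfold flip_def[symmetric])
      (use n in \<open>auto simp: inverse flip_tail tail_words_gen\<close>)
qed

lemma aut_eqI_tail:
  assumes "\<sigma> \<in> carrier (aut_free n)" "\<tau> \<in> carrier (aut_free n)" "\<sigma> (gen 0) = \<tau> (gen 0)"
    and "\<And>v. v \<in> tail_words n \<Longrightarrow> \<sigma> v = \<tau> v"
  shows "\<sigma> = \<tau>"
proof (rule aut_eqI[OF assms(1,2)])
  show "\<sigma> (gen i) = \<tau> (gen i)" if "i < n" for i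
    using assms(3,4) tail_words_gen[of i n] that by (cases "i = 0") auto
qed

text \<open>The order is reversed because the product acts from the right: x_0 goes to x_0 u and
  then to x_0 v u.\<close>

lemma transv_mult:
  assumes "u \<in> tail_words n" "v \<in> tail_words n"
  shows "transv n u \<otimes>\<^bsub>aut_free n\<^esub> transv n v = transv n (v \<otimes>\<^bsub>free_grp n\<^esub> u)"
  by (rule aut_eqI_tail)
    (use assms n in \<open>auto simp: transv_aut tail_words_mult mult_aut_free transv_tail tail_words_carrier
       transv_gen_0 aut_mult F.m_assoc\<close>)

lemma inv_transv:
  assumes "u \<in> tail_words n"
  shows "inv\<^bsub>aut_free n\<^esub> transv n u = transv n (inv\<^bsub>free_grp n\<^esub> u)"
proof (rule A.inv_equality)
  have "\<one>\<^bsub>free_grp n\<^esub> \<in> tail_words n" by (simp add: tail_words_def one_free_grp mem_free_grp)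
  then have "transv n \<one>\<^bsub>free_grp n\<^esub> = \<one>\<^bsub>aut_free n\<^esub>"
    by (intro aut_eqI_tail) (auto simp: transv_aut transv_tail transv_gen_0 n tail_words_carrier one_aut_free
        A.one_closed[unfolded one_aut_free])
  then show "transv n (inv\<^bsub>free_grp n\<^esub> u) \<otimes>\<^bsub>aut_free n\<^esub> transv n u = \<one>\<^bsub>aut_free n\<^esub>"
    using assms by (simp add: transv_mult tail_words_inv tail_words_carrier)
qed (use assms in \<open>auto simp: transv_aut tail_words_inv\<close>)

lemma inv_flip: "inv\<^bsub>aut_free n\<^esub> flip n = flip n"
  by (rule A.inv_equality, rule aut_eqI_tail)
    (use n in \<open>auto simp: flip_aut mult_aut_free flip_tail flip_gen_0 one_aut_free aut_inv tail_words_carrier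
        A.one_closed[unfolded one_aut_free]\<close>)

definition reflection :: "letter list \<Rightarrow> letter list \<Rightarrow> letter list" where
  "reflection u = transv n u \<otimes>\<^bsub>aut_free n\<^esub> flip n \<otimes>\<^bsub>aut_free n\<^esub> inv\<^bsub>aut_free n\<^esub> transv n u"

lemma reflection_aut: "u \<in> tail_words n \<Longrightarrow> reflection u \<in> carrier (aut_free n)"
  by (simp add: reflection_def transv_aut flip_aut)

lemma reflection_tail: "u \<in> tail_words n \<Longrightarrow> v \<in> tail_words n \<Longrightarrow> reflection u v = v"
  by (simp add: reflection_def transv_aut flip_aut mult_aut_free tail_words_carrier transv_tail flip_tail
      inv_transv tail_words_inv)

text \<open>Following the three factors from left to right, x_0 becomes x_0 u, then x_0^-1 u, and
  finally (x_0 u^-1)^-1 u.\<close>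

lemma reflection_gen_0:
  assumes "u \<in> tail_words n"
  shows "reflection u (gen 0) = u \<otimes>\<^bsub>free_grp n\<^esub> (inv\<^bsub>free_grp n\<^esub> gen 0 \<otimes>\<^bsub>free_grp n\<^esub> u)"
  using assms n
  by (simp add: reflection_def transv_aut flip_aut mult_aut_free tail_words_carrier transv_tail flip_tail
      inv_transv transv_gen_0 flip_gen_0 aut_mult aut_inv tail_words_inv F.inv_mult_group F.m_assoc aut_closed)

text \<open>Both sides fix the words without x_0 and send x_0 to a b x_0^-1 b a. The reflection for
  the product ab alone would end in a b, and the transvection repairs this last factor.\<close>

lemma reflection_relation:
  assumes a: "a \<in> tail_words n" and b: "b \<in> tail_words n"
  shows "reflection a \<otimes>\<^bsub>aut_free n\<^esub> (flip n \<otimes>\<^bsub>aut_free n\<^esub> reflection b) =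
    transv n (commutator (free_grp n) (inv\<^bsub>free_grp n\<^esub> b) (inv\<^bsub>free_grp n\<^esub> a)) \<otimes>\<^bsub>aut_free n\<^esub>
    reflection (a \<otimes>\<^bsub>free_grp n\<^esub> b)"
proof (rule aut_eqI_tail)
  let ?c = "commutator (free_grp n) (inv\<^bsub>free_grp n\<^esub> b) (inv\<^bsub>free_grp n\<^esub> a)"
  have ab: "a \<otimes>\<^bsub>free_grp n\<^esub> b \<in> tail_words n" using a b by (rule tail_words_mult)
  have c: "?c \<in> tail_words n"
    using a b by (simp add: commutator_def tail_words_mult tail_words_inv)
  note carriers = tail_words_carrier[OF a] tail_words_carrier[OF b] tail_words_carrier[OF ab]
    tail_words_carrier[OF c]
  note auts = reflection_aut[OF a] reflection_aut[OF b] reflection_aut[OF ab] transv_aut[OF c] flip_aut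
  show "reflection a \<otimes>\<^bsub>aut_free n\<^esub> (flip n \<otimes>\<^bsub>aut_free n\<^esub> reflection b) \<in> carrier (aut_free n)"
    "transv n ?c \<otimes>\<^bsub>aut_free n\<^esub> reflection (a \<otimes>\<^bsub>free_grp n\<^esub> b) \<in> carrier (aut_free n)"
    using auts by simp_all
  show "(reflection a \<otimes>\<^bsub>aut_free n\<^esub> (flip n \<otimes>\<^bsub>aut_free n\<^esub> reflection b)) v =
      (transv n ?c \<otimes>\<^bsub>aut_free n\<^esub> reflection (a \<otimes>\<^bsub>free_grp n\<^esub> b)) v" if "v \<in> tail_words n" for v
    using that auts
    by (simp add: mult_aut_free tail_words_carrier reflection_tail a b ab flip_tail transv_tail)
  have "(reflection a \<otimes>\<^bsub>aut_free n\<^esub> (flip n \<otimes>\<^bsub>aut_free n\<^esub> reflection b)) (gen 0) =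
      a \<otimes>\<^bsub>free_grp n\<^esub> (b \<otimes>\<^bsub>free_grp n\<^esub> (inv\<^bsub>free_grp n\<^esub> gen 0 \<otimes>\<^bsub>free_grp n\<^esub> (b \<otimes>\<^bsub>free_grp n\<^esub> a)))"
    using auts carriers n
    by (simp add: mult_aut_free reflection_gen_0 a b flip_tail flip_gen_0 aut_mult aut_inv
        reflection_tail F.inv_mult_group F.m_assoc aut_closed)
  moreover have "(transv n ?c \<otimes>\<^bsub>aut_free n\<^esub> reflection (a \<otimes>\<^bsub>free_grp n\<^esub> b)) (gen 0) =
      a \<otimes>\<^bsub>free_grp n\<^esub> (b \<otimes>\<^bsub>free_grp n\<^esub> (inv\<^bsub>free_grp n\<^esub> gen 0 \<otimes>\<^bsub>free_grp n\<^esub>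
        (a \<otimes>\<^bsub>free_grp n\<^esub> (b \<otimes>\<^bsub>free_grp n\<^esub> ?c))))"
    using auts carriers n
    by (simp add: mult_aut_free reflection_gen_0[OF ab] transv_gen_0[OF c] aut_mult
        reflection_tail[OF ab c] F.m_assoc)
  \<comment> \<open>This identity, a b [b^-1, a^-1] = b a, dictates the order and the inverses in
    the commutator.\<close>
  moreover have "a \<otimes>\<^bsub>free_grp n\<^esub> (b \<otimes>\<^bsub>free_grp n\<^esub> ?c) = b \<otimes>\<^bsub>free_grp n\<^esub> a"
    using carriers by (simp add: commutator_def F.m_assoc)
  ultimately show "(reflection a \<otimes>\<^bsub>aut_free n\<^esub> (flip n \<otimes>\<^bsub>aut_free n\<^esub> reflection b)) (gen 0) =
      (transv n ?c \<otimes>\<^bsub>aut_free n\<^esub> reflection (a \<otimes>\<^bsub>free_grp n\<^esub> b)) (gen 0)" by simp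
qed

lemma ab_class_transv:
  assumes "c \<in> tail_words n" "c \<in> comm_sub n" "x \<in> carrier (free_grp n)"
  shows "ab_class n (transv n c x) = ab_class n x"
proof (rule free_hom_eq[OF group_ab _ ab_class_hom _ assms(3)])
  interpret B: group "ab n" by simp
  show "(\<lambda>x. ab_class n (transv n c x)) \<in> hom (free_grp n) (ab n)"
    using Group.hom_compose[OF aut_hom[OF transv_aut[OF assms(1)]] ab_class_hom] by (simp add: comp_def)
  have "ab_class n c = \<one>\<^bsub>ab n\<^esub>"
    using normal.rcos_eq_iff[OF comm_sub_normal tail_words_carrier[OF assms(1)]] assms(2)
    by (simp add: ab_class_def ab_def)
  then show "ab_class n (transv n c (gen i)) = ab_class n (gen i)" if "i < n" for i
    using that assms(1)
    by (cases "i = 0") (simp_all add: transv_gen_0 transv_tail tail_words_gen ab_class_mult tail_words_carrier)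
qed

text \<open>Membership in the kernel \<open>IA\<close> asks for equality with the unit of
  \<open>AutoGroup (ab n)\<close>, which is the identity restricted to the carrier.\<close>

lemma act_ab_transv:
  assumes "c \<in> tail_words n" "c \<in> comm_sub n"
  shows "act_ab n (transv n c) = (\<lambda>h\<in>carrier (ab n). h)"
proof (rule extensionalityI)
  show "act_ab n (transv n c) h = (\<lambda>h\<in>carrier (ab n). h) h" if "h \<in> carrier (ab n)" for h
    using that assms
    by (auto simp: carrier_ab act_ab_class transv_aut inv_transv ab_class_transv tail_words_inv comm_sub_inv)
qed (auto simp: act_ab_def)

lemma transv_IA:
  assumes "c \<in> tail_words n" "c \<in> comm_sub n" shows "transv n c \<in> IA n"
  using transv_aut[OF assms(1)] act_ab_transv[OF assms]
  by (simp add: IA_def kernel_def AutoGroup_def BijGroup_def)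

end

section \<open>The Johnson homomorphism\<close>

lemma V_to_hom_bilinear:
  "bilinear (ab_dual n) (ext2 (ab n)) (hom_group (ab n) (ext2 (ab n)))
     (\<lambda>f w. \<lambda>h\<in>carrier (ab n). w [^]\<^bsub>ext2 (ab n)\<^esub> f h)"
proof -
  interpret E: comm_group "ext2 (ab n)" by (rule comm_group_ext2[OF comm_group_ab])
  interpret B: group "ab n" by simp
  show ?thesis
    by (rule bilinearI)
      (auto simp: ab_dual_def hom_group_def hom_def E.int_pow_mult E.int_pow_distrib fun_eq_iff)
qed

lemma V_to_hom_hom: "V_to_hom n \<in> hom (V n) (hom_group (ab n) (ext2 (ab n)))"
  and V_to_hom_pure: "f \<in> carrier (ab_dual n) \<Longrightarrow> w \<in> carrier (ext2 (ab n)) \<Longrightarrow>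
    V_to_hom n (pure (ab_dual n) (ext2 (ab n)) f w) = (\<lambda>h\<in>carrier (ab n). w [^]\<^bsub>ext2 (ab n)\<^esub> f h)"
  unfolding V_to_hom_def V_def
  by (rule tensor_lift[OF comm_group_ab_dual comm_group_ext2[OF comm_group_ab]
        comm_group_hom_group[OF group_ab comm_group_ext2[OF comm_group_ab]] V_to_hom_bilinear])+

text \<open>The map from x to the class of x^-1 x^\<sigma> is itself a homomorphism into
  \<open>gr2\<close>, so agreement on generators is enough. Injectivity of
  \<open>ext2_to_gr2\<close> gives the uniqueness behind the \<open>THE\<close> in
  \<open>johnson_hom\<close>.\<close>

lemma johnson_hom_eq:
  assumes \<sigma>: "\<sigma> \<in> carrier (aut_free n)"
    and IA: "\<And>x. x \<in> carrier (free_grp n) \<Longrightarrow> ab_class n (\<sigma> x) = ab_class n x"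
    and \<phi>: "\<phi> \<in> carrier (hom_group (ab n) (ext2 (ab n)))"
    and gens: "\<And>i. i < n \<Longrightarrow> ext2_to_gr2 n (\<phi> (ab_class n (gen i))) =
      gr2_class n (inv\<^bsub>free_grp n\<^esub> gen i \<otimes>\<^bsub>free_grp n\<^esub> \<sigma> (gen i))"
  shows "johnson_hom n \<sigma> = \<phi>"
proof -
  interpret F: group "free_grp n" by (rule group_free_grp)
  interpret E: comm_group "ext2 (ab n)" by (rule comm_group_ext2[OF comm_group_ab])
  interpret C: comm_group "gr2 n" by (rule comm_group_gr2)
  have j: "ext2_to_gr2 n \<in> hom (ext2 (ab n)) (gr2 n)" "inj_on (ext2_to_gr2 n) (carrier (ext2 (ab n)))"
    using ext2_to_gr2_iso[of n] by (auto simp: iso_def bij_betw_def)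
  have hom: "\<psi> \<in> hom (ab n) (ext2 (ab n))" if "\<psi> \<in> carrier (hom_group (ab n) (ext2 (ab n)))" for \<psi>
    using that by (simp add: hom_group_def)
  have D: "inv\<^bsub>free_grp n\<^esub> x \<otimes>\<^bsub>free_grp n\<^esub> \<sigma> x \<in> comm_sub n" if "x \<in> carrier (free_grp n)" for x
    using IA[OF that] ab_class_eq_iff[OF that aut_closed[OF \<sigma> that]] by simp
  have D_hom: "(\<lambda>x. gr2_class n (inv\<^bsub>free_grp n\<^esub> x \<otimes>\<^bsub>free_grp n\<^esub> \<sigma> x)) \<in> hom (free_grp n) (gr2 n)"
  proof (rule homI)
    fix x y assume x: "x \<in> carrier (free_grp n)" and y: "y \<in> carrier (free_grp n)"
    let ?d = "\<lambda>x. inv\<^bsub>free_grp n\<^esub> x \<otimes>\<^bsub>free_grp n\<^esub> \<sigma> x"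
    note cl = x y aut_closed[OF \<sigma> x] aut_closed[OF \<sigma> y] D[OF x, THEN comm_sub_closed] D[OF y, THEN comm_sub_closed]
    \<comment> \<open>The factor \<open>?d x\<close> lies in [F, F], hence moves past
      \<open>\<sigma> y\<close> modulo \<open>lower3\<close>; then y^-1 and
      \<open>\<sigma> y\<close> combine to \<open>?d y\<close>.\<close>
    have "?d (x \<otimes>\<^bsub>free_grp n\<^esub> y) = inv\<^bsub>free_grp n\<^esub> y \<otimes>\<^bsub>free_grp n\<^esub> (?d x \<otimes>\<^bsub>free_grp n\<^esub> \<sigma> y)"
      using cl by (simp add: aut_mult[OF \<sigma>] F.inv_mult_group F.m_assoc)
    then have "gr2_class n (?d (x \<otimes>\<^bsub>free_grp n\<^esub> y)) =
        gr2_class n (inv\<^bsub>free_grp n\<^esub> y) \<otimes>\<^bsub>gr2 n\<^esub> gr2_class n (?d x \<otimes>\<^bsub>free_grp n\<^esub> \<sigma> y)"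
      using cl by (simp add: gr2_class_mult del: F.inv_mult_cancel)
    also have "gr2_class n (?d x \<otimes>\<^bsub>free_grp n\<^esub> \<sigma> y) = gr2_class n (\<sigma> y \<otimes>\<^bsub>free_grp n\<^esub> ?d x)"
      using gr2_class_central[OF cl(4) D[OF x]] cl by (simp add: gr2_class_mult)
    also have "gr2_class n (inv\<^bsub>free_grp n\<^esub> y) \<otimes>\<^bsub>gr2 n\<^esub> gr2_class n (\<sigma> y \<otimes>\<^bsub>free_grp n\<^esub> ?d x) =
        gr2_class n (?d y \<otimes>\<^bsub>free_grp n\<^esub> ?d x)"
      using cl by (simp add: F.m_assoc flip: gr2_class_mult)
    also have "\<dots> = gr2_class n (?d y) \<otimes>\<^bsub>gr2 n\<^esub> gr2_class n (?d x)"
      by (rule gr2_class_mult[OF cl(6,5)])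
    also have "\<dots> = gr2_class n (?d x) \<otimes>\<^bsub>gr2 n\<^esub> gr2_class n (?d y)"
      by (rule C.m_comm) (use D x y in simp_all)
    finally show "gr2_class n (?d (x \<otimes>\<^bsub>free_grp n\<^esub> y)) = gr2_class n (?d x) \<otimes>\<^bsub>gr2 n\<^esub> gr2_class n (?d y)" .
  qed (use D in auto)
  have \<phi>_class: "ext2_to_gr2 n (\<phi> (ab_class n x)) = gr2_class n (inv\<^bsub>free_grp n\<^esub> x \<otimes>\<^bsub>free_grp n\<^esub> \<sigma> x)"
    if "x \<in> carrier (free_grp n)" for x
  proof (rule free_hom_eq[OF C.is_group _ D_hom gens that])
    show "(\<lambda>x. ext2_to_gr2 n (\<phi> (ab_class n x))) \<in> hom (free_grp n) (gr2 n)"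
      using Group.hom_compose[OF Group.hom_compose[OF ab_class_hom hom[OF \<phi>]] j(1)] by (simp add: comp_def)
  qed
  show ?thesis
    unfolding johnson_hom_def
  proof (rule the_equality)
    fix \<psi> assume \<psi>: "\<psi> \<in> carrier (hom_group (ab n) (ext2 (ab n))) \<and> (\<forall>x\<in>carrier (free_grp n).
        ext2_to_gr2 n (\<psi> (ab_class n x)) = gr2_class n (inv\<^bsub>free_grp n\<^esub> x \<otimes>\<^bsub>free_grp n\<^esub> \<sigma> x))"
    show "\<psi> = \<phi>"
    proof (rule extensionalityI)
      show "\<psi> \<in> extensional (carrier (ab n))" "\<phi> \<in> extensional (carrier (ab n))"
        using \<phi> \<psi> by (auto simp: hom_group_def)
      fix h assume h: "h \<in> carrier (ab n)"
      then have "ext2_to_gr2 n (\<psi> h) = ext2_to_gr2 n (\<phi> h)" using \<psi> \<phi>_class by (auto simp: carrier_ab)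
      then show "\<psi> h = \<phi> h"
        using j(2) hom_in_carrier[OF hom h] \<phi> \<psi> by (auto simp: inj_on_def)
    qed
  qed (use \<phi> \<phi>_class in blast)
qed

text \<open>The transvection changes x_0 alone, by the commutator, so the tensor of e_0^* and [a]
  wedge [b] has the right image. As \<open>johnson\<close> is an \<open>inv_into\<close> value, it
  is described by its image under \<open>V_to_hom\<close>, which is what \<open>V_coord\<close>
  reads.\<close>

lemma V_to_hom_johnson_transv:
  assumes n: "0 < n" and a: "a \<in> tail_words n" and b: "b \<in> tail_words n"
  defines "w \<equiv> wedge (ab n) (ab_class n a) (ab_class n b)"
  shows "johnson n (transv n (commutator (free_grp n) a b)) \<in> carrier (V n)"
    and "V_to_hom n (johnson n (transv n (commutator (free_grp n) a b))) =
      (\<lambda>h\<in>carrier (ab n). w [^]\<^bsub>ext2 (ab n)\<^esub> dual_gen n 0 h)"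
proof -
  interpret F: group "free_grp n" by (rule group_free_grp)
  interpret E: comm_group "ext2 (ab n)" by (rule comm_group_ext2[OF comm_group_ab])
  let ?c = "commutator (free_grp n) a b"
  let ?v = "pure (ab_dual n) (ext2 (ab n)) (dual_gen n 0) w"
  have w: "w \<in> carrier (ext2 (ab n))" using a b by (simp add: w_def tail_words_carrier)
  have jw: "ext2_to_gr2 n w = gr2_class n ?c"
    using a b by (simp add: w_def ext2_to_gr2_wedge tail_words_carrier)
  have c: "?c \<in> tail_words n" using a b by (simp add: commutator_def tail_words_mult tail_words_inv)
  have c': "?c \<in> comm_sub n" using a b by (simp add: commutator_comm_sub tail_words_carrier)
  have v: "?v \<in> carrier (V n)" using w by (simp add: V_def dual_gen)
  have \<phi>: "V_to_hom n ?v = (\<lambda>h\<in>carrier (ab n). w [^]\<^bsub>ext2 (ab n)\<^esub> dual_gen n 0 h)"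
    using w by (rule V_to_hom_pure[OF dual_gen])
  have jone: "ext2_to_gr2 n \<one>\<^bsub>ext2 (ab n)\<^esub> = \<one>\<^bsub>gr2 n\<^esub>"
    using ext2_to_gr2_iso[of n] comm_group_gr2[of n] E.is_group
    by (intro hom_one) (auto simp: iso_def comm_group_def)
  have "johnson_hom n (transv n ?c) = V_to_hom n ?v"
  proof (rule johnson_hom_eq[OF transv_aut[OF n c] ab_class_transv[OF n c c']])
    show "V_to_hom n ?v \<in> carrier (hom_group (ab n) (ext2 (ab n)))"
      using hom_in_carrier[OF V_to_hom_hom v] .
    fix i assume i: "i < n"
    show "ext2_to_gr2 n (V_to_hom n ?v (ab_class n (gen i))) =
      gr2_class n (inv\<^bsub>free_grp n\<^esub> gen i \<otimes>\<^bsub>free_grp n\<^esub> transv n ?c (gen i))"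
    proof (cases "i = 0")
      case True
      then show ?thesis
        using i w a b c by (simp add: \<phi> dual_gen_ab_class transv_gen_0 tail_words_carrier jw)
    next
      case False
      then show ?thesis
        using i w gr2_class_one_iff[OF F.one_closed]
          subgroup.one_closed[OF normal_imp_subgroup[OF lower3_normal]]
        by (simp add: \<phi> dual_gen_ab_class transv_tail n tail_words_gen jone)
    qed
  qed
  then have J: "johnson_hom n (transv n ?c) \<in> V_to_hom n ` carrier (V n)" using v by blast
  show "johnson n (transv n ?c) \<in> carrier (V n)"
    unfolding johnson_def by (rule inv_into_into[OF J])
  show "V_to_hom n (johnson n (transv n ?c)) = (\<lambda>h\<in>carrier (ab n). w [^]\<^bsub>ext2 (ab n)\<^esub> dual_gen n 0 h)"
    unfolding johnson_def using f_inv_into_f[OF J] \<open>johnson_hom n (transv n ?c) = V_to_hom n ?v\<close> \<phi> by simp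
qed

section \<open>Coordinates of the twisted module\<close>

text \<open>Integer-valued coordinates on \<open>V\<close>, indexed by \<open>h \<in> H\<close> and \<open>\<psi>, \<chi> \<in> H\<^sup>*\<close>: the value at
  \<open>f \<otimes> w\<close> is \<open>f(h) (\<psi> \<and> \<chi>)(w)\<close>.\<close>

definition V_coord where
  "V_coord n h \<psi> \<chi> v = wedge_dual (ab n) \<psi> \<chi> (V_to_hom n v h)"

lemma comm_group_V: "comm_group (V n)"
  unfolding V_def by (intro comm_group_tensor comm_group_ab_dual comm_group_ext2 comm_group_ab)

lemma V_to_hom_mem:
  "v \<in> carrier (V n) \<Longrightarrow> V_to_hom n v \<in> hom (ab n) (ext2 (ab n))"
  using hom_in_carrier[OF V_to_hom_hom, of v n] by (simp add: hom_group_def)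

lemma V_to_hom_closed:
  "v \<in> carrier (V n) \<Longrightarrow> h \<in> carrier (ab n) \<Longrightarrow> V_to_hom n v h \<in> carrier (ext2 (ab n))"
  by (rule hom_in_carrier[OF V_to_hom_mem])

lemma V_to_hom_mult:
  "u \<in> carrier (V n) \<Longrightarrow> v \<in> carrier (V n) \<Longrightarrow> h \<in> carrier (ab n) \<Longrightarrow>
    V_to_hom n (u \<otimes>\<^bsub>V n\<^esub> v) h = V_to_hom n u h \<otimes>\<^bsub>ext2 (ab n)\<^esub> V_to_hom n v h"
  using hom_mult[OF V_to_hom_hom, of u n v] by (simp add: hom_group_def)

context
  fixes n :: nat and h \<psi> \<chi>
  assumes h: "h \<in> carrier (ab n)" and \<psi>: "\<psi> \<in> hom (ab n) integer_group"
    and \<chi>: "\<chi> \<in> hom (ab n) integer_group"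
begin

lemma wedge_dual_mult:
  "u \<in> carrier (ext2 (ab n)) \<Longrightarrow> w \<in> carrier (ext2 (ab n)) \<Longrightarrow>
    wedge_dual (ab n) \<psi> \<chi> (u \<otimes>\<^bsub>ext2 (ab n)\<^esub> w) = wedge_dual (ab n) \<psi> \<chi> u + wedge_dual (ab n) \<psi> \<chi> w"
  using hom_mult[OF wedge_dual[OF comm_group_ab \<psi> \<chi>]] by simp

lemma wedge_dual_pow:
  assumes "w \<in> carrier (ext2 (ab n))"
  shows "wedge_dual (ab n) \<psi> \<chi> (w [^]\<^bsub>ext2 (ab n)\<^esub> (m :: int)) = m * wedge_dual (ab n) \<psi> \<chi> w"
  using group_hom.hom_int_pow[of "ext2 (ab n)" integer_group "wedge_dual (ab n) \<psi> \<chi>" w m]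
    wedge_dual[OF comm_group_ab \<psi> \<chi>] comm_group_ext2[OF comm_group_ab, of n] assms
  by (simp add: group_hom_def group_hom_axioms_def comm_group_def)

lemma V_coord_hom: "V_coord n h \<psi> \<chi> \<in> hom (V n) integer_group"
  using h by (intro homI) (simp_all add: V_coord_def V_to_hom_mult wedge_dual_mult V_to_hom_closed)

lemma V_coord_pure:
  "f \<in> carrier (ab_dual n) \<Longrightarrow> w \<in> carrier (ext2 (ab n)) \<Longrightarrow>
    V_coord n h \<psi> \<chi> (pure (ab_dual n) (ext2 (ab n)) f w) = f h * wedge_dual (ab n) \<psi> \<chi> w"
  using h by (simp add: V_coord_def V_to_hom_pure wedge_dual_pow)

end

section \<open>The action of automorphisms expressed in coordinates\<close>

lemma act_ab_hom:
  assumes \<sigma>: "\<sigma> \<in> carrier (aut_free n)" shows "act_ab n \<sigma> \<in> hom (ab n) (ab n)"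
proof -
  interpret F: group "free_grp n" by (rule group_free_grp)
  interpret A: group "aut_free n" by (rule group_aut_free)
  have inv: "inv\<^bsub>aut_free n\<^esub> \<sigma> \<in> carrier (aut_free n)" using \<sigma> by simp
  show ?thesis
  proof (rule homI)
    show "act_ab n \<sigma> h \<in> carrier (ab n)" if "h \<in> carrier (ab n)" for h
      using that by (auto simp: carrier_ab act_ab_class[OF \<sigma>] aut_closed[OF inv])
    show "act_ab n \<sigma> (h \<otimes>\<^bsub>ab n\<^esub> k) = act_ab n \<sigma> h \<otimes>\<^bsub>ab n\<^esub> act_ab n \<sigma> k"
      if "h \<in> carrier (ab n)" "k \<in> carrier (ab n)" for h k
      using that
      by (auto simp: carrier_ab act_ab_class[OF \<sigma>] aut_closed[OF inv] aut_mult[OF inv] simp flip: ab_class_mult)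
  qed
qed

text \<open>Two reversals cancel: inversion reverses the factors, and the product of
  \<open>aut_free\<close> reverses composition. The result is a left action.\<close>

lemma act_ab_mult:
  assumes \<sigma>: "\<sigma> \<in> carrier (aut_free n)" and \<tau>: "\<tau> \<in> carrier (aut_free n)" and h: "h \<in> carrier (ab n)"
  shows "act_ab n (\<sigma> \<otimes>\<^bsub>aut_free n\<^esub> \<tau>) h = act_ab n \<sigma> (act_ab n \<tau> h)"
proof -
  interpret A: group "aut_free n" by (rule group_aut_free)
  obtain x where x: "x \<in> carrier (free_grp n)" "h = ab_class n x" using h by (auto simp: carrier_ab)
  then show ?thesis
    using \<sigma> \<tau> by (simp add: act_ab_class aut_closed A.inv_mult_group mult_aut_free)
qed

lemma act_ab_one:
  assumes "h \<in> carrier (ab n)" shows "act_ab n \<one>\<^bsub>aut_free n\<^esub> h = h"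
proof -
  interpret A: group "aut_free n" by (rule group_aut_free)
  obtain x where x: "x \<in> carrier (free_grp n)" "h = ab_class n x" using assms by (auto simp: carrier_ab)
  then have "\<one>\<^bsub>aut_free n\<^esub> x = x" by (simp add: one_aut_free)
  then show ?thesis using x by (simp add: act_ab_class)
qed

lemma act_dual_hom:
  assumes "\<sigma> \<in> carrier (aut_free n)"
  shows "act_dual n \<sigma> \<in> hom (ab_dual n) (ab_dual n)"
proof -
  interpret A: group "aut_free n" by (rule group_aut_free)
  interpret B: group "ab n" by simp
  note hom = act_ab_hom[OF A.inv_closed[OF assms]]
  have cl: "act_ab n (inv\<^bsub>aut_free n\<^esub> \<sigma>) h \<in> carrier (ab n)" if "h \<in> carrier (ab n)" for h
    using hom_in_carrier[OF hom that] .
  show ?thesis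
    by (rule homI)
      (auto simp: act_dual_def ab_dual_def hom_group_def fun_eq_iff cl hom_mult[OF hom] hom_def[of "ab n" integer_group])
qed

lemma
  assumes "\<sigma> \<in> carrier (aut_free n)"
  shows act_V_hom: "act_V n \<sigma> \<in> hom (V n) (V n)"
    and act_V_pure: "f \<in> carrier (ab_dual n) \<Longrightarrow> w \<in> carrier (ext2 (ab n)) \<Longrightarrow>
      act_V n \<sigma> (pure (ab_dual n) (ext2 (ab n)) f w) =
      pure (ab_dual n) (ext2 (ab n)) (act_dual n \<sigma> f) (ext2_map (ab n) (act_ab n \<sigma>) w)"
  unfolding act_V_def V_def
  by (rule tensor_map[OF comm_group_ab_dual comm_group_ext2[OF comm_group_ab] act_dual_hom[OF assms]
        ext2_map(1)[OF comm_group_ab act_ab_hom[OF assms]]])+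

lemma hom_act_ab:
  assumes "\<sigma> \<in> carrier (aut_free n)" "\<psi> \<in> hom (ab n) integer_group"
  shows "(\<lambda>h. \<psi> (act_ab n \<sigma> h)) \<in> hom (ab n) integer_group"
  using Group.hom_compose[OF act_ab_hom[OF assms(1)] assms(2)] by (simp add: comp_def)

text \<open>By duality the action moves from the vector to the three indices: the dual action
  evaluates functionals at the inverse translate of \<open>h\<close>, and \<open>\<psi>\<close> and
  \<open>\<chi>\<close> are pulled back along \<open>\<sigma>\<close>. Both sides are homomorphisms,
  so pure tensors suffice.\<close>

lemma V_coord_act:
  assumes \<sigma>: "\<sigma> \<in> carrier (aut_free n)" and h: "h \<in> carrier (ab n)"
    and \<psi>: "\<psi> \<in> hom (ab n) integer_group" and \<chi>: "\<chi> \<in> hom (ab n) integer_group"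
    and v: "v \<in> carrier (V n)"
  shows "V_coord n h \<psi> \<chi> (act_V n \<sigma> v) =
    V_coord n (act_ab n (inv\<^bsub>aut_free n\<^esub> \<sigma>) h) (\<lambda>x. \<psi> (act_ab n \<sigma> x)) (\<lambda>x. \<chi> (act_ab n \<sigma> x)) v"
proof -
  interpret A: group "aut_free n" by (rule group_aut_free)
  have inv: "inv\<^bsub>aut_free n\<^esub> \<sigma> \<in> carrier (aut_free n)" using \<sigma> by simp
  have h': "act_ab n (inv\<^bsub>aut_free n\<^esub> \<sigma>) h \<in> carrier (ab n)"
    by (rule hom_in_carrier[OF act_ab_hom[OF inv] h])
  note \<psi>' = hom_act_ab[OF \<sigma> \<psi>] and \<chi>' = hom_act_ab[OF \<sigma> \<chi>]
  note map = ext2_map[OF comm_group_ab act_ab_hom[OF \<sigma>]]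
  have w: "wedge_dual (ab n) \<psi> \<chi> (ext2_map (ab n) (act_ab n \<sigma>) w) =
      wedge_dual (ab n) (\<lambda>x. \<psi> (act_ab n \<sigma> x)) (\<lambda>x. \<chi> (act_ab n \<sigma> x)) w"
    if "w \<in> carrier (ext2 (ab n))" for w
  proof (rule ext2_hom_eq[OF comm_group_ab group_integer_group _ wedge_dual[OF comm_group_ab \<psi>' \<chi>'] _ that])
    show "(\<lambda>w. wedge_dual (ab n) \<psi> \<chi> (ext2_map (ab n) (act_ab n \<sigma>) w)) \<in> hom (ext2 (ab n)) integer_group"
      using Group.hom_compose[OF map(1) wedge_dual[OF comm_group_ab \<psi> \<chi>]] by (simp add: comp_def)
    show "wedge_dual (ab n) \<psi> \<chi> (ext2_map (ab n) (act_ab n \<sigma>) (wedge (ab n) a b)) =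
      wedge_dual (ab n) (\<lambda>x. \<psi> (act_ab n \<sigma> x)) (\<lambda>x. \<chi> (act_ab n \<sigma> x)) (wedge (ab n) a b)"
      if "a \<in> carrier (ab n)" "b \<in> carrier (ab n)" for a b
      using that hom_in_carrier[OF act_ab_hom[OF \<sigma>]]
      by (simp add: map(2) wedge_dual_wedge[OF comm_group_ab] \<psi> \<chi> \<psi>' \<chi>')
  qed
  show ?thesis
  proof (rule tensor_hom_eq[OF comm_group_ab_dual comm_group_ext2[OF comm_group_ab] group_integer_group
        _ _ _ v[unfolded V_def]], fold V_def)
    show "(\<lambda>v. V_coord n h \<psi> \<chi> (act_V n \<sigma> v)) \<in> hom (V n) integer_group"
      using Group.hom_compose[OF act_V_hom[OF \<sigma>] V_coord_hom[OF h \<psi> \<chi>]] by (simp add: comp_def)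
    show "V_coord n (act_ab n (inv\<^bsub>aut_free n\<^esub> \<sigma>) h) (\<lambda>x. \<psi> (act_ab n \<sigma> x)) (\<lambda>x. \<chi> (act_ab n \<sigma> x))
        \<in> hom (V n) integer_group"
      by (rule V_coord_hom[OF h' \<psi>' \<chi>'])
    fix f w assume f: "f \<in> carrier (ab_dual n)" and w': "w \<in> carrier (ext2 (ab n))"
    have "act_dual n \<sigma> f h = f (act_ab n (inv\<^bsub>aut_free n\<^esub> \<sigma>) h)" using h by (simp add: act_dual_def)
    then show "V_coord n h \<psi> \<chi> (act_V n \<sigma> (pure (ab_dual n) (ext2 (ab n)) f w)) =
        V_coord n (act_ab n (inv\<^bsub>aut_free n\<^esub> \<sigma>) h) (\<lambda>x. \<psi> (act_ab n \<sigma> x)) (\<lambda>x. \<chi> (act_ab n \<sigma> x))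
          (pure (ab_dual n) (ext2 (ab n)) f w)"
      using f w' hom_in_carrier[OF act_dual_hom[OF \<sigma>] f] hom_in_carrier[OF map(1) w']
      by (simp add: act_V_pure[OF \<sigma>] V_coord_pure h \<psi> \<chi> h' \<psi>' \<chi>' w)
  qed
qed

text \<open>Bilinear expansion of (\<open>\<psi>\<close> - p \<open>\<theta>\<close>) wedge
  (\<open>\<chi>\<close> - q \<open>\<theta>\<close>), where the square of \<open>\<theta>\<close>
  vanishes and \<open>\<theta>\<close> wedge \<open>\<chi>\<close> is turned round.\<close>

lemma wedge_dual_expand:
  assumes A: "comm_group A" and hom: "\<psi> \<in> hom A integer_group" "\<chi> \<in> hom A integer_group" "\<theta> \<in> hom A integer_group"
    and \<psi>': "\<psi>' \<in> hom A integer_group" "\<And>a. a \<in> carrier A \<Longrightarrow> \<psi>' a = \<psi> a - p * \<theta> a"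
    and \<chi>': "\<chi>' \<in> hom A integer_group" "\<And>a. a \<in> carrier A \<Longrightarrow> \<chi>' a = \<chi> a - q * \<theta> a"
    and w: "w \<in> carrier (ext2 A)"
  shows "wedge_dual A \<psi>' \<chi>' w =
    wedge_dual A \<psi> \<chi> w - q * wedge_dual A \<psi> \<theta> w + p * wedge_dual A \<chi> \<theta> w"
proof (rule ext2_hom_eq[OF A group_integer_group wedge_dual[OF A \<psi>'(1) \<chi>'(1)] _ _ w])
  show "(\<lambda>w. wedge_dual A \<psi> \<chi> w - q * wedge_dual A \<psi> \<theta> w + p * wedge_dual A \<chi> \<theta> w)
      \<in> hom (ext2 A) integer_group"
    using hom_mult[OF wedge_dual[OF A hom(1,2)]] hom_mult[OF wedge_dual[OF A hom(1,3)]]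
      hom_mult[OF wedge_dual[OF A hom(2,3)]]
    by (intro homI) (simp_all add: algebra_simps)
  show "wedge_dual A \<psi>' \<chi>' (wedge A a b) = wedge_dual A \<psi> \<chi> (wedge A a b)
      - q * wedge_dual A \<psi> \<theta> (wedge A a b) + p * wedge_dual A \<chi> \<theta> (wedge A a b)"
    if "a \<in> carrier A" "b \<in> carrier A" for a b
    using that by (simp add: wedge_dual_wedge[OF A] hom \<psi>' \<chi>' algebra_simps)
qed

text \<open>The difference reduced modulo 2 is a homomorphism to Z/2, so it suffices to compare the
  determinants on wedges.\<close>

lemma wedge_dual_mod2:
  assumes A: "comm_group A" and hom: "\<psi> \<in> hom A integer_group" "\<chi> \<in> hom A integer_group"
    "\<psi>' \<in> hom A integer_group" "\<chi>' \<in> hom A integer_group"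
    and even: "\<And>a. a \<in> carrier A \<Longrightarrow> even (\<psi>' a - \<psi> a)" "\<And>a. a \<in> carrier A \<Longrightarrow> even (\<chi>' a - \<chi> a)"
    and w: "w \<in> carrier (ext2 A)"
  shows "even (wedge_dual A \<psi>' \<chi>' w - wedge_dual A \<psi> \<chi> w)"
proof -
  have "(\<lambda>w. (wedge_dual A \<psi>' \<chi>' w - wedge_dual A \<psi> \<chi> w) mod 2) w = (\<lambda>w. 0) w"
  proof (rule ext2_hom_eq[OF A group_integer_mod_group[of 2] _ _ _ w])
    show "(\<lambda>w. (wedge_dual A \<psi>' \<chi>' w - wedge_dual A \<psi> \<chi> w) mod 2) \<in> hom (ext2 A) (integer_mod_group 2)"
      using hom_mult[OF wedge_dual[OF A hom(1,2)]] hom_mult[OF wedge_dual[OF A hom(3,4)]]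
      by (intro homI) (simp_all add: carrier_integer_mod_group add_diff_add mod_add_eq)
    show "(\<lambda>w. 0) \<in> hom (ext2 A) (integer_mod_group 2)"
      by (intro homI) (simp_all add: carrier_integer_mod_group)
    fix a b assume a: "a \<in> carrier A" and b: "b \<in> carrier A"
    have "even ((\<psi>' a * \<chi>' b - \<chi>' a * \<psi>' b) - (\<psi> a * \<chi> b - \<chi> a * \<psi> b))"
      using even(1)[OF a] even(1)[OF b] even(2)[OF a] even(2)[OF b] by auto
    then show "(wedge_dual A \<psi>' \<chi>' (wedge A a b) - wedge_dual A \<psi> \<chi> (wedge A a b)) mod 2 = 0"
      using a b by (simp add: wedge_dual_wedge[OF A] hom flip: even_iff_mod_2_eq_zero)
  qed
  then show ?thesis by (simp add: even_iff_mod_2_eq_zero)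
qed

text \<open>Additively, h goes to h - 2 m e_0, where m is the x_0 coordinate of h; so t = - m
  e_0.\<close>

lemma act_ab_flip:
  assumes n: "0 < n" and h: "h \<in> carrier (ab n)"
  obtains t where "t \<in> carrier (ab n)" and "act_ab n (flip n) h = h \<otimes>\<^bsub>ab n\<^esub> (t \<otimes>\<^bsub>ab n\<^esub> t)"
proof -
  interpret F: group "free_grp n" by (rule group_free_grp)
  interpret B: comm_group "ab n" by (rule comm_group_ab)
  note flip = flip_aut[OF n]
  let ?e = "ab_class n (gen 0)"
  let ?t = "\<lambda>h. ?e [^]\<^bsub>ab n\<^esub> (- dual_gen n 0 h)"
  have e: "?e \<in> carrier (ab n)" using n by simp
  have dual: "dual_gen n 0 (x \<otimes>\<^bsub>ab n\<^esub> y) = dual_gen n 0 x + dual_gen n 0 y"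
    if "x \<in> carrier (ab n)" "y \<in> carrier (ab n)" for x y
    using hom_mult[OF dual_gen_hom that] by simp
  have pow: "?e [^]\<^bsub>ab n\<^esub> (- x - y) = ?e [^]\<^bsub>ab n\<^esub> (- x) \<otimes>\<^bsub>ab n\<^esub> ?e [^]\<^bsub>ab n\<^esub> (- y)" for x y :: int
    using B.int_pow_mult[OF e, of "- x" "- y"] by simp
  have inv_e: "ab_class n (inv\<^bsub>free_grp n\<^esub> gen 0) = inv\<^bsub>ab n\<^esub> ?e"
    using group_hom.hom_inv[of "free_grp n" "ab n" "ab_class n" "gen 0"] n ab_class_hom
    by (simp add: group_hom_def group_hom_axioms_def group_free_grp)
  have "act_ab n (flip n) h = h \<otimes>\<^bsub>ab n\<^esub> (?t h \<otimes>\<^bsub>ab n\<^esub> ?t h)"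
  proof (rule ab_hom_eq[OF group_ab act_ab_hom[OF flip] _ _ h])
    show "(\<lambda>h. h \<otimes>\<^bsub>ab n\<^esub> (?t h \<otimes>\<^bsub>ab n\<^esub> ?t h)) \<in> hom (ab n) (ab n)"
      by (rule homI) (use e in \<open>simp_all add: dual pow B.m_ac\<close>)
    show "act_ab n (flip n) (ab_class n (gen i)) =
      ab_class n (gen i) \<otimes>\<^bsub>ab n\<^esub> (?t (ab_class n (gen i)) \<otimes>\<^bsub>ab n\<^esub> ?t (ab_class n (gen i)))"
      if "i < n" for i
      using that e n
      by (cases "i = 0") (simp_all add: act_ab_class flip inv_flip flip_gen_0 flip_tail tail_words_gen
          inv_e dual_gen_ab_class B.int_pow_neg)
  qed
  then show thesis using that[of "?t h"] e by simp
qed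

text \<open>By \<open>V_coord_act\<close> only the indices change, each by twice something: first
  the vector \<open>h\<close> is corrected, then the two functionals.\<close>

lemma V_coord_flip:
  assumes n: "0 < n" and h: "h \<in> carrier (ab n)"
    and \<psi>: "\<psi> \<in> hom (ab n) integer_group" and \<chi>: "\<chi> \<in> hom (ab n) integer_group"
    and v: "v \<in> carrier (V n)"
  shows "even (V_coord n h \<psi> \<chi> (act_V n (flip n) v) - V_coord n h \<psi> \<chi> v)"
proof -
  interpret B: comm_group "ab n" by (rule comm_group_ab)
  interpret E: comm_group "ext2 (ab n)" by (rule comm_group_ext2[OF comm_group_ab])
  note flip = flip_aut[OF n]
  have even: "even (\<phi> (act_ab n (flip n) a) - \<phi> a)"
    if "\<phi> \<in> hom (ab n) integer_group" "a \<in> carrier (ab n)" for \<phi> :: "letter list set \<Rightarrow> int" and a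
  proof -
    obtain t where "t \<in> carrier (ab n)" "act_ab n (flip n) a = a \<otimes>\<^bsub>ab n\<^esub> (t \<otimes>\<^bsub>ab n\<^esub> t)"
      using act_ab_flip[OF n \<open>a \<in> carrier (ab n)\<close>] .
    then show ?thesis using that by (simp add: hom_mult[OF that(1)])
  qed
  obtain t where t: "t \<in> carrier (ab n)" "act_ab n (flip n) h = h \<otimes>\<^bsub>ab n\<^esub> (t \<otimes>\<^bsub>ab n\<^esub> t)"
    using act_ab_flip[OF n h] .
  note \<psi>' = hom_act_ab[OF flip \<psi>] and \<chi>' = hom_act_ab[OF flip \<chi>]
  let ?w = "V_to_hom n v (act_ab n (flip n) h)"
  have w: "?w = V_to_hom n v h \<otimes>\<^bsub>ext2 (ab n)\<^esub> (V_to_hom n v t \<otimes>\<^bsub>ext2 (ab n)\<^esub> V_to_hom n v t)"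
    using h t by (simp add: hom_mult[OF V_to_hom_mem[OF v]])
  have "even (wedge_dual (ab n) \<psi> \<chi> ?w - V_coord n h \<psi> \<chi> v)"
    using h t(1) v by (simp add: w wedge_dual_mult[OF h \<psi> \<chi>] V_coord_def V_to_hom_closed)
  moreover have "even (wedge_dual (ab n) (\<lambda>x. \<psi> (act_ab n (flip n) x)) (\<lambda>x. \<chi> (act_ab n (flip n) x)) ?w
      - wedge_dual (ab n) \<psi> \<chi> ?w)"
    by (rule wedge_dual_mod2[OF comm_group_ab \<psi> \<chi> \<psi>' \<chi>' even(1)[OF \<psi>] even(1)[OF \<chi>]])
      (use h t v in \<open>simp_all add: V_to_hom_closed\<close>)
  moreover have "V_coord n h \<psi> \<chi> (act_V n (flip n) v) =
      wedge_dual (ab n) (\<lambda>x. \<psi> (act_ab n (flip n) x)) (\<lambda>x. \<chi> (act_ab n (flip n) x)) ?w"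
    by (subst V_coord_act[OF flip h \<psi> \<chi> v]) (simp add: inv_flip[OF n] V_coord_def)
  ultimately show ?thesis by presburger
qed

text \<open>Acting by P_u replaces the vector e_0 by e_0 + [u] and each functional e_i^* with i > 0
  by e_i^* - u_i e_0^*, where u_i is the exponent sum; the formula is then
  \<open>wedge_dual_expand\<close> with e_0^* as \<open>\<theta>\<close>.\<close>

lemma V_coord_transv:
  assumes n: "0 < n" and u: "u \<in> tail_words n" and j: "0 < j" "j < n" and k: "0 < k" "k < n"
    and v: "v \<in> carrier (V n)"
  defines "w \<equiv> V_to_hom n v (ab_class n (gen 0)) \<otimes>\<^bsub>ext2 (ab n)\<^esub> V_to_hom n v (ab_class n u)"
  shows "V_coord n (ab_class n (gen 0)) (dual_gen n j) (dual_gen n k) (act_V n (transv n u) v) =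
    gen_coord n j k w - expo k u * gen_coord n j 0 w + expo j u * gen_coord n k 0 w"
proof -
  interpret A: group "aut_free n" by (rule group_aut_free)
  interpret F: group "free_grp n" by (rule group_free_grp)
  note T = transv_aut[OF n u]
  have uc: "u \<in> carrier (free_grp n)" by (rule tail_words_carrier[OF u])
  have e: "ab_class n (gen 0) \<in> carrier (ab n)" using n by simp
  have act_e: "act_ab n (inv\<^bsub>aut_free n\<^esub> transv n u) (ab_class n (gen 0)) =
      ab_class n (gen 0) \<otimes>\<^bsub>ab n\<^esub> ab_class n u"
    using T n u uc by (simp add: act_ab_class transv_gen_0 ab_class_mult)
  have dual: "dual_gen n i (act_ab n (transv n u) a) = dual_gen n i a - expo i u * dual_gen n 0 a"
    if i: "0 < i" and a: "a \<in> carrier (ab n)" for i a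
  proof (rule ab_hom_eq[OF group_integer_group hom_act_ab[OF T dual_gen_hom] _ _ a])
    show "(\<lambda>a. dual_gen n i a - expo i u * dual_gen n 0 a) \<in> hom (ab n) integer_group"
      using hom_mult[OF dual_gen_hom[of n i]] hom_mult[OF dual_gen_hom[of n 0]]
      by (intro homI) (simp_all add: algebra_simps)
    show "dual_gen n i (act_ab n (transv n u) (ab_class n (gen l))) =
        dual_gen n i (ab_class n (gen l)) - expo i u * dual_gen n 0 (ab_class n (gen l))" if "l < n" for l
      using that T n u uc i
      by (cases "l = 0") (simp_all add: act_ab_class inv_transv transv_gen_0 tail_words_inv dual_gen_ab_class
          expo_mult expo_inv transv_tail tail_words_gen)
  qed
  have w: "w \<in> carrier (ext2 (ab n))"
    unfolding w_def using v e uc comm_group_ext2[OF comm_group_ab, of n]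
    by (intro monoid.m_closed V_to_hom_closed) (auto simp: comm_group_def group.is_monoid)
  have "V_to_hom n v (ab_class n (gen 0) \<otimes>\<^bsub>ab n\<^esub> ab_class n u) = w"
    unfolding w_def using e uc by (simp add: hom_mult[OF V_to_hom_mem[OF v]])
  then have "V_coord n (ab_class n (gen 0)) (dual_gen n j) (dual_gen n k) (act_V n (transv n u) v) =
      wedge_dual (ab n) (\<lambda>x. dual_gen n j (act_ab n (transv n u) x)) (\<lambda>x. dual_gen n k (act_ab n (transv n u) x)) w"
    by (subst V_coord_act[OF T e dual_gen_hom dual_gen_hom v]) (simp add: act_e V_coord_def)
  also have "\<dots> = gen_coord n j k w - expo k u * gen_coord n j 0 w + expo j u * gen_coord n k 0 w"
    by (rule wedge_dual_expand[OF comm_group_ab dual_gen_hom dual_gen_hom dual_gen_hom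
          hom_act_ab[OF T dual_gen_hom] dual[OF j(1)] hom_act_ab[OF T dual_gen_hom] dual[OF k(1)] w])
  finally show ?thesis .
qed

text \<open>In \<open>V_coord_transv\<close> both w and the coefficients are affine in [u]. The
  linear contributions of \<open>gen j\<close> and \<open>gen k\<close> cancel against those of
  their product, the constant term is counted 3 - 1 = 2 times, and the mixed terms leave
  \<open>b j\<close> and \<open>b k\<close> with opposite signs.\<close>

lemma V_coord_second_difference:
  assumes n: "0 < n" and j: "0 < j" "j < n" and k: "0 < k" "k < n" and "j \<noteq> k" and v: "v \<in> carrier (V n)"
  defines "c \<equiv> V_coord n (ab_class n (gen 0)) (dual_gen n j) (dual_gen n k)"
    and "b \<equiv> \<lambda>i v. V_coord n (ab_class n (gen i)) (dual_gen n i) (dual_gen n 0) v"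
  shows "c (act_V n (transv n (gen j)) v) + c v + c (act_V n (transv n (gen k)) v)
    - c (act_V n (transv n (gen j \<otimes>\<^bsub>free_grp n\<^esub> gen k)) v) = 2 * c v + b j v - b k v"
proof -
  note tails = tail_words_gen[OF j] tail_words_gen[OF k] tail_words_mult[OF tail_words_gen[OF j] tail_words_gen[OF k]]
  note mult = wedge_dual_mult[OF ab_class_closed[OF gen_closed[OF n]] dual_gen_hom dual_gen_hom]
  have "ab_class n (gen j \<otimes>\<^bsub>free_grp n\<^esub> gen k) = ab_class n (gen j) \<otimes>\<^bsub>ab n\<^esub> ab_class n (gen k)"
    using j k by (simp add: ab_class_mult)
  then have "V_to_hom n v (ab_class n (gen j \<otimes>\<^bsub>free_grp n\<^esub> gen k)) =
      V_to_hom n v (ab_class n (gen j)) \<otimes>\<^bsub>ext2 (ab n)\<^esub> V_to_hom n v (ab_class n (gen k))"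
    using j k by (simp add: hom_mult[OF V_to_hom_mem[OF v]])
  moreover have "V_to_hom n v (ab_class n (gen j)) \<otimes>\<^bsub>ext2 (ab n)\<^esub> V_to_hom n v (ab_class n (gen k))
      \<in> carrier (ext2 (ab n))"
    using v j k comm_group_ext2[OF comm_group_ab, of n]
    by (intro monoid.m_closed V_to_hom_closed) (auto simp: comm_group_def group.is_monoid)
  ultimately show ?thesis
    unfolding c_def b_def
    using n j k v \<open>j \<noteq> k\<close>
    by (simp add: V_coord_transv[OF n _ j k v] tails mult V_to_hom_closed expo_mult V_coord_def[symmetric])
qed

text \<open>The \<open>SOME\<close> in \<open>wedge_dual\<close> inspects its functionals on the
  carrier only, so changing them elsewhere leaves the predicate, and hence the choice, the
  same.\<close>

lemma V_coord_cong:
  assumes "\<And>a. a \<in> carrier (ab n) \<Longrightarrow> \<psi> a = \<psi>' a" "\<And>a. a \<in> carrier (ab n) \<Longrightarrow> \<chi> a = \<chi>' a"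
  shows "V_coord n h \<psi> \<chi> v = V_coord n h \<psi>' \<chi>' v"
  unfolding V_coord_def wedge_dual_def using assms by (simp cong: conj_cong ball_cong)

text \<open>A family of integral functionals on V that is stable under the action. Stability allows
  the laws of the action to be applied behind another automorphism, in the middle of a
  composite.\<close>

definition coordinates :: "nat \<Rightarrow> (V_elem \<Rightarrow> int) set" where
  "coordinates n = {V_coord n h \<psi> \<chi> | h \<psi> \<chi>. h \<in> carrier (ab n) \<and>
     \<psi> \<in> hom (ab n) integer_group \<and> \<chi> \<in> hom (ab n) integer_group}"

lemma coordinates_hom: "k \<in> coordinates n \<Longrightarrow> k \<in> hom (V n) integer_group"
  unfolding coordinates_def using V_coord_hom by blast

lemma act_V_closed:
  "\<sigma> \<in> carrier (aut_free n) \<Longrightarrow> v \<in> carrier (V n) \<Longrightarrow> act_V n \<sigma> v \<in> carrier (V n)"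
  by (rule hom_in_carrier[OF act_V_hom])

lemma coordinates_act:
  assumes k: "k \<in> coordinates n" and \<sigma>: "\<sigma> \<in> carrier (aut_free n)"
  obtains k' where "k' \<in> coordinates n" and "\<And>v. v \<in> carrier (V n) \<Longrightarrow> k (act_V n \<sigma> v) = k' v"
proof -
  interpret A: group "aut_free n" by (rule group_aut_free)
  obtain h \<psi> \<chi> where kdef: "k = V_coord n h \<psi> \<chi>" and h: "h \<in> carrier (ab n)"
    and \<psi>: "\<psi> \<in> hom (ab n) integer_group" and \<chi>: "\<chi> \<in> hom (ab n) integer_group"
    using k unfolding coordinates_def by blast
  have "act_ab n (inv\<^bsub>aut_free n\<^esub> \<sigma>) h \<in> carrier (ab n)"
    using hom_in_carrier[OF act_ab_hom[OF A.inv_closed[OF \<sigma>]] h] .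
  then have "V_coord n (act_ab n (inv\<^bsub>aut_free n\<^esub> \<sigma>) h) (\<lambda>x. \<psi> (act_ab n \<sigma> x)) (\<lambda>x. \<chi> (act_ab n \<sigma> x))
      \<in> coordinates n"
    unfolding coordinates_def using hom_act_ab[OF \<sigma> \<psi>] hom_act_ab[OF \<sigma> \<chi>] by blast
  then show thesis by (rule that) (simp add: kdef V_coord_act[OF \<sigma> h \<psi> \<chi>])
qed

lemma coordinates_act_mult:
  assumes k: "k \<in> coordinates n" and \<sigma>: "\<sigma> \<in> carrier (aut_free n)" and \<tau>: "\<tau> \<in> carrier (aut_free n)"
    and v: "v \<in> carrier (V n)"
  shows "k (act_V n (\<sigma> \<otimes>\<^bsub>aut_free n\<^esub> \<tau>) v) = k (act_V n \<sigma> (act_V n \<tau> v))"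
proof -
  interpret A: group "aut_free n" by (rule group_aut_free)
  obtain h \<psi> \<chi> where kdef: "k = V_coord n h \<psi> \<chi>" and h: "h \<in> carrier (ab n)"
    and \<psi>: "\<psi> \<in> hom (ab n) integer_group" and \<chi>: "\<chi> \<in> hom (ab n) integer_group"
    using k unfolding coordinates_def by blast
  have h': "act_ab n (inv\<^bsub>aut_free n\<^esub> \<sigma>) h \<in> carrier (ab n)"
    using hom_in_carrier[OF act_ab_hom[OF A.inv_closed[OF \<sigma>]] h] .
  have "k (act_V n \<sigma> (act_V n \<tau> v)) =
      V_coord n (act_ab n (inv\<^bsub>aut_free n\<^esub> \<tau>) (act_ab n (inv\<^bsub>aut_free n\<^esub> \<sigma>) h))
        (\<lambda>x. \<psi> (act_ab n \<sigma> (act_ab n \<tau> x))) (\<lambda>x. \<chi> (act_ab n \<sigma> (act_ab n \<tau> x))) v"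
    by (simp add: kdef V_coord_act[OF \<sigma> h \<psi> \<chi> act_V_closed[OF \<tau> v]]
        V_coord_act[OF \<tau> h' hom_act_ab[OF \<sigma> \<psi>] hom_act_ab[OF \<sigma> \<chi>] v])
  also have "act_ab n (inv\<^bsub>aut_free n\<^esub> \<tau>) (act_ab n (inv\<^bsub>aut_free n\<^esub> \<sigma>) h) =
      act_ab n (inv\<^bsub>aut_free n\<^esub> (\<sigma> \<otimes>\<^bsub>aut_free n\<^esub> \<tau>)) h"
    using \<sigma> \<tau> h by (simp add: act_ab_mult A.inv_mult_group)
  also have "V_coord n \<dots> (\<lambda>x. \<psi> (act_ab n \<sigma> (act_ab n \<tau> x))) (\<lambda>x. \<chi> (act_ab n \<sigma> (act_ab n \<tau> x))) v =
      k (act_V n (\<sigma> \<otimes>\<^bsub>aut_free n\<^esub> \<tau>) v)"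
    unfolding kdef V_coord_act[OF A.m_closed[OF \<sigma> \<tau>] h \<psi> \<chi> v]
    by (rule V_coord_cong) (simp_all add: act_ab_mult \<sigma> \<tau>)
  finally show ?thesis by simp
qed

lemma coordinates_act_trivial:
  assumes k: "k \<in> coordinates n" and \<sigma>: "\<sigma> \<in> carrier (aut_free n)"
    and triv: "\<And>h. h \<in> carrier (ab n) \<Longrightarrow> act_ab n \<sigma> h = h" and v: "v \<in> carrier (V n)"
  shows "k (act_V n \<sigma> v) = k v"
proof -
  interpret A: group "aut_free n" by (rule group_aut_free)
  obtain h \<psi> \<chi> where kdef: "k = V_coord n h \<psi> \<chi>" and h: "h \<in> carrier (ab n)"
    and \<psi>: "\<psi> \<in> hom (ab n) integer_group" and \<chi>: "\<chi> \<in> hom (ab n) integer_group"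
    using k unfolding coordinates_def by blast
  have "act_ab n (inv\<^bsub>aut_free n\<^esub> \<sigma>) h = act_ab n (inv\<^bsub>aut_free n\<^esub> \<sigma>) (act_ab n \<sigma> h)"
    using triv[OF h] by simp
  also have "\<dots> = h"
    using act_ab_mult[OF A.inv_closed[OF \<sigma>] \<sigma> h] \<sigma> h by (simp add: act_ab_one)
  finally show ?thesis
    unfolding kdef V_coord_act[OF \<sigma> h \<psi> \<chi> v] by simp (rule V_coord_cong, simp_all add: triv)
qed

section \<open>Coordinates modulo two\<close>

text \<open>Coordinates are pushed into a group \<open>M\<close> of exponent two under \<open>q : L \<rightarrow> M\<close>, so that
  congruences modulo \<open>2 L\<close> become equations.\<close>

locale mod_two =
  fixes L :: "('a, 'm) ring_scheme" and M :: "'b monoid" and q :: "'a \<Rightarrow> 'b"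
  assumes add_L: "comm_group (add_monoid L)" and comm_group_M: "comm_group M"
    and q_hom: "q \<in> hom (add_monoid L) M"
    and square: "x \<in> carrier M \<Longrightarrow> x \<otimes>\<^bsub>M\<^esub> x = \<one>\<^bsub>M\<^esub>"
begin

sublocale M: comm_group M by (rule comm_group_M)

text \<open>The homomorphism from V_L to M that sends the tensor of v and l to k(v) times q(l), in
  additive terms: an integral functional on V combined with the reduction of the
  coefficients.\<close>

definition VL_coord :: "nat \<Rightarrow> (V_elem \<Rightarrow> int) \<Rightarrow> (V_elem \<times> 'a \<Rightarrow>\<^sub>0 int) set \<Rightarrow> 'b" where
  "VL_coord n k = tensor_lift (V n) (add_monoid L) M (\<lambda>v l. q l [^]\<^bsub>M\<^esub> k v)"

lemma q_closed [simp]: "l \<in> carrier L \<Longrightarrow> q l \<in> carrier M"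
  using hom_in_carrier[OF q_hom, of l] by simp

lemma square_cancel [simp]: "x \<in> carrier M \<Longrightarrow> y \<in> carrier M \<Longrightarrow> x \<otimes>\<^bsub>M\<^esub> (x \<otimes>\<^bsub>M\<^esub> y) = y"
  by (simp add: square flip: M.m_assoc)

lemma inv_eq_self: "x \<in> carrier M \<Longrightarrow> inv\<^bsub>M\<^esub> x = x"
  by (rule M.inv_equality) (simp_all add: square)

lemma pow_mod_two:
  assumes "x \<in> carrier M" "even (i - j :: int)" shows "x [^]\<^bsub>M\<^esub> i = x [^]\<^bsub>M\<^esub> j"
proof -
  obtain m where "i = j + (m + m)" using assms(2) by (metis add_diff_cancel_left' diff_add_cancel evenE mult_2 add.commute)
  then have "x [^]\<^bsub>M\<^esub> i = x [^]\<^bsub>M\<^esub> j \<otimes>\<^bsub>M\<^esub> (x [^]\<^bsub>M\<^esub> m \<otimes>\<^bsub>M\<^esub> x [^]\<^bsub>M\<^esub> m)"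
    using assms(1) by (simp only: M.int_pow_mult)
  then show ?thesis using assms(1) by (simp add: square)
qed

lemma
  assumes k: "k \<in> hom (V n) integer_group"
  shows VL_coord_hom: "VL_coord n k \<in> hom (VL n L) M"
    and VL_coord_pure: "v \<in> carrier (V n) \<Longrightarrow> l \<in> carrier L \<Longrightarrow>
      VL_coord n k (pure (V n) (add_monoid L) v l) = q l [^]\<^bsub>M\<^esub> k v"
proof -
  have "bilinear (V n) (add_monoid L) M (\<lambda>v l. q l [^]\<^bsub>M\<^esub> k v)"
    using hom_mult[OF k] hom_mult[OF q_hom]
    by (intro bilinearI) (simp_all add: M.int_pow_mult M.int_pow_distrib)
  note lift = tensor_lift[OF comm_group_V add_L comm_group_M this]
  show "VL_coord n k \<in> hom (VL n L) M"
    "v \<in> carrier (V n) \<Longrightarrow> l \<in> carrier L \<Longrightarrow>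
      VL_coord n k (pure (V n) (add_monoid L) v l) = q l [^]\<^bsub>M\<^esub> k v"
    using lift unfolding VL_coord_def VL_def by simp_all
qed

lemma VL_hom_eq:
  assumes "f \<in> hom (VL n L) M" "g \<in> hom (VL n L) M"
    and "\<And>v l. v \<in> carrier (V n) \<Longrightarrow> l \<in> carrier L \<Longrightarrow>
      f (pure (V n) (add_monoid L) v l) = g (pure (V n) (add_monoid L) v l)"
    and "x \<in> carrier (VL n L)"
  shows "f x = g x"
  by (rule tensor_hom_eq[OF comm_group_V add_L M.is_group assms(1,2)[unfolded VL_def] _ assms(4)[unfolded VL_def]])
    (simp add: assms(3))

text \<open>M has exponent two, so only the parity of \<open>k\<close> matters. Here congruences
  between integral coordinates become equations in M.\<close>

lemma VL_coord_mod_two: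
  assumes k: "k \<in> hom (V n) integer_group" and k': "k' \<in> hom (V n) integer_group"
    and "\<And>v. v \<in> carrier (V n) \<Longrightarrow> even (k v - k' v)" and x: "x \<in> carrier (VL n L)"
  shows "VL_coord n k x = VL_coord n k' x"
  by (rule VL_hom_eq[OF VL_coord_hom[OF k] VL_coord_hom[OF k'] _ x])
    (simp add: VL_coord_pure k k' pow_mod_two[OF _ assms(3)])

lemma VL_coord_add:
  assumes k: "k \<in> hom (V n) integer_group" and k': "k' \<in> hom (V n) integer_group"
    and x: "x \<in> carrier (VL n L)"
  shows "VL_coord n (\<lambda>v. k v + k' v) x = VL_coord n k x \<otimes>\<^bsub>M\<^esub> VL_coord n k' x"
proof -
  have kk': "(\<lambda>v. k v + k' v) \<in> hom (V n) integer_group"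
    using hom_mult[OF k] hom_mult[OF k'] by (intro homI) simp_all
  show ?thesis
    by (rule VL_hom_eq[OF VL_coord_hom[OF kk'] M.hom_group_mult[OF VL_coord_hom[OF k] VL_coord_hom[OF k']] _ x])
      (simp add: VL_coord_pure k k' kk' M.int_pow_mult)
qed

lemma
  assumes "\<sigma> \<in> carrier (aut_free n)"
  shows act_VL_hom: "act_VL n L \<sigma> \<in> hom (VL n L) (VL n L)"
    and act_VL_pure: "v \<in> carrier (V n) \<Longrightarrow> l \<in> carrier L \<Longrightarrow>
      act_VL n L \<sigma> (pure (V n) (add_monoid L) v l) = pure (V n) (add_monoid L) (act_V n \<sigma> v) l"
proof -
  have "(\<lambda>l. l) \<in> hom (add_monoid L) (add_monoid L)" by (simp add: hom_def)
  from tensor_map[OF comm_group_V add_L act_V_hom[OF assms] this]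
  show "act_VL n L \<sigma> \<in> hom (VL n L) (VL n L)" "v \<in> carrier (V n) \<Longrightarrow> l \<in> carrier L \<Longrightarrow>
      act_VL n L \<sigma> (pure (V n) (add_monoid L) v l) = pure (V n) (add_monoid L) (act_V n \<sigma> v) l"
    unfolding act_VL_def VL_def by simp_all
qed

lemma act_VL_closed:
  "\<sigma> \<in> carrier (aut_free n) \<Longrightarrow> x \<in> carrier (VL n L) \<Longrightarrow> act_VL n L \<sigma> x \<in> carrier (VL n L)"
  by (rule hom_in_carrier[OF act_VL_hom])

lemma hom_act_V:
  assumes "\<sigma> \<in> carrier (aut_free n)" "k \<in> hom (V n) integer_group"
  shows "(\<lambda>v. k (act_V n \<sigma> v)) \<in> hom (V n) integer_group"
  using Group.hom_compose[OF act_V_hom[OF assms(1)] assms(2)] by (simp add: comp_def)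

lemma VL_coord_act:
  assumes \<sigma>: "\<sigma> \<in> carrier (aut_free n)" and k: "k \<in> hom (V n) integer_group" and x: "x \<in> carrier (VL n L)"
  shows "VL_coord n k (act_VL n L \<sigma> x) = VL_coord n (\<lambda>v. k (act_V n \<sigma> v)) x"
proof (rule VL_hom_eq[OF _ VL_coord_hom[OF hom_act_V[OF \<sigma> k]] _ x])
  show "(\<lambda>x. VL_coord n k (act_VL n L \<sigma> x)) \<in> hom (VL n L) M"
    using Group.hom_compose[OF act_VL_hom[OF \<sigma>] VL_coord_hom[OF k]] by (simp add: comp_def)
qed (simp add: act_VL_pure[OF \<sigma>] VL_coord_pure k hom_act_V[OF \<sigma> k] act_V_closed[OF \<sigma>])

lemma VL_coord_act_coordinates:
  assumes k: "k \<in> coordinates n" and \<sigma>: "\<sigma> \<in> carrier (aut_free n)"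
  obtains k' where "k' \<in> coordinates n"
    and "\<And>x. x \<in> carrier (VL n L) \<Longrightarrow> VL_coord n k (act_VL n L \<sigma> x) = VL_coord n k' x"
proof -
  obtain k' where k': "k' \<in> coordinates n" "\<And>v. v \<in> carrier (V n) \<Longrightarrow> k (act_V n \<sigma> v) = k' v"
    using coordinates_act[OF k \<sigma>] by blast
  have "VL_coord n k (act_VL n L \<sigma> x) = VL_coord n k' x" if "x \<in> carrier (VL n L)" for x
    unfolding VL_coord_act[OF \<sigma> coordinates_hom[OF k] that]
    by (rule VL_coord_mod_two[OF hom_act_V[OF \<sigma> coordinates_hom[OF k]] coordinates_hom[OF k'(1)] _ that])
      (simp add: k'(2))
  then show thesis by (rule that[OF k'(1)])
qed

lemma VL_coord_act_mult:
  assumes k: "k \<in> coordinates n" and \<sigma>: "\<sigma> \<in> carrier (aut_free n)" and \<tau>: "\<tau> \<in> carrier (aut_free n)"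
    and x: "x \<in> carrier (VL n L)"
  shows "VL_coord n k (act_VL n L (\<sigma> \<otimes>\<^bsub>aut_free n\<^esub> \<tau>) x) = VL_coord n k (act_VL n L \<sigma> (act_VL n L \<tau> x))"
proof -
  interpret A: group "aut_free n" by (rule group_aut_free)
  note hom = coordinates_hom[OF k]
  have "VL_coord n k (act_VL n L \<sigma> (act_VL n L \<tau> x)) = VL_coord n (\<lambda>v. k (act_V n \<sigma> (act_V n \<tau> v))) x"
    by (simp add: VL_coord_act \<sigma> \<tau> x hom hom_act_V act_VL_closed)
  also have "\<dots> = VL_coord n (\<lambda>v. k (act_V n (\<sigma> \<otimes>\<^bsub>aut_free n\<^esub> \<tau>) v)) x"
    by (rule VL_coord_mod_two[OF hom_act_V[OF \<tau> hom_act_V[OF \<sigma> hom]] hom_act_V[OF A.m_closed[OF \<sigma> \<tau>] hom] _ x])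
      (simp add: coordinates_act_mult[OF k \<sigma> \<tau>])
  also have "\<dots> = VL_coord n k (act_VL n L (\<sigma> \<otimes>\<^bsub>aut_free n\<^esub> \<tau>) x)"
    by (simp add: VL_coord_act \<sigma> \<tau> x hom)
  finally show ?thesis by simp
qed

lemma VL_coord_act_trivial:
  assumes k: "k \<in> coordinates n" and \<sigma>: "\<sigma> \<in> carrier (aut_free n)"
    and triv: "\<And>h. h \<in> carrier (ab n) \<Longrightarrow> act_ab n \<sigma> h = h" and x: "x \<in> carrier (VL n L)"
  shows "VL_coord n k (act_VL n L \<sigma> x) = VL_coord n k x"
  unfolding VL_coord_act[OF \<sigma> coordinates_hom[OF k] x]
  by (rule VL_coord_mod_two[OF hom_act_V[OF \<sigma> coordinates_hom[OF k]] coordinates_hom[OF k] _ x])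
    (simp add: coordinates_act_trivial[OF k \<sigma> triv])

lemma VL_coord_act_one:
  assumes k: "k \<in> coordinates n" and x: "x \<in> carrier (VL n L)"
  shows "VL_coord n k (act_VL n L \<one>\<^bsub>aut_free n\<^esub> x) = VL_coord n k x"
  by (rule VL_coord_act_trivial[OF k _ act_ab_one x])
    (simp_all add: monoid.one_closed group.is_monoid group_aut_free)

lemma VL_coord_act_flip:
  assumes n: "0 < n" and k: "k \<in> coordinates n" and x: "x \<in> carrier (VL n L)"
  shows "VL_coord n k (act_VL n L (flip n) x) = VL_coord n k x"
  unfolding VL_coord_act[OF flip_aut[OF n] coordinates_hom[OF k] x]
  by (rule VL_coord_mod_two[OF hom_act_V[OF flip_aut[OF n] coordinates_hom[OF k]] coordinates_hom[OF k] _ x])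
    (use k V_coord_flip[OF n] in \<open>auto simp: coordinates_def\<close>)

text \<open>A coordinate composed with \<open>\<tau>\<close> is again a coordinate, so the
  triviality of the flip modulo two applies behind \<open>\<tau>\<close>.\<close>

lemma VL_coord_act_conj_flip:
  assumes n: "0 < n" and k: "k \<in> coordinates n" and \<tau>: "\<tau> \<in> carrier (aut_free n)"
    and x: "x \<in> carrier (VL n L)"
  shows "VL_coord n k (act_VL n L (\<tau> \<otimes>\<^bsub>aut_free n\<^esub> flip n) x) = VL_coord n k (act_VL n L \<tau> x)"
proof -
  obtain k' where k': "k' \<in> coordinates n"
    "\<And>x. x \<in> carrier (VL n L) \<Longrightarrow> VL_coord n k (act_VL n L \<tau> x) = VL_coord n k' x"
    using VL_coord_act_coordinates[OF k \<tau>] by blast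
  show ?thesis
    using x by (simp add: VL_coord_act_mult[OF k \<tau> flip_aut[OF n]] k' act_VL_closed flip_aut[OF n]
        VL_coord_act_flip[OF n])
qed

text \<open>Modulo two the flip drops out of P_u D P_u^-1, leaving P_u P_u^-1.\<close>

lemma VL_coord_act_reflection:
  assumes n: "0 < n" and k: "k \<in> coordinates n" and u: "u \<in> tail_words n" and x: "x \<in> carrier (VL n L)"
  shows "VL_coord n k (act_VL n L (reflection n u) x) = VL_coord n k x"
proof -
  interpret A: group "aut_free n" by (rule group_aut_free)
  note T = transv_aut[OF n u] and D = flip_aut[OF n]
  have "VL_coord n k (act_VL n L (reflection n u) x) =
      VL_coord n k (act_VL n L (transv n u \<otimes>\<^bsub>aut_free n\<^esub> flip n) (act_VL n L (inv\<^bsub>aut_free n\<^esub> transv n u) x))"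
    using T D x unfolding reflection_def[OF n] by (intro VL_coord_act_mult[OF k]) simp_all
  also have "\<dots> = VL_coord n k (act_VL n L (transv n u) (act_VL n L (inv\<^bsub>aut_free n\<^esub> transv n u) x))"
    using T x by (intro VL_coord_act_conj_flip[OF n k]) (simp_all add: act_VL_closed)
  also have "\<dots> = VL_coord n k (act_VL n L (transv n u \<otimes>\<^bsub>aut_free n\<^esub> inv\<^bsub>aut_free n\<^esub> transv n u) x)"
    using T x by (intro VL_coord_act_mult[OF k, symmetric]) simp_all
  also have "\<dots> = VL_coord n k x" using T x by (simp add: VL_coord_act_one[OF k])
  finally show ?thesis .
qed

section \<open>Crossed homomorphisms read modulo two\<close>

context
  fixes n :: nat and f
  assumes n: "0 < n" and f: "f \<in> crossed_homs (aut_free n) (VL n L) (act_VL n L)"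
begin

interpretation A: group "aut_free n" by (rule group_aut_free)

lemma crossed_closed: "\<sigma> \<in> carrier (aut_free n) \<Longrightarrow> f \<sigma> \<in> carrier (VL n L)"
  using f by (auto simp: crossed_homs_def)

lemma VL_coord_closed [simp]: "k \<in> coordinates n \<Longrightarrow> x \<in> carrier (VL n L) \<Longrightarrow> VL_coord n k x \<in> carrier M"
  using hom_in_carrier[OF VL_coord_hom[OF coordinates_hom]] .

lemma crossed_mult:
  assumes k: "k \<in> coordinates n" and \<sigma>: "\<sigma> \<in> carrier (aut_free n)" and \<tau>: "\<tau> \<in> carrier (aut_free n)"
  shows "VL_coord n k (f (\<sigma> \<otimes>\<^bsub>aut_free n\<^esub> \<tau>)) = VL_coord n k (f \<sigma>) \<otimes>\<^bsub>M\<^esub> VL_coord n k (act_VL n L \<sigma> (f \<tau>))"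
proof -
  have "f (\<sigma> \<otimes>\<^bsub>aut_free n\<^esub> \<tau>) = f \<sigma> \<otimes>\<^bsub>VL n L\<^esub> act_VL n L \<sigma> (f \<tau>)"
    using f \<sigma> \<tau> by (auto simp: crossed_homs_def)
  then show ?thesis
    using hom_mult[OF VL_coord_hom[OF coordinates_hom[OF k]]] \<sigma> \<tau> by (simp add: crossed_closed act_VL_closed)
qed

lemma crossed_one: "k \<in> coordinates n \<Longrightarrow> VL_coord n k (f \<one>\<^bsub>aut_free n\<^esub>) = \<one>\<^bsub>M\<^esub>"
  using crossed_mult[of k "\<one>\<^bsub>aut_free n\<^esub>" "\<one>\<^bsub>aut_free n\<^esub>"]
  by (simp add: VL_coord_act_one crossed_closed square)

text \<open>Expand f at \<open>\<sigma>\<close> times its inverse, where the coordinates are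
  trivial; in exponent two the resulting minus sign is invisible.\<close>

lemma crossed_inv:
  assumes k: "k \<in> coordinates n" and \<sigma>: "\<sigma> \<in> carrier (aut_free n)"
  shows "VL_coord n k (act_VL n L \<sigma> (f (inv\<^bsub>aut_free n\<^esub> \<sigma>))) = VL_coord n k (f \<sigma>)"
proof -
  have cl: "VL_coord n k (f \<sigma>) \<in> carrier M" "VL_coord n k (act_VL n L \<sigma> (f (inv\<^bsub>aut_free n\<^esub> \<sigma>))) \<in> carrier M"
    using k \<sigma> by (simp_all add: crossed_closed act_VL_closed)
  have "VL_coord n k (f \<sigma>) \<otimes>\<^bsub>M\<^esub> VL_coord n k (act_VL n L \<sigma> (f (inv\<^bsub>aut_free n\<^esub> \<sigma>))) = \<one>\<^bsub>M\<^esub>"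
    using crossed_mult[OF k \<sigma> A.inv_closed[OF \<sigma>]] crossed_one[OF k] \<sigma> by simp
  then show ?thesis using square_cancel[OF cl] cl by simp
qed

lemma crossed_reflection:
  assumes k: "k \<in> coordinates n" and u: "u \<in> tail_words n"
  shows "VL_coord n k (f (reflection n u)) = VL_coord n k (act_VL n L (transv n u) (f (flip n)))"
proof -
  note T = transv_aut[OF n u] and D = flip_aut[OF n]
  have "VL_coord n k (f (reflection n u)) = VL_coord n k (f (transv n u \<otimes>\<^bsub>aut_free n\<^esub> flip n)) \<otimes>\<^bsub>M\<^esub>
      VL_coord n k (act_VL n L (transv n u) (f (inv\<^bsub>aut_free n\<^esub> transv n u)))"
    using T D by (simp add: reflection_def[OF n] crossed_mult[OF k] VL_coord_act_conj_flip[OF n k] crossed_closed)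
  also have "\<dots> = VL_coord n k (f (transv n u)) \<otimes>\<^bsub>M\<^esub>
      (VL_coord n k (act_VL n L (transv n u) (f (flip n))) \<otimes>\<^bsub>M\<^esub> VL_coord n k (f (transv n u)))"
    using T D k by (simp add: crossed_inv crossed_mult crossed_closed act_VL_closed M.m_assoc)
  also have "\<dots> = VL_coord n k (act_VL n L (transv n u) (f (flip n)))"
    using T D k by (subst M.m_comm[of "VL_coord n k (act_VL n L (transv n u) (f (flip n)))"])
      (simp_all add: crossed_closed act_VL_closed)
  finally show ?thesis .
qed

text \<open>Apply f to both sides of \<open>reflection_relation\<close>. Every automorphism that
  stands in front of a value of f acts trivially on coordinates: reflections and the flip modulo
  two, the commutator transvection because it acts trivially on H.\<close>

lemma crossed_relation:
  assumes k: "k \<in> coordinates n" and a: "a \<in> tail_words n" and b: "b \<in> tail_words n"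
  shows "VL_coord n k (f (transv n (commutator (free_grp n) (inv\<^bsub>free_grp n\<^esub> b) (inv\<^bsub>free_grp n\<^esub> a)))) =
    VL_coord n k (act_VL n L (transv n a) (f (flip n))) \<otimes>\<^bsub>M\<^esub> (VL_coord n k (f (flip n)) \<otimes>\<^bsub>M\<^esub>
    (VL_coord n k (act_VL n L (transv n b) (f (flip n))) \<otimes>\<^bsub>M\<^esub>
     VL_coord n k (act_VL n L (transv n (a \<otimes>\<^bsub>free_grp n\<^esub> b)) (f (flip n)))))"
    (is "?C = ?A \<otimes>\<^bsub>M\<^esub> (?D \<otimes>\<^bsub>M\<^esub> (?B \<otimes>\<^bsub>M\<^esub> ?E))")
proof -
  let ?c = "commutator (free_grp n) (inv\<^bsub>free_grp n\<^esub> b) (inv\<^bsub>free_grp n\<^esub> a)"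
  note D = flip_aut[OF n]
  have ab: "a \<otimes>\<^bsub>free_grp n\<^esub> b \<in> tail_words n" using a b by (rule tail_words_mult)
  have c: "?c \<in> tail_words n"
    using a b by (simp add: commutator_def tail_words_mult tail_words_inv)
  have c': "?c \<in> comm_sub n"
    using tail_words_carrier[OF tail_words_inv[OF a]] tail_words_carrier[OF tail_words_inv[OF b]]
    by (intro commutator_comm_sub)
  note auts = reflection_aut[OF n a] reflection_aut[OF n b] reflection_aut[OF n ab] transv_aut[OF n c]
    transv_aut[OF n a] transv_aut[OF n b] transv_aut[OF n ab] D
  have cl: "?A \<in> carrier M" "?B \<in> carrier M" "?C \<in> carrier M" "?D \<in> carrier M" "?E \<in> carrier M"
    using auts k by (simp_all add: crossed_closed act_VL_closed)
  have "VL_coord n k (f (reflection n a \<otimes>\<^bsub>aut_free n\<^esub> (flip n \<otimes>\<^bsub>aut_free n\<^esub> reflection n b))) = ?A \<otimes>\<^bsub>M\<^esub> (?D \<otimes>\<^bsub>M\<^esub> ?B)"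
    using auts
    by (simp add: crossed_mult[OF k] crossed_reflection[OF k] a b VL_coord_act_reflection[OF n k]
        VL_coord_act_flip[OF n k] crossed_closed)
  moreover have "VL_coord n k (f (transv n ?c \<otimes>\<^bsub>aut_free n\<^esub> reflection n (a \<otimes>\<^bsub>free_grp n\<^esub> b))) = ?C \<otimes>\<^bsub>M\<^esub> ?E"
    using auts
    by (simp add: crossed_mult[OF k] crossed_reflection[OF k ab] crossed_closed
        VL_coord_act_trivial[OF k] act_ab_transv[OF n c c'])
  ultimately have "?C \<otimes>\<^bsub>M\<^esub> ?E = ?A \<otimes>\<^bsub>M\<^esub> (?D \<otimes>\<^bsub>M\<^esub> ?B)"
    using reflection_relation[OF n a b] by simp
  \<comment> \<open>Multiplying by \<open>?E\<close> once more removes it on the left, since it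
    squares to the identity.\<close>
  then have "(?C \<otimes>\<^bsub>M\<^esub> ?E) \<otimes>\<^bsub>M\<^esub> ?E = ?A \<otimes>\<^bsub>M\<^esub> (?D \<otimes>\<^bsub>M\<^esub> (?B \<otimes>\<^bsub>M\<^esub> ?E))"
    using cl by (simp add: M.m_assoc)
  then show ?thesis using cl by (simp add: M.m_assoc square)
qed

lemma crossed_johnson_relation:
  assumes johnson: "\<And>\<sigma>. \<sigma> \<in> IA n \<Longrightarrow> f \<sigma> = johnson_L n L \<sigma>" and one: "\<one>\<^bsub>L\<^esub> \<in> carrier L"
    and j: "0 < j" "j < n" and k: "0 < k" "k < n" and jk: "j \<noteq> k"
  defines "b \<equiv> \<lambda>i. VL_coord n (V_coord n (ab_class n (gen i)) (dual_gen n i) (dual_gen n 0)) (f (flip n))"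
  shows "q \<one>\<^bsub>L\<^esub> = b j \<otimes>\<^bsub>M\<^esub> b k"
proof -
  interpret F: group "free_grp n" by (rule group_free_grp)
  interpret E: comm_group "ext2 (ab n)" by (rule comm_group_ext2[OF comm_group_ab])
  let ?x = "f (flip n)" and ?e = "ab_class n (gen 0)"
  let ?c = "V_coord n ?e (dual_gen n j) (dual_gen n k)"
  let ?b = "\<lambda>i. V_coord n (ab_class n (gen i)) (dual_gen n i) (dual_gen n 0)"
  let ?T = "\<lambda>u v. ?c (act_V n (transv n u) v)"
  let ?w = "commutator (free_grp n) (inv\<^bsub>free_grp n\<^esub> gen k) (inv\<^bsub>free_grp n\<^esub> gen j)"
  have e: "?e \<in> carrier (ab n)" using n by simp
  have c: "?c \<in> coordinates n" using e dual_gen_hom unfolding coordinates_def by blast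
  have tj: "gen j \<in> tail_words n" and tk: "gen k \<in> tail_words n" using j k by (simp_all add: tail_words_gen)
  note tails = tj tk tail_words_mult[OF tj tk] tail_words_inv[OF tj] tail_words_inv[OF tk]
  have w: "?w \<in> tail_words n" using tails by (simp add: commutator_def tail_words_mult tail_words_inv)
  have w': "?w \<in> comm_sub n" using j k by (intro commutator_comm_sub) simp_all
  have x: "?x \<in> carrier (VL n L)" by (rule crossed_closed[OF flip_aut[OF n]])
  have chom: "?c \<in> hom (V n) integer_group" by (rule coordinates_hom[OF c])
  have Thom: "?T u \<in> hom (V n) integer_group" if "u \<in> tail_words n" for u
    by (rule hom_act_V[OF transv_aut[OF n that] chom])
  have bhom: "?b i \<in> hom (V n) integer_group" if "i < n" for i
    using that by (intro V_coord_hom dual_gen_hom) simp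
  have add_hom: "(\<lambda>v. p v + r v) \<in> hom (V n) integer_group"
    if "p \<in> hom (V n) integer_group" "r \<in> hom (V n) integer_group" for p r :: "V_elem \<Rightarrow> int"
    using hom_mult[OF that(1)] hom_mult[OF that(2)] by (intro homI) simp_all
  \<comment> \<open>At e_0 the functional \<open>dual_gen n 0\<close> takes the value 1, so the
    power of the wedge is the wedge itself.\<close>
  have "V_to_hom n (johnson n (transv n ?w)) ?e =
      wedge (ab n) (ab_class n (inv\<^bsub>free_grp n\<^esub> gen k)) (ab_class n (inv\<^bsub>free_grp n\<^esub> gen j))"
    using V_to_hom_johnson_transv(2)[OF n tails(5,4)] e n tails
    by (simp add: dual_gen_ab_class tail_words_carrier)
  \<comment> \<open>The signs of the two inverses cancel, leaving e_k wedge e_j, which is minus e_j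
    wedge e_k.\<close>
  then have "?c (johnson n (transv n ?w)) = - 1"
    using tails j k jk by (simp add: V_coord_def gen_coord_wedge tail_words_carrier expo_inv)
  moreover have "VL_coord n ?c (f (transv n ?w)) = q \<one>\<^bsub>L\<^esub> [^]\<^bsub>M\<^esub> ?c (johnson n (transv n ?w))"
    using johnson[OF transv_IA[OF n w w']] V_to_hom_johnson_transv(1)[OF n tails(5,4)] one
    by (simp add: johnson_L_def VL_coord_pure[OF chom])
  \<comment> \<open>The exponent -1 turns into 1, as inversion is the identity in M.\<close>
  ultimately have "q \<one>\<^bsub>L\<^esub> = VL_coord n ?c (f (transv n ?w))"
    using one by (simp add: M.int_pow_neg inv_eq_self)
  also have "\<dots> = VL_coord n (?T (gen j)) ?x \<otimes>\<^bsub>M\<^esub> (VL_coord n ?c ?x \<otimes>\<^bsub>M\<^esub>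
      (VL_coord n (?T (gen k)) ?x \<otimes>\<^bsub>M\<^esub> VL_coord n (?T (gen j \<otimes>\<^bsub>free_grp n\<^esub> gen k)) ?x))"
    using tails by (simp add: crossed_relation[OF c tj tk] VL_coord_act[OF _ chom x] transv_aut[OF n])
  also have "\<dots> = VL_coord n (\<lambda>v. ?T (gen j) v + (?c v + (?T (gen k) v + ?T (gen j \<otimes>\<^bsub>free_grp n\<^esub> gen k) v))) ?x"
    using tails by (simp add: VL_coord_add[OF _ _ x] add_hom Thom chom)
  also have "\<dots> = VL_coord n (\<lambda>v. ?b j v + ?b k v) ?x"
  proof (rule VL_coord_mod_two[OF _ _ _ x])
    \<comment> \<open>The second difference equals 2 c + b_j - b_k; modulo two the first term
      vanishes and all signs can be changed.\<close>
    show "even ((?T (gen j) v + (?c v + (?T (gen k) v + ?T (gen j \<otimes>\<^bsub>free_grp n\<^esub> gen k) v)))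
        - (?b j v + ?b k v))" if "v \<in> carrier (V n)" for v
      using V_coord_second_difference[OF n j k jk that] by presburger
  qed (use tails j k in \<open>simp_all add: add_hom Thom chom bhom\<close>)
  also have "\<dots> = b j \<otimes>\<^bsub>M\<^esub> b k"
    unfolding b_def using j k by (intro VL_coord_add bhom x)
  finally show ?thesis .
qed

end

lemma no_crossed_hom_extending_johnson:
  assumes n: "4 \<le> n" and one: "\<one>\<^bsub>L\<^esub> \<in> carrier L" and q_one: "q \<one>\<^bsub>L\<^esub> \<noteq> \<one>\<^bsub>M\<^esub>"
    and f: "f \<in> crossed_homs (aut_free n) (VL n L) (act_VL n L)"
  shows "\<exists>\<sigma>\<in>IA n. f \<sigma> \<noteq> johnson_L n L \<sigma>"
proof (rule ccontr)
  assume "\<not> ?thesis"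
  then have johnson: "f \<sigma> = johnson_L n L \<sigma>" if "\<sigma> \<in> IA n" for \<sigma> using that by blast
  have n0: "0 < n" using n by simp
  define b where "b i = VL_coord n (V_coord n (ab_class n (gen i)) (dual_gen n i) (dual_gen n 0)) (f (flip n))" for i
  have cl: "b i \<in> carrier M" if "i < n" for i
    unfolding b_def using that
    by (intro hom_in_carrier[OF VL_coord_hom[OF V_coord_hom[OF _ dual_gen_hom dual_gen_hom]]]
        crossed_closed[OF n0 f flip_aut[OF n0]]) simp
  note rel = crossed_johnson_relation[OF n0 f johnson one, folded b_def]
  have "q \<one>\<^bsub>L\<^esub> = b 1 \<otimes>\<^bsub>M\<^esub> b 2" "q \<one>\<^bsub>L\<^esub> = b 2 \<otimes>\<^bsub>M\<^esub> b 3" "q \<one>\<^bsub>L\<^esub> = b 1 \<otimes>\<^bsub>M\<^esub> b 3"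
    using n by (auto intro!: rel)
  then have "q \<one>\<^bsub>L\<^esub> \<otimes>\<^bsub>M\<^esub> q \<one>\<^bsub>L\<^esub> = (b 1 \<otimes>\<^bsub>M\<^esub> b 2) \<otimes>\<^bsub>M\<^esub> (b 2 \<otimes>\<^bsub>M\<^esub> b 3)" "q \<one>\<^bsub>L\<^esub> = b 1 \<otimes>\<^bsub>M\<^esub> b 3"
    by simp_all
  \<comment> \<open>\<open>b 2\<close> cancels, so the relations for (1, 2) and (2, 3) combine to
    the right-hand side of the one for (1, 3).\<close>
  moreover have "(b 1 \<otimes>\<^bsub>M\<^esub> b 2) \<otimes>\<^bsub>M\<^esub> (b 2 \<otimes>\<^bsub>M\<^esub> b 3) = b 1 \<otimes>\<^bsub>M\<^esub> b 3"
    using cl[of 1] cl[of 2] cl[of 3] n by (simp add: M.m_assoc)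
  moreover have "q \<one>\<^bsub>L\<^esub> \<otimes>\<^bsub>M\<^esub> q \<one>\<^bsub>L\<^esub> = \<one>\<^bsub>M\<^esub>" using one by (simp add: square)
  ultimately show False using q_one by metis
qed

end

theorem corollary1:
  fixes L :: "('a, 'm) ring_scheme" (structure) and n :: nat
  assumes "principal_domain L"
    and no_2_torsion: "\<And>a. a \<in> carrier L \<Longrightarrow> [(2::nat)] \<cdot> a = \<zero> \<Longrightarrow> a = \<zero>"
    and two_not_invertible: "[(2::nat)] \<cdot> \<one> \<notin> Units L"
    and "n \<ge> 5"
  shows "\<not> (\<exists>f \<in> crossed_homs (aut_free n) (VL n L) (act_VL n L).
              \<forall>\<sigma> \<in> IA n. f \<sigma> = johnson_L n L \<sigma>)"
proof
  assume "\<exists>f \<in> crossed_homs (aut_free n) (VL n L) (act_VL n L). \<forall>\<sigma> \<in> IA n. f \<sigma> = johnson_L n L \<sigma>"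
  then obtain f where f: "f \<in> crossed_homs (aut_free n) (VL n L) (act_VL n L)"
    and johnson: "\<And>\<sigma>. \<sigma> \<in> IA n \<Longrightarrow> f \<sigma> = johnson_L n L \<sigma>" by blast
  interpret principal_domain L by fact
  \<comment> \<open>This is 2 L. The additive quotient L / 2 L has exponent two and becomes the
    group \<open>M\<close> of the locale, with \<open>q\<close> the projection.\<close>
  define I where "I = {x \<oplus> x | x. x \<in> carrier L}"
  let ?A = "add_monoid L"
  let ?M = "?A Mod I"
  have I: "subgroup I ?A"
  proof (rule add.subgroupI)
    show "I \<subseteq> carrier L" "I \<noteq> {}" by (auto simp: I_def)
    show "\<ominus> a \<in> I" if "a \<in> I" for a
    proof -
      obtain x where "x \<in> carrier L" "a = x \<oplus> x" using \<open>a \<in> I\<close> by (auto simp: I_def)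
      then have "\<ominus> a = \<ominus> x \<oplus> \<ominus> x" "\<ominus> x \<in> carrier L" by (simp_all add: minus_add)
      then show ?thesis unfolding I_def by blast
    qed
    show "a \<oplus> b \<in> I" if "a \<in> I" "b \<in> I" for a b
    proof -
      obtain x y where "x \<in> carrier L" "a = x \<oplus> x" "y \<in> carrier L" "b = y \<oplus> y"
        using \<open>a \<in> I\<close> \<open>b \<in> I\<close> by (auto simp: I_def)
      then have "a \<oplus> b = (x \<oplus> y) \<oplus> (x \<oplus> y)" "x \<oplus> y \<in> carrier L" by (simp_all add: a_ac)
      then show ?thesis unfolding I_def by blast
    qed
  qed
  have I_normal: "I \<lhd> ?A" using I by (simp add: add.normal_iff_subgroup)
  interpret mod_two L ?M "\<lambda>x. I #>\<^bsub>?A\<^esub> x"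
  proof (rule mod_two.intro)
    show "comm_group ?A" by (rule a_comm_group)
    show "comm_group ?M" by (rule comm_group.abelian_FactGroup[OF a_comm_group I])
    show q: "(\<lambda>x. I #>\<^bsub>?A\<^esub> x) \<in> hom ?A ?M" by (rule normal.r_coset_hom_Mod[OF I_normal])
    show "x \<otimes>\<^bsub>?M\<^esub> x = \<one>\<^bsub>?M\<^esub>" if "x \<in> carrier ?M" for x
    proof -
      obtain l where l: "l \<in> carrier L" "x = I #>\<^bsub>?A\<^esub> l" using \<open>x \<in> carrier ?M\<close> by (auto simp: carrier_FactGroup)
      then have "x \<otimes>\<^bsub>?M\<^esub> x = I #>\<^bsub>?A\<^esub> (l \<oplus> l)" using hom_mult[OF q, of l l] by simp
      also have "\<dots> = I" using l normal.rcos_eq_iff[OF I_normal, of "l \<oplus> l"] by (auto simp: I_def)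
      finally show ?thesis by simp
    qed
  qed
  \<comment> \<open>If 1 were trivial modulo 2 L, then 1 = x + x for some x, and this x would be an
    inverse of 2.\<close>
  have "I #>\<^bsub>?A\<^esub> \<one> \<noteq> \<one>\<^bsub>?M\<^esub>"
  proof
    assume "I #>\<^bsub>?A\<^esub> \<one> = \<one>\<^bsub>?M\<^esub>"
    then have "\<one> \<in> I" using normal.rcos_eq_iff[OF I_normal, of \<one>] by simp
    then obtain x where x: "x \<in> carrier L" "\<one> = x \<oplus> x" by (auto simp: I_def)
    have "[(2::nat)] \<cdot> \<one> = \<one> \<oplus> \<one>" by (simp add: numeral_2_eq_2)
    then have "[(2::nat)] \<cdot> \<one> \<otimes> x = x \<oplus> x" using x(1) by (simp add: l_distr)
    then have "[(2::nat)] \<cdot> \<one> \<otimes> x = \<one>" using x(2) by simp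
    then have "[(2::nat)] \<cdot> \<one> \<in> Units L" using x(1) unfolding Units_def by (auto simp: m_comm)
    with two_not_invertible show False by contradiction
  qed
  from no_crossed_hom_extending_johnson[OF _ one_closed this f] \<open>n \<ge> 5\<close> johnson show False by auto
qed

end
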